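(* Let $(A,\rho)$ be a faithful tracial $\mathrm{C}^*$-probability space, and let $L=(L_n)_{n=0}^\infty$ be a filtration of $A$ with the rapid decay property. Then $H_L^\infty(A,\rho)$ is closed under the smooth functional calculus of $A$. More precisely, fix rapid decay constants $C,\alpha>0$, i.e. constants such that $\|b\|\le C(m+1)^{\alpha}\|\hat b\|_2$ for all $m\in\mathbb N$ and all $b\in L_m$. For every $n\in\mathbb N$ there is a constant $K_n>0$ such that, for every $a=a^*\in H_L^\infty(A,\rho)$ and every $f\in C_c^\infty(\mathbb R)$, the integral $$f(a)=\frac{1}{2\pi}\int_{\mathbb R}\widehat f(t)\,e^{ita}\,dt$$ converges in every subspace $H_L^n(A,\rho)$ (with value the element $f(a)$ given by the continuous functional calculus of $A$), and $$\|f(a)\|_{H_L^n}\leq K_n\bigl(1+\|a\|_{H_L^{\alpha+n+1}}\bigr)^n \int_{\mathbb R}|\widehat f(t)|(1+|t|)^n\,dt.$$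
   Context: Conventions: $\mathbb N=\{0,1,2,\dots\}$. For $f\in C_c^\infty(\mathbb R)$, $\widehat f(t)=\int_{\mathbb R}f(s)e^{-its}\,ds$. A $\mathrm{C}^*$-probability space $(A,\rho)$ is a unital $\mathrm{C}^*$-algebra $A$ with a state $\rho$; it is tracial if $\rho(ab)=\rho(ba)$ for all $a,b\in A$, and faithful if $\rho(a^*a)=0$ implies $a=0$. $L^2(A,\rho)$ is the GNS Hilbert space with norm $\|\cdot\|_2$, and $\hat a\in L^2(A,\rho)$ is the vector of $a\in A$, so $\|\hat a\|_2=\rho(a^*a)^{1/2}$. By faithfulness $A$ is identified with the subspace $\{\hat a:a\in A\}\subseteq L^2(A,\rho)$. $\|\cdot\|$ is the $\mathrm{C}^*$-norm. A filtration of $A$ is an increasing sequence $L=(L_n)_{n=0}^\infty$ of linear subspaces of $A$ such that $L_0=\mathbb C1$, each $L_n$ is stable under $*$, $L_nL_k\subseteq L_{n+k}$ for all $n,k$, and $\bigcup_kL_k$ is norm dense in $A$. It has the rapid decay property if there are constants $C>0$, $\alpha>0$ with $\|a\|\le C(n+1)^\alpha\|\hat a\|_2$ for all $n\in\mathbb N$ and $a\in L_n$. For $k\in\mathbb N$ let $q_k$ be the orthogonal projection of $L^2(A,\rho)$ onto the $\|\cdot\|_2$-closure of $L_k$, set $q_{-1}=0$ and $p_k=q_k-q_{k-1}$. For $\xi\in L^2(A,\rho)$ and $s\geq 0$, $$\|\xi\|_{H_L^s}=\Bigl(\sum_{k=0}^\infty(k+1)^{2s}\|p_k(\xi)\|_2^2\Bigr)^{1/2},$$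 $H_L^s(A,\rho)=\{\xi\in L^2(A,\rho):\|\xi\|_{H_L^s}<\infty\}$ (a Banach space with this norm), and $H_L^\infty(A,\rho)=\bigcap_{s>0}H_L^s(A,\rho)$. When $L$ has rapid decay, $H_L^\infty(A,\rho)\subseteq A$ under the identification $a\leftrightarrow\hat a$ (a known fact), so $H_L^\infty(A,\rho)=\{a\in A:\|\hat a\|_{H_L^s}<\infty\text{ for all }s>0\}$; for $a\in A$ one writes $\|a\|_{H_L^s}=\|\hat a\|_{H_L^s}$. "Closed under the smooth functional calculus of $A$" means: for every self-adjoint $a\in H_L^\infty(A,\rho)$ and every $f\in C_c^\infty(\mathbb R)$, the element $f(a)\in A$ given by continuous functional calculus belongs to $H_L^\infty(A,\rho)$. *)

theory Defs
  imports "HOL-Analysis.Analysis"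
begin

section \<open>Complex normed spaces, C*-algebras and Hilbert spaces\<close>

class scaleC =
  fixes scaleC :: "complex \<Rightarrow> 'a \<Rightarrow> 'a"  (infixr \<open>*\<^sub>C\<close> 75)

class complex_normed_vector = real_normed_vector + scaleC +
  assumes scaleC_add_right: "c *\<^sub>C (x + y) = c *\<^sub>C x + c *\<^sub>C y"
    and scaleC_add_left: "(c + d) *\<^sub>C x = c *\<^sub>C x + d *\<^sub>C x"
    and scaleC_scaleC: "c *\<^sub>C d *\<^sub>C x = (c * d) *\<^sub>C x"
    and scaleC_one: "1 *\<^sub>C x = x"
    and scaleR_scaleC: "r *\<^sub>R x = complex_of_real r *\<^sub>C x"
    and norm_scaleC: "norm (c *\<^sub>C x) = cmod c * norm x"

text \<open>Unital C*-algebras. The axiom \<open>norm 1 = 1\<close> of \<^class>\<open>real_normed_algebra_1\<close> excludes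
  only the zero algebra, which has no states.\<close>

class cstar_algebra = complex_normed_vector + real_normed_algebra_1 + banach +
  fixes star :: "'a \<Rightarrow> 'a"
  assumes mult_scaleC_left: "(c *\<^sub>C x) * y = c *\<^sub>C (x * y)"
    and mult_scaleC_right: "x * (c *\<^sub>C y) = c *\<^sub>C (x * y)"
    and star_add: "star (x + y) = star x + star y"
    and star_scaleC: "star (c *\<^sub>C x) = cnj c *\<^sub>C star x"
    and star_mult: "star (x * y) = star y * star x"
    and star_star: "star (star x) = x"
    and norm_star_mult: "norm (star x * x) = (norm x)\<^sup>2"

text \<open>The inner product is linear in the second argument.\<close>

class complex_hilbert_space = complex_normed_vector + banach +
  fixes cinner :: "'a \<Rightarrow> 'a \<Rightarrow> complex"
  assumes cinner_commute: "cinner x y = cnj (cinner y x)"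
    and cinner_add_right: "cinner x (y + z) = cinner x y + cinner x z"
    and cinner_scaleC_right: "cinner x (c *\<^sub>C y) = c * cinner x y"
    and cinner_self: "cinner x x = complex_of_real ((norm x)\<^sup>2)"

definition orthogonal_projection :: "'h::complex_hilbert_space set \<Rightarrow> 'h \<Rightarrow> 'h" where
  "orthogonal_projection M x = (THE y. y \<in> M \<and> (\<forall>z\<in>M. cinner z (x - y) = 0))"


section \<open>Continuous functional calculus\<close>

definition spectrum :: "'a::cstar_algebra \<Rightarrow> complex set" where
  "spectrum a = {z. \<not> (\<exists>b. b * (a - z *\<^sub>C 1) = 1 \<and> (a - z *\<^sub>C 1) * b = 1)}"

text \<open>\<open>\<Phi>\<close> is the isometric unital *-homomorphism from the continuous functions on the spectrum
  of \<open>a\<close> to the algebra that maps the identity function to \<open>a\<close>. Continuous functions on the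
  spectrum are represented by functions on the whole plane; linearity and the isometry condition
  force \<open>\<Phi> g\<close> to depend only on the restriction of \<open>g\<close> to the spectrum.\<close>

definition is_functional_calculus ::
    "'a::cstar_algebra \<Rightarrow> ((complex \<Rightarrow> complex) \<Rightarrow> 'a) \<Rightarrow> bool" where
  "is_functional_calculus a \<Phi> \<longleftrightarrow>
     (\<forall>g h. continuous_on (spectrum a) g \<longrightarrow> continuous_on (spectrum a) h \<longrightarrow>
        \<Phi> (\<lambda>z. g z + h z) = \<Phi> g + \<Phi> h \<and> \<Phi> (\<lambda>z. g z * h z) = \<Phi> g * \<Phi> h) \<and>
     (\<forall>c g. continuous_on (spectrum a) g \<longrightarrow>
        \<Phi> (\<lambda>z. c * g z) = c *\<^sub>C \<Phi> g \<and> \<Phi> (\<lambda>z. cnj (g z)) = star (\<Phi> g) \<and>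
        norm (\<Phi> g) = (SUP z\<in>spectrum a. cmod (g z))) \<and>
     \<Phi> (\<lambda>z. 1) = 1 \<and> \<Phi> (\<lambda>z. z) = a"

definition functional_calculus :: "'a::cstar_algebra \<Rightarrow> (complex \<Rightarrow> complex) \<Rightarrow> 'a" where
  "functional_calculus a g = (THE b. \<exists>\<Phi>. is_functional_calculus a \<Phi> \<and> b = \<Phi> g)"

text \<open>For self-adjoint \<open>a\<close> the spectrum is real, so a function on the real line acts on it via
  the real part.\<close>

definition real_functional_calculus :: "'a::cstar_algebra \<Rightarrow> (real \<Rightarrow> complex) \<Rightarrow> 'a" where
  "real_functional_calculus a f = functional_calculus a (\<lambda>z. f (Re z))"


section \<open>Test functions and the Fourier transform\<close>

definition test_function :: "(real \<Rightarrow> complex) \<Rightarrow> bool" where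
  "test_function f \<longleftrightarrow>
     (\<forall>k x. ((\<lambda>g y. vector_derivative g (at y)) ^^ k) f differentiable (at x)) \<and>
     compact (closure {x. f x \<noteq> 0})"

definition fourier :: "(real \<Rightarrow> complex) \<Rightarrow> real \<Rightarrow> complex" where
  "fourier f t = (LINT s|lborel. f s * exp (- \<i> * complex_of_real t * complex_of_real s))"


section \<open>Tracial C*-probability spaces and the GNS space\<close>

definition state :: "('a::cstar_algebra \<Rightarrow> complex) \<Rightarrow> bool" where
  "state \<rho> \<longleftrightarrow> Vector_Spaces.linear (*\<^sub>C) (*) \<rho> \<and>
     (\<forall>a. \<rho> (star a * a) \<in> \<real>\<^sub>\<ge>\<^sub>0) \<and> \<rho> 1 = 1"

definition tracial :: "('a::cstar_algebra \<Rightarrow> complex) \<Rightarrow> bool" where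
  "tracial \<rho> \<longleftrightarrow> (\<forall>a b. \<rho> (a * b) = \<rho> (b * a))"

definition faithful :: "('a::cstar_algebra \<Rightarrow> complex) \<Rightarrow> bool" where
  "faithful \<rho> \<longleftrightarrow> (\<forall>a. \<rho> (star a * a) = 0 \<longrightarrow> a = 0)"

text \<open>The GNS space of \<open>\<rho>\<close> is determined up to a unique unitary commuting with the canonical
  maps: it is a Hilbert space \<open>'h\<close> together with a linear map \<open>a \<mapsto> hat a\<close> of dense range that
  induces the inner product \<open>\<rho> (star a * b)\<close>.\<close>

definition gns_space ::
    "('a::cstar_algebra \<Rightarrow> complex) \<Rightarrow> ('a \<Rightarrow> 'h::complex_hilbert_space) \<Rightarrow> bool" where
  "gns_space \<rho> hat \<longleftrightarrow> Vector_Spaces.linear (*\<^sub>C) (*\<^sub>C) hat \<and>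
     (\<forall>a b. cinner (hat a) (hat b) = \<rho> (star a * b)) \<and> closure (range hat) = UNIV"


section \<open>Filtrations and Sobolev spaces\<close>

definition filtration :: "(nat \<Rightarrow> 'a::cstar_algebra set) \<Rightarrow> bool" where
  "filtration L \<longleftrightarrow>
     (\<forall>n. module.subspace (*\<^sub>C) (L n)) \<and> mono L \<and>
     L 0 = range (\<lambda>c. c *\<^sub>C 1) \<and>
     (\<forall>n. \<forall>a\<in>L n. star a \<in> L n) \<and>
     (\<forall>n k. \<forall>a\<in>L n. \<forall>b\<in>L k. a * b \<in> L (n + k)) \<and>
     closure (\<Union>k. L k) = UNIV"

definition rapid_decay_constants ::
    "('a::cstar_algebra \<Rightarrow> 'h::complex_hilbert_space) \<Rightarrow> (nat \<Rightarrow> 'a set) \<Rightarrow> real \<Rightarrow> real \<Rightarrow> bool"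
  where
  "rapid_decay_constants hat L C \<alpha> \<longleftrightarrow> C > 0 \<and> \<alpha> > 0 \<and>
     (\<forall>m. \<forall>b\<in>L m. norm b \<le> C * (real m + 1) powr \<alpha> * norm (hat b))"

definition rapid_decay ::
    "('a::cstar_algebra \<Rightarrow> 'h::complex_hilbert_space) \<Rightarrow> (nat \<Rightarrow> 'a set) \<Rightarrow> bool" where
  "rapid_decay hat L \<longleftrightarrow> (\<exists>C \<alpha>. rapid_decay_constants hat L C \<alpha>)"

definition filtration_proj ::
    "('a::cstar_algebra \<Rightarrow> 'h::complex_hilbert_space) \<Rightarrow> (nat \<Rightarrow> 'a set) \<Rightarrow> nat \<Rightarrow> 'h \<Rightarrow> 'h" where
  "filtration_proj hat L k = orthogonal_projection (closure (hat ` L k))"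

definition level_proj ::
    "('a::cstar_algebra \<Rightarrow> 'h::complex_hilbert_space) \<Rightarrow> (nat \<Rightarrow> 'a set) \<Rightarrow> nat \<Rightarrow> 'h \<Rightarrow> 'h" where
  "level_proj hat L k \<xi> =
     filtration_proj hat L k \<xi> - (if k = 0 then 0 else filtration_proj hat L (k - 1) \<xi>)"

definition sobolev_space ::
    "('a::cstar_algebra \<Rightarrow> 'h::complex_hilbert_space) \<Rightarrow> (nat \<Rightarrow> 'a set) \<Rightarrow> real \<Rightarrow> 'h set" where
  "sobolev_space hat L s =
     {\<xi>. summable (\<lambda>k. (real k + 1) powr (2 * s) * (norm (level_proj hat L k \<xi>))\<^sup>2)}"

text \<open>Only meaningful on \<^const>\<open>sobolev_space\<close>, that is, where the series converges.\<close>

definition sobolev_norm ::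
    "('a::cstar_algebra \<Rightarrow> 'h::complex_hilbert_space) \<Rightarrow> (nat \<Rightarrow> 'a set) \<Rightarrow> real \<Rightarrow> 'h \<Rightarrow> real" where
  "sobolev_norm hat L s \<xi> =
     sqrt (\<Sum>k. (real k + 1) powr (2 * s) * (norm (level_proj hat L k \<xi>))\<^sup>2)"

definition sobolev_inf ::
    "('a::cstar_algebra \<Rightarrow> 'h::complex_hilbert_space) \<Rightarrow> (nat \<Rightarrow> 'a set) \<Rightarrow> 'h set" where
  "sobolev_inf hat L = (\<Inter>s\<in>{0<..}. sobolev_space hat L s)"

definition closed_under_smooth_calculus ::
    "('a::cstar_algebra \<Rightarrow> 'h::complex_hilbert_space) \<Rightarrow> (nat \<Rightarrow> 'a set) \<Rightarrow> bool" where
  "closed_under_smooth_calculus hat L \<longleftrightarrow>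
     (\<forall>a f. star a = a \<longrightarrow> hat a \<in> sobolev_inf hat L \<longrightarrow> test_function f \<longrightarrow>
        hat (real_functional_calculus a f) \<in> sobolev_inf hat L)"


section \<open>Bochner integrals with values in a normed subspace\<close>

text \<open>The Bochner integral of \<open>g\<close> in the normed space \<open>(V, N)\<close>, where \<open>V\<close> is a subspace of the
  ambient type carrying its own norm \<open>N\<close>. This is \<^const>\<open>has_bochner_integral\<close> with the type's
  norm replaced by \<open>N\<close>. Measurability of \<open>t \<mapsto> N (g t - s i t)\<close> together with convergence of the
  integrals to 0 yields strong measurability of \<open>g\<close>.\<close>

definition has_bochner_integral_in ::
    "'v::real_vector set \<Rightarrow> ('v \<Rightarrow> real) \<Rightarrow> 'm measure \<Rightarrow> ('m \<Rightarrow> 'v) \<Rightarrow> 'v \<Rightarrow> bool" where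
  "has_bochner_integral_in V N M g I \<longleftrightarrow>
     (\<forall>t\<in>space M. g t \<in> V) \<and> I \<in> V \<and>
     (\<exists>s. (\<forall>i. Bochner_Integration.simple_bochner_integrable M (s i) \<and> s i ` space M \<subseteq> V \<and>
              (\<lambda>t. N (g t - s i t)) \<in> borel_measurable M) \<and>
          (\<lambda>i. \<integral>\<^sup>+ t. ennreal (N (g t - s i t)) \<partial>M) \<longlonglongrightarrow> 0 \<and>
          (\<lambda>i. N (Bochner_Integration.simple_bochner_integral M (s i) - I)) \<longlonglongrightarrow> 0)"

end

theory Submission
  imports "HOL-Probability.Characteristic_Functions" "HOL-Probability.Sinc_Integral"
    "HOL-Computational_Algebra.Fundamental_Theorem_Algebra" Defs
begin

text \<open>
  Let \<open>D\<close> be the number operator on \<open>L\<^sup>2\<close>, which multiplies the component of degree \<open>k\<close> by \<open>k\<close>, so that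
  \<open>\<parallel>\<xi>\<parallel>\<close> in \<open>H\<^sup>n\<close> is \<open>\<parallel>(1 + D)\<^sup>n \<xi>\<parallel>\<^sub>2\<close>. For self-adjoint \<open>a\<close> consider the unitaries \<open>u\<^sub>t = e\<^sup>i\<^sup>t\<^sup>a\<close>. The
  theorem holds because \<open>\<parallel>u\<^sub>t\<parallel>\<close> grows only polynomially in \<open>H\<^sup>n\<close>, namely at most like \<open>(1 + B \<bar>t\<bar>)\<^sup>n\<close>, while
  the Fourier transform of a test function decays faster than any power.

  The growth bound comes from commutators. The derivative of \<open>u\<^bsub>-t\<^esub> (1 + D)\<^sup>n u\<^sub>t\<close> is
  \<open>i u\<^bsub>-t\<^esub> [(1 + D)\<^sup>n, a] u\<^sub>t\<close>, and the commutator is of order \<open>n - 1\<close>: its value at \<open>\<xi>\<close> has norm at most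
  \<open>B \<parallel>(1 + D)\<^bsup>n - 1\<^esup> \<xi>\<parallel>\<^sub>2\<close>. Since left multiplication by \<open>u\<^bsub>-t\<^esub>\<close> is isometric on \<open>L\<^sup>2\<close> and \<open>(1 + D)\<^sup>n 1 = 1\<close>,
  the bound follows by induction on \<open>n\<close> and the mean value inequality (\<open>norm2_weight_group_exp_le\<close>).

  For the commutator, note that an element \<open>x\<close> of \<open>L\<^sub>k\<close> moves degrees by at most \<open>k\<close>, up because
  \<open>L\<^sub>k L\<^sub>j \<subseteq> L\<^bsub>k + j\<^esub>\<close> and down because \<open>x\<^sup>*\<close> is in \<open>L\<^sub>k\<close> as well. For such an operator \<open>[D, x]\<close> has norm at
  most \<open>2 k \<parallel>x\<parallel>\<close> (\<open>num_commutator_le\<close>) and moves degrees by at most \<open>k\<close> again, so that higher commutators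
  can be iterated (\<open>weight_commutator_le\<close>). An element \<open>a\<close> of the Sobolev space is the sum of its components
  \<open>a\<^sub>k\<close>, with \<open>\<parallel>a\<^sub>k\<parallel> \<le> C (k + 1)\<^sup>\<alpha> \<parallel>a\<^sub>k\<parallel>\<^sub>2\<close> by rapid decay; the sum of \<open>(k + 1)\<^sup>n \<parallel>a\<^sub>k\<parallel>\<close> is
  bounded by a multiple of the norm of \<open>a\<close> in \<open>H\<^sup>s\<close>, \<open>s = \<alpha> + n + 1\<close>, by the Cauchy-Schwarz inequality
  (\<open>weight_commutator_element_le\<close>). To avoid unbounded operators, \<open>D\<close> is truncated to
  \<open>num N\<close>, a finite sum of projections; no estimate depends on \<open>N\<close>.

  It remains to identify the integral with \<open>2 \<pi> f(a)\<close>. Its Riemann sums converge in the C*-norm to \<open>2 \<pi> f(a)\<close>,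
  because the functional calculus is isometric and the corresponding scalar sums converge to \<open>2 \<pi> f\<close> on the
  spectrum, by Fourier inversion. They are Cauchy in \<open>H\<^sup>n\<close> by the growth bound, so they converge to the same
  limit there (\<open>smooth_functional_calculus\<close>).

  The continuous functional calculus is constructed from polynomials. This rests on the fact that
  the norm of a self-adjoint element is attained on its spectrum (\<open>norm_attained_on_spectrum\<close>). It also yields
  square roots of positive elements, hence the inequality \<open>\<parallel>x y\<parallel>\<^sub>2 \<le> \<parallel>x\<parallel> \<parallel>y\<parallel>\<^sub>2\<close> (\<open>norm2_mult_le\<close>).
\<close>


section \<open>Elementary facts about complex normed spaces and C*-algebras\<close>

lemma scaleC_zero_left [simp]: "0 *\<^sub>C (x::'a::complex_normed_vector) = 0"
  using scaleR_scaleC[of 0 x] by simp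

lemma scaleC_zero_right [simp]: "c *\<^sub>C (0::'a::complex_normed_vector) = 0"
  using scaleC_add_right[of c 0 "0::'a"] by simp

lemma scaleC_minus_left: "(- c) *\<^sub>C (x::'a::complex_normed_vector) = - (c *\<^sub>C x)"
  using scaleC_add_left[of "-c" c x] by (simp add: eq_neg_iff_add_eq_0)

lemma scaleC_minus_right: "c *\<^sub>C (- x::'a::complex_normed_vector) = - (c *\<^sub>C x)"
  using scaleC_add_right[of c "-x" x] by (simp add: eq_neg_iff_add_eq_0)

lemma scaleC_diff_left: "(c - d) *\<^sub>C (x::'a::complex_normed_vector) = c *\<^sub>C x - d *\<^sub>C x"
  using scaleC_add_left[of c "-d" x] by (simp add: scaleC_minus_left)

lemma scaleC_diff_right: "c *\<^sub>C (x - y::'a::complex_normed_vector) = c *\<^sub>C x - c *\<^sub>C y"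
  using scaleC_add_right[of c x "-y"] by (simp add: scaleC_minus_right)

lemma scaleC_sum_right: "c *\<^sub>C (\<Sum>i\<in>S. f i::'a::complex_normed_vector) = (\<Sum>i\<in>S. c *\<^sub>C f i)"
  by (induction S rule: infinite_finite_induct) (auto simp: scaleC_add_right)

lemma tendsto_scaleC:
  assumes "(f \<longlongrightarrow> c) F" "(g \<longlongrightarrow> (x::'a::complex_normed_vector)) F"
  shows "((\<lambda>i. f i *\<^sub>C g i) \<longlongrightarrow> c *\<^sub>C x) F"
proof -
  have "bounded_bilinear (\<lambda>c x. c *\<^sub>C (x::'a))"
    by unfold_locales (auto simp: scaleC_add_left scaleC_add_right scaleR_scaleC scaleC_scaleC
        norm_scaleC scaleR_conv_of_real mult.commute intro!: exI[of _ 1])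
  from bounded_bilinear.tendsto[OF this assms] show ?thesis .
qed

lemma Cauchy_if_le_null:
  fixes f :: "nat \<Rightarrow> 'a::real_normed_vector"
  assumes le: "\<And>m n. norm (f m - f n) \<le> r m + r n" and r: "r \<longlonglongrightarrow> 0"
  shows "Cauchy f"
proof (rule metric_CauchyI)
  fix e :: real assume "e > 0"
  then have "\<forall>\<^sub>F n in sequentially. r n < e / 2" using r by (intro order_tendstoD(2)) auto
  then obtain M where "\<And>n. n \<ge> M \<Longrightarrow> r n < e / 2" unfolding eventually_sequentially by blast
  then show "\<exists>M. \<forall>m\<ge>M. \<forall>n\<ge>M. dist (f m) (f n) < e"
    using le unfolding dist_norm by (smt (verit) field_sum_of_halves)
qed

lemma star_zero [simp]: "star (0::'a::cstar_algebra) = 0"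
  using star_scaleC[of 0 "0::'a"] by simp

lemma star_minus: "star (- x::'a::cstar_algebra) = - star x"
  using star_add[of "-x" x] by (simp add: eq_neg_iff_add_eq_0)

lemma star_diff: "star (x - y::'a::cstar_algebra) = star x - star y"
  using star_add[of x "-y"] by (simp add: star_minus)

lemma star_one [simp]: "star (1::'a::cstar_algebra) = 1"
  by (metis mult_1 mult.right_neutral star_mult star_star)

lemma norm_star [simp]: "norm (star (x::'a::cstar_algebra)) = norm x"
proof -
  have le: "norm y \<le> norm (star y)" for y :: 'a
  proof (cases "norm y = 0")
    case False
    have "norm y * norm y \<le> norm (star y) * norm y"
      using norm_star_mult[of y] norm_mult_ineq[of "star y" y] by (simp add: power2_eq_square)
    with False show ?thesis by simp
  qed simp
  show ?thesis using le[of x] le[of "star x"] by (simp add: star_star)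
qed

lemma bounded_linear_star: "bounded_linear (star :: 'a::cstar_algebra \<Rightarrow> 'a)"
  by (rule bounded_linear_intro[where K = 1]) (auto simp: star_add scaleR_scaleC star_scaleC)

lemma star_power: "star ((x::'a::cstar_algebra) ^ n) = star x ^ n"
  by (induction n) (auto simp: star_mult power_commutes)

lemma star_exp: "star (exp (x::'a::cstar_algebra)) = exp (star x)"
proof -
  have "star (exp x) = (\<Sum>n. star (x ^ n /\<^sub>R fact n))"
    unfolding exp_def by (rule bounded_linear.suminf[OF bounded_linear_star])
      (rule summable_exp_generic)
  also have "\<dots> = exp (star x)"
    unfolding exp_def
    by (simp add: star_power linear_cmul[OF bounded_linear.linear[OF bounded_linear_star]])
  finally show ?thesis .
qed

lemma norm_power_self_adjoint:
  assumes "star (b::'a::cstar_algebra) = b"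
  shows "norm (b ^ 2 ^ k) = norm b ^ 2 ^ k"
proof (induction k)
  case (Suc k)
  have "norm (b ^ 2 ^ Suc k) = norm (star (b ^ 2 ^ k) * b ^ 2 ^ k)"
    by (simp add: star_power assms power_add[symmetric] mult_2)
  then show ?case by (simp add: norm_star_mult Suc power_mult[symmetric] mult.commute)
qed simp


section \<open>Invertible elements and the spectrum\<close>

definition is_inverse :: "'a::monoid_mult \<Rightarrow> 'a \<Rightarrow> bool" where
  "is_inverse x y \<longleftrightarrow> x * y = 1 \<and> y * x = 1"

lemma is_inverse_mult: "is_inverse x y \<Longrightarrow> is_inverse x' y' \<Longrightarrow> is_inverse (x * x') (y' * y)"
  unfolding is_inverse_def by (metis mult.assoc mult_1_right)

lemma is_inverse_scaleC:
  "is_inverse (x::'a::cstar_algebra) y \<Longrightarrow> c \<noteq> 0 \<Longrightarrow> is_inverse (c *\<^sub>C x) ((1 / c) *\<^sub>C y)"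
  by (auto simp: is_inverse_def mult_scaleC_left mult_scaleC_right scaleC_scaleC scaleC_one)

lemma spectrum_iff: "z \<in> spectrum a \<longleftrightarrow> (\<nexists>b. is_inverse (a - z *\<^sub>C 1) b)"
  by (auto simp: spectrum_def is_inverse_def)

lemma is_inverse_Neumann:
  assumes "norm (x::'a::cstar_algebra) < 1"
  shows "is_inverse (1 - x) (\<Sum>n. x ^ n)"
proof -
  have s: "summable (\<lambda>n. x ^ n)" by (rule complete_algebra_summable_geometric[OF assms])
  have S: "(\<Sum>n. x ^ n) = 1 + (\<Sum>n. x ^ Suc n)"
    using suminf_split_head[OF s] by simp
  have "(\<Sum>n. x ^ Suc n) = x * (\<Sum>n. x ^ n)"
    using suminf_mult[OF s, of x] by simp
  moreover have "(\<Sum>n. x ^ Suc n) = (\<Sum>n. x ^ n) * x"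
    using suminf_mult2[OF s, of x] by (simp add: power_commutes)
  ultimately show ?thesis using S
    by (auto simp: is_inverse_def algebra_simps)
qed

lemma is_inverse_perturb:
  assumes "is_inverse (x::'a::cstar_algebra) m" "norm m * norm y < 1"
  shows "\<exists>m'. is_inverse (x - y) m'"
proof -
  have "norm (m * y) < 1" using norm_mult_ineq[of m y] assms(2) by linarith
  then have "is_inverse (1 - m * y) (\<Sum>n. (m * y) ^ n)" by (rule is_inverse_Neumann)
  moreover have "x - y = x * (1 - m * y)"
    using assms(1) by (simp add: is_inverse_def algebra_simps mult.assoc[symmetric])
  ultimately show ?thesis using is_inverse_mult[OF assms(1)] by metis
qed

lemma cmod_spectrum_le: "z \<in> spectrum (a::'a::cstar_algebra) \<Longrightarrow> cmod z \<le> norm a"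
proof (rule ccontr)
  assume z: "z \<in> spectrum a" and "\<not> cmod z \<le> norm a"
  then have nz: "z \<noteq> 0" and lt: "norm a < cmod z" by auto
  have "norm ((1 / z) *\<^sub>C a) < 1" using nz lt by (simp add: norm_scaleC norm_divide)
  from is_inverse_scaleC[OF is_inverse_Neumann[OF this], of "-z"] nz
  have "\<exists>b. is_inverse ((- z) *\<^sub>C (1 - (1 / z) *\<^sub>C a)) b" by auto
  moreover have "(- z) *\<^sub>C (1 - (1 / z) *\<^sub>C a) = a - z *\<^sub>C 1"
    using nz by (simp add: scaleC_diff_right scaleC_scaleC scaleC_minus_left scaleC_one)
  ultimately show False using z by (simp add: spectrum_iff)
qed

lemma compact_spectrum: "compact (spectrum (a::'a::cstar_algebra))"
proof -
  have "open (- spectrum a)"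
    unfolding open_dist
  proof safe
    fix z assume "z \<notin> spectrum a"
    then obtain m where m: "is_inverse (a - z *\<^sub>C 1) m" by (auto simp: spectrum_iff)
    have pos: "norm m + 1 > 0" by (smt (verit) norm_ge_zero)
    have "y \<notin> spectrum a" if "dist y z < 1 / (norm m + 1)" for y
    proof -
      have "norm m * cmod (y - z) \<le> (norm m + 1) * cmod (y - z)" by (simp add: mult_right_mono)
      also have "\<dots> < 1" using that pos by (simp add: dist_norm field_simps)
      finally have "norm m * norm ((y - z) *\<^sub>C (1::'a)) < 1" by (simp add: norm_scaleC)
      from is_inverse_perturb[OF m this] show ?thesis
        by (simp add: spectrum_iff scaleC_diff_left)
    qed
    then show "\<exists>e>0. \<forall>y. dist y z < e \<longrightarrow> y \<in> - spectrum a"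
      using pos by (intro exI[of _ "1 / (norm m + 1)"]) auto
  qed
  then have "closed (spectrum a)" by (simp add: closed_def)
  moreover have "bounded (spectrum a)"
    using cmod_spectrum_le by (auto simp: bounded_iff)
  ultimately show ?thesis by (simp add: compact_eq_bounded_closed)
qed

lemma spectrum_translate: "z \<in> spectrum a \<Longrightarrow> z + c \<in> spectrum (a + c *\<^sub>C (1::'a::cstar_algebra))"
  by (simp add: spectrum_iff scaleC_add_left)

text \<open>If \<open>i y\<close> with \<open>y\<close> real and nonzero were in the spectrum of a self-adjoint \<open>b\<close>, then
  \<open>i (y + l)\<close> would be in the spectrum of \<open>b + i l\<close>, whose squared norm is at most \<open>\<parallel>b\<parallel>\<^sup>2 + l\<^sup>2\<close>. For
  large \<open>l\<close> of the sign of \<open>y\<close> this is less than \<open>(y + l)\<^sup>2\<close>.\<close>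

lemma spectrum_self_adjoint_real:
  assumes sa: "star (a::'a::cstar_algebra) = a" and z: "z \<in> spectrum a"
  shows "Im z = 0"
proof (rule ccontr)
  assume nz: "Im z \<noteq> 0"
  define b where "b = a - complex_of_real (Re z) *\<^sub>C 1"
  have sb: "star b = b" by (simp add: b_def star_diff sa star_scaleC)
  have "z + - complex_of_real (Re z) \<in> spectrum (a + (- complex_of_real (Re z)) *\<^sub>C 1)"
    by (rule spectrum_translate[OF z])
  moreover have "z + - complex_of_real (Re z) = \<i> * complex_of_real (Im z)"
    by (simp add: complex_eq_iff)
  ultimately have *: "\<i> * complex_of_real (Im z) \<in> spectrum b"
    by (simp add: b_def scaleC_minus_left)
  \<comment> \<open>chosen so that \<open>2 y l = \<parallel>b\<parallel>\<^sup>2 + 1\<close> for \<open>y = Im z\<close>\<close>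
  define l where "l = ((norm b)\<^sup>2 + 1) / (2 * Im z)"
  have "\<i> * complex_of_real (Im z) + \<i> * complex_of_real l \<in> spectrum (b + (\<i> * complex_of_real l) *\<^sub>C 1)"
    by (rule spectrum_translate[OF *])
  then have "cmod (\<i> * complex_of_real (Im z + l)) \<le> norm (b + (\<i> * complex_of_real l) *\<^sub>C 1)"
    using cmod_spectrum_le by (metis distrib_left of_real_add)
  then have "(Im z + l)\<^sup>2 \<le> (norm (b + (\<i> * complex_of_real l) *\<^sub>C 1))\<^sup>2"
    using power_mono[of "\<bar>Im z + l\<bar>" _ 2] by (simp add: norm_mult del: of_real_add)
  also have "\<dots> = norm (star (b + (\<i> * complex_of_real l) *\<^sub>C 1) * (b + (\<i> * complex_of_real l) *\<^sub>C 1))"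
    by (simp add: norm_star_mult)
  also have "star (b + (\<i> * complex_of_real l) *\<^sub>C 1) * (b + (\<i> * complex_of_real l) *\<^sub>C 1)
      = b * b + complex_of_real (l\<^sup>2) *\<^sub>C 1"
    by (simp add: star_add sb star_scaleC algebra_simps mult_scaleC_left mult_scaleC_right scaleC_scaleC
        scaleC_minus_left scaleC_diff_right power2_eq_square)
  also have "norm \<dots> \<le> (norm b)\<^sup>2 + l\<^sup>2"
    using norm_triangle_ineq[of "b * b" "complex_of_real (l\<^sup>2) *\<^sub>C 1"] norm_mult_ineq[of b b]
    by (simp add: norm_scaleC norm_mult power2_eq_square)
  finally have "2 * Im z * l + (Im z)\<^sup>2 \<le> (norm b)\<^sup>2" by (simp add: power2_sum algebra_simps)
  moreover have "2 * Im z * l = (norm b)\<^sup>2 + 1" using nz by (simp add: l_def)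
  ultimately show False using zero_le_power2[of "Im z"] by linarith
qed


section \<open>The norm of a self-adjoint element is attained on its spectrum\<close>

text \<open>The doubling step for the averages over roots of unity: \<open>(1 - x\<^sup>2)\<inverse>\<close> is the mean of \<open>(1 - x)\<inverse>\<close> and
  \<open>(1 + x)\<inverse>\<close>.\<close>

lemma is_inverse_square:
  assumes "is_inverse (1 - x) y" "is_inverse (1 + x) z"
  shows "is_inverse (1 - x * x) ((1/2) *\<^sub>R (y + z :: 'a::real_normed_algebra_1))"
proof -
  have f: "1 - x * x = (1 - x) * (1 + x)" "1 - x * x = (1 + x) * (1 - x)"
    by (simp_all add: algebra_simps)
  have "y * (1 - x * x) = 1 + x" "z * (1 - x * x) = 1 - x"
    using assms unfolding is_inverse_def by (metis f mult.assoc mult_1_left)+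
  moreover have "(1 - x * x) * y = 1 + x" "(1 - x * x) * z = 1 - x"
    using assms unfolding is_inverse_def by (metis f mult.assoc mult_1_right)+
  moreover have "(1/2) *\<^sub>R (2::'a) = 1" by (metis one_add_one scaleR_half_double)
  ultimately show ?thesis
    by (simp add: is_inverse_def distrib_left distrib_right scaleR_add_right[symmetric])
qed

text \<open>The resolvent is bounded near each point where it exists, hence continuous.\<close>

lemma continuous_on_resolvent:
  fixes R :: "complex \<Rightarrow> 'a::cstar_algebra"
  assumes R: "\<And>w. w \<in> S \<Longrightarrow> is_inverse (1 - w *\<^sub>C c) (R w)"
  shows "continuous_on S R"
  unfolding continuous_on_iff
proof safe
  fix v e :: real and v' assume "v' \<in> S" "(0::real) < e"
  then show "\<exists>d>0. \<forall>x'\<in>S. dist x' v' < d \<longrightarrow> dist (R x') (R v') < e"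
  proof -
    let ?v = v'
    have v: "?v \<in> S" by fact
    have id: "R w - R ?v = (w - ?v) *\<^sub>C (R w * c * R ?v)" if w: "w \<in> S" for w
    proof -
      have "R w = R w * ((1 - ?v *\<^sub>C c) * R ?v)" "R ?v = (R w * (1 - w *\<^sub>C c)) * R ?v"
        using R[OF v] R[OF w] by (auto simp: is_inverse_def)
      then have "R w - R ?v = R w * ((1 - ?v *\<^sub>C c) - (1 - w *\<^sub>C c)) * R ?v"
        by (metis (no_types, lifting) left_diff_distrib mult.assoc right_diff_distrib)
      then show ?thesis
        by (simp add: scaleC_diff_left[symmetric] mult_scaleC_left mult_scaleC_right)
    qed
    define m where "m = norm c * norm (R ?v) + 1"
    have m: "m > 0" "norm c * norm (R ?v) \<le> m" by (auto simp: m_def add_nonneg_pos)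
    have bd: "norm (R w - R ?v) \<le> cmod (w - ?v) * m * norm (R w)" if w: "w \<in> S" for w
    proof -
      have "norm (R w * c * R ?v) \<le> norm (R w) * norm c * norm (R ?v)"
        by (rule order_trans[OF norm_mult_ineq]) (simp add: mult_right_mono norm_mult_ineq)
      also have "\<dots> \<le> m * norm (R w)"
        using mult_left_mono[OF m(2) norm_ge_zero[of "R w"]] by (simp add: mult_ac)
      finally show ?thesis
        by (simp add: id[OF w] norm_scaleC mult.assoc mult_left_mono)
    qed
    define d where "d = min (1 / (2 * m)) (e / (2 * m * (norm (R ?v) + 1)))"
    have np: "norm (R ?v) + 1 > 0" by (smt (verit) norm_ge_zero)
    have "d > 0" using m np \<open>0 < e\<close> by (simp add: d_def)
    moreover have "dist (R w) (R ?v) < e" if w: "w \<in> S" and wd: "dist w ?v < d" for w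
    proof -
      have a1: "cmod (w - ?v) * m \<le> 1 / 2"
        using wd m(1) by (simp add: d_def dist_norm field_simps)
      have "norm (R w) \<le> norm (R ?v) + norm (R w - R ?v)"
        by (metis add.commute diff_add_cancel norm_triangle_ineq)
      also have "norm (R w - R ?v) \<le> 1/2 * norm (R w)"
        using bd[OF w] mult_right_mono[OF a1 norm_ge_zero[of "R w"]] by linarith
      finally have a2: "norm (R w) \<le> 2 * norm (R ?v)" by simp
      have "norm (R w - R ?v) \<le> cmod (w - ?v) * m * (2 * norm (R ?v))"
        using order_trans[OF bd[OF w] mult_left_mono[OF a2, of "cmod (w - ?v) * m"]] m(1) by simp
      also have "\<dots> \<le> cmod (w - ?v) * (2 * m * (norm (R ?v) + 1))"
        using m(1) by (simp add: mult.assoc mult_left_mono)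
      also have "\<dots> < e"
        using wd m(1) np by (simp add: d_def dist_norm pos_less_divide_eq)
      finally show ?thesis by (simp add: dist_norm)
    qed
    ultimately show ?thesis by blast
  qed
qed

text \<open>
  An elementary form of the spectral radius formula, due to Rickart, without complex integration.
  If no point of the unit circle is in the spectrum, the resolvent is uniformly continuous on the
  closed disc. Averaging over the roots of unity of order \<open>2 ^ k\<close>, here by repeated doubling, turns
  \<open>(1 - w c)\<inverse>\<close> into \<open>(1 - (w c) ^ 2 ^ k)\<inverse>\<close> and does not increase differences. So these
  inverses are, uniformly in \<open>k\<close>, close to their values at a slightly smaller radius, which tend
  to \<open>1\<close>; this is impossible if the powers of \<open>c\<close> keep norm \<open>1\<close>.
\<close>

lemma spectrum_meets_unit_circle:
  fixes c :: "'a::cstar_algebra"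
  assumes nrm: "\<And>k. norm (c ^ 2 ^ k) = 1"
  shows "\<exists>z\<in>spectrum c. cmod z = 1"
proof (rule ccontr)
  assume "\<not> ?thesis"
  then have no: "\<And>z. cmod z = 1 \<Longrightarrow> \<exists>b. is_inverse (c - z *\<^sub>C 1) b"
    by (metis spectrum_iff)
  have n1: "norm c = 1" using nrm[of 0] by simp
  have "\<exists>b. is_inverse (1 - w *\<^sub>C c) b" if "cmod w \<le> 1" for w
  proof (cases "cmod w = 1")
    case True
    then have w0: "w \<noteq> 0" by auto
    from no[of "1 / w"] True obtain b where "is_inverse (c - (1 / w) *\<^sub>C 1) b"
      by (auto simp: norm_divide)
    from is_inverse_scaleC[OF this, of "-w"] w0 show ?thesis
      by (auto simp: scaleC_diff_right scaleC_scaleC scaleC_minus_left scaleC_one)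
  next
    case False
    then have "norm (w *\<^sub>C c) < 1" using that n1 by (simp add: norm_scaleC)
    from is_inverse_Neumann[OF this] show ?thesis by blast
  qed
  then obtain R where R: "\<And>w. cmod w \<le> 1 \<Longrightarrow> is_inverse (1 - w *\<^sub>C c) (R w)" by metis
  have "continuous_on (cball 0 1) R" by (rule continuous_on_resolvent[where c = c]) (auto intro: R)
  then have "uniformly_continuous_on (cball 0 1) R"
    by (rule compact_uniformly_continuous) simp
  then obtain d where d: "d > 0"
    and dR: "\<And>w v. cmod w \<le> 1 \<Longrightarrow> cmod v \<le> 1 \<Longrightarrow> dist w v < d \<Longrightarrow> dist (R w) (R v) < 1/6"
    unfolding uniformly_continuous_on_def by (metis mem_cball_0 divide_pos_pos zero_less_numeral zero_less_one)
  define t where "t = max (1/2) (1 - d / 2)"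
  have t: "0 < t" "t < 1" "1 - t < d" using d by (auto simp: t_def max_def)
  define \<omega> where "\<omega> k = cis (pi / 2 ^ k)" for k
  have \<omega>: "cmod (\<omega> k) = 1" "\<omega> k ^ 2 ^ k = -1" for k
  proof -
    have "\<omega> k ^ 2 ^ k = cis (real (2 ^ k) * (pi / 2 ^ k))" by (simp only: \<omega>_def Complex.DeMoivre)
    also have "real (2 ^ k) * (pi / 2 ^ k) = pi" by simp
    finally show "\<omega> k ^ 2 ^ k = -1" by simp
  qed (simp add: \<omega>_def)
  \<comment> \<open>the average of \<open>R (w \<zeta>)\<close> over all \<open>\<zeta>\<close> with \<open>\<zeta> ^ 2 ^ k = 1\<close>\<close>
  define G where "G = rec_nat R (\<lambda>k g w. (1/2) *\<^sub>R (g w + g (w * \<omega> k)))"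
  have G0: "G 0 = R" and GS: "G (Suc k) w = (1/2) *\<^sub>R (G k w + G k (w * \<omega> k))" for k w
    by (simp_all add: G_def)
  have pw: "(w * \<omega> k) ^ 2 ^ k = - (w ^ 2 ^ k)" for w k
    by (simp add: power_mult_distrib \<omega>)
  have Ginv: "is_inverse (1 - (w ^ 2 ^ k) *\<^sub>C (c ^ 2 ^ k)) (G k w)" if "cmod w \<le> 1" for w k
    using that
  proof (induction k arbitrary: w)
    case 0 then show ?case using R by (simp add: G0)
  next
    case (Suc k)
    let ?x = "(w ^ 2 ^ k) *\<^sub>C (c ^ 2 ^ k)"
    have "is_inverse (1 - ?x) (G k w)" using Suc by simp
    moreover have "is_inverse (1 + ?x) (G k (w * \<omega> k))"
      using Suc.IH[of "w * \<omega> k"] Suc.prems by (simp add: pw norm_mult \<omega> scaleC_minus_left)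
    ultimately have "is_inverse (1 - ?x * ?x) (G (Suc k) w)"
      unfolding GS by (rule is_inverse_square)
    then show ?case
      by (simp add: mult_scaleC_left mult_scaleC_right scaleC_scaleC power_add[symmetric] mult_2)
  qed
  have Gclose: "norm (G k w - G k (complex_of_real t * w)) \<le> 1/6" if "cmod w = 1" for w k
    using that
  proof (induction k arbitrary: w)
    case 0
    have "dist w (complex_of_real t * w) = cmod (complex_of_real (1 - t) * w)"
      by (simp add: dist_norm algebra_simps)
    also have "\<dots> = \<bar>1 - t\<bar>" using 0 by (simp only: norm_mult norm_of_real mult_1_right)
    also have "\<dots> < d" using t by simp
    finally show ?case using dR[of w "complex_of_real t * w"] 0 t
      by (simp add: G0 dist_norm norm_mult less_imp_le)
  next
    case (Suc k)
    have "norm (G k w - G k (complex_of_real t * w)) \<le> 1/6"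
      "norm (G k (w * \<omega> k) - G k (complex_of_real t * w * \<omega> k)) \<le> 1/6"
      using Suc.IH[of w] Suc.IH[of "w * \<omega> k"] Suc.prems by (simp_all add: norm_mult \<omega> mult.assoc)
    moreover have "G (Suc k) w - G (Suc k) (complex_of_real t * w) = (1/2) *\<^sub>R
        ((G k w - G k (complex_of_real t * w)) + (G k (w * \<omega> k) - G k (complex_of_real t * w * \<omega> k)))"
      by (simp add: GS algebra_simps)
    ultimately show ?case
      using norm_triangle_ineq[of "G k w - G k (complex_of_real t * w)"
          "G k (w * \<omega> k) - G k (complex_of_real t * w * \<omega> k)"] by simp
  qed
  have "(\<lambda>n. t ^ n) \<longlonglongrightarrow> 0" using t by (intro LIMSEQ_realpow_zero) auto
  then have "\<forall>\<^sub>F n in sequentially. t ^ n < 1/7" by (rule order_tendstoD(2)) simp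
  then obtain n0 where n0: "\<And>n. n \<ge> n0 \<Longrightarrow> t ^ n < 1/7"
    unfolding eventually_sequentially by blast
  have "n0 \<le> 2 ^ n0" by (simp add: less_imp_le)
  then have tk: "t ^ 2 ^ n0 < 1/7" by (rule n0)
  \<comment> \<open>at the smaller radius the inverse is within \<open>1/6\<close> of \<open>1\<close> by the Neumann series\<close>
  have small: "norm (g - 1) \<le> norm x / (1 - norm x)"
    if "is_inverse (1 - x) g" "norm x < 1" for x g :: 'a
  proof -
    have gx: "g - 1 = x + x * (g - 1)" using that(1) by (auto simp: is_inverse_def algebra_simps)
    have "norm (g - 1) \<le> norm x + norm x * norm (g - 1)"
      by (subst gx) (meson norm_triangle_ineq norm_mult_ineq order_trans add_left_mono)
    then show ?thesis using that(2) by (simp add: field_simps)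
  qed
  define g where "g = G n0 1"
  define g' where "g' = G n0 (complex_of_real t)"
  define y where "y = c ^ 2 ^ n0"
  have ny: "norm y = 1" by (simp add: y_def nrm)
  have inv: "is_inverse (1 - y) g" using Ginv[of 1 n0] by (simp add: g_def y_def scaleC_one)
  have nx: "norm ((complex_of_real t ^ 2 ^ n0) *\<^sub>C y) = t ^ 2 ^ n0"
    using t ny by (simp add: norm_scaleC norm_power)
  have "is_inverse (1 - (complex_of_real t ^ 2 ^ n0) *\<^sub>C y) g'"
    using Ginv[of "complex_of_real t" n0] t by (simp add: g'_def y_def)
  from small[OF this] nx tk have "norm (g' - 1) \<le> t ^ 2 ^ n0 / (1 - t ^ 2 ^ n0)" by simp
  also have "\<dots> < 1/6" using tk by (simp add: divide_less_eq)
  finally have "norm (g' - 1) < 1/6" .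
  moreover have "norm (g - g') \<le> 1/6" using Gclose[of 1 n0] by (simp add: g_def g'_def)
  ultimately have "norm (g - 1) < 1/3" using norm_triangle_ineq[of "g - g'" "g' - 1"] by simp
  have "y = (1 - g) * (1 - y) * (-1)" using inv by (simp add: is_inverse_def algebra_simps)
  then have "norm y \<le> norm (1 - g) * norm (1 - y)"
    by (metis mult_minus1_right norm_minus_cancel norm_mult_ineq)
  also have "\<dots> \<le> norm (1 - g) * 2"
    using norm_triangle_ineq4[of 1 y] ny by (intro mult_left_mono) auto
  also have "\<dots> < 1" using \<open>norm (g - 1) < 1/3\<close> by (simp add: norm_minus_commute)
  finally show False using ny by simp
qed

lemma norm_attained_on_spectrum:
  fixes b :: "'a::cstar_algebra"
  assumes sa: "star b = b"
  shows "\<exists>z\<in>spectrum b. cmod z = norm b"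
proof (cases "b = 0")
  case True
  then have "0 \<in> spectrum b" by (simp add: spectrum_iff is_inverse_def)
  with True show ?thesis by auto
next
  case False
  define c where "c = complex_of_real (1 / norm b) *\<^sub>C b"
  have "star c = c" by (simp add: c_def star_scaleC sa)
  moreover have "norm c = 1" using False by (simp add: c_def norm_scaleC norm_divide)
  ultimately have "\<exists>z\<in>spectrum c. cmod z = 1"
    by (intro spectrum_meets_unit_circle) (simp add: norm_power_self_adjoint)
  then obtain z where z: "z \<in> spectrum c" "cmod z = 1" by auto
  have "complex_of_real (norm b) * z \<in> spectrum b"
  proof (rule ccontr)
    assume "\<not> ?thesis"
    then obtain m where "is_inverse (b - (complex_of_real (norm b) * z) *\<^sub>C 1) m"
      by (auto simp: spectrum_iff)
    from is_inverse_scaleC[OF this, of "complex_of_real (1 / norm b)"] False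
    have "\<exists>m. is_inverse (c - z *\<^sub>C 1) m"
      by (auto simp: c_def scaleC_diff_right scaleC_scaleC)
    with z show False by (simp add: spectrum_iff)
  qed
  with z show ?thesis by (intro bexI) (auto simp: norm_mult)
qed


section \<open>Polynomials of a self-adjoint element\<close>

definition poly_eval :: "complex poly \<Rightarrow> 'a::cstar_algebra \<Rightarrow> 'a" where
  "poly_eval p a = (\<Sum>i\<le>degree p. coeff p i *\<^sub>C a ^ i)"

lemma poly_eval_altdef:
  assumes "degree p \<le> n"
  shows "poly_eval p a = (\<Sum>i\<le>n. coeff p i *\<^sub>C a ^ i)"
  unfolding poly_eval_def using assms
  by (intro sum.mono_neutral_left) (auto simp: coeff_eq_0)

lemma poly_eval_0 [simp]: "poly_eval 0 a = 0" by (simp add: poly_eval_def)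

lemma poly_eval_pCons: "poly_eval (pCons c p) a = c *\<^sub>C 1 + a * poly_eval p a"
proof -
  have "poly_eval (pCons c p) a = (\<Sum>i\<le>Suc (degree p). coeff (pCons c p) i *\<^sub>C a ^ i)"
    by (rule poly_eval_altdef) (rule degree_pCons_le)
  also have "\<dots> = c *\<^sub>C 1 + (\<Sum>i\<le>degree p. coeff p i *\<^sub>C (a * a ^ i))"
    by (simp add: sum.atMost_Suc_shift del: sum.atMost_Suc)
  finally show ?thesis by (simp add: poly_eval_def sum_distrib_left mult_scaleC_right)
qed

lemma poly_eval_add: "poly_eval (p + q) a = poly_eval p a + poly_eval q a"
proof -
  let ?n = "max (degree p) (degree q)"
  show ?thesis
    using poly_eval_altdef[of "p + q" ?n a] poly_eval_altdef[of p ?n a] poly_eval_altdef[of q ?n a]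
    by (simp add: degree_add_le scaleC_add_left sum.distrib)
qed

lemma poly_eval_smult: "poly_eval (smult c p) a = c *\<^sub>C poly_eval p a"
  by (induction p) (auto simp: poly_eval_pCons scaleC_add_right scaleC_scaleC mult_scaleC_right)

lemma poly_eval_mult: "poly_eval (p * q) a = poly_eval p a * poly_eval q a"
  by (induction p)
     (auto simp: poly_eval_pCons poly_eval_add poly_eval_smult distrib_right mult_scaleC_left mult.assoc)

lemma poly_eval_diff: "poly_eval (p - q) a = poly_eval p a - poly_eval q a"
  using poly_eval_add[of "p - q" q a] by (simp add: algebra_simps)

lemma poly_eval_const: "poly_eval [:c:] a = c *\<^sub>C 1"
  by (simp add: poly_eval_pCons)

lemma poly_eval_linear: "poly_eval [:- r, 1:] a = a - r *\<^sub>C 1"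
  by (simp add: poly_eval_pCons scaleC_one scaleC_minus_left)

lemma poly_eval_commute: "poly_eval p a * poly_eval q a = poly_eval q a * poly_eval p a"
  by (metis poly_eval_mult mult.commute)

lemma poly_eval_star:
  assumes "star a = a"
  shows "poly_eval (map_poly cnj p) a = star (poly_eval p a)"
proof -
  have deg: "degree (map_poly cnj p) \<le> degree p"
    by (rule degree_le) (simp add: coeff_map_poly coeff_eq_0)
  have "star (poly_eval p a) = (\<Sum>i\<le>degree p. star (coeff p i *\<^sub>C a ^ i))"
    unfolding poly_eval_def by (rule linear_sum[OF bounded_linear.linear[OF bounded_linear_star]])
  also have "\<dots> = poly_eval (map_poly cnj p) a"
    by (subst poly_eval_altdef[OF deg])
       (simp add: coeff_map_poly star_scaleC star_power assms)
  finally show ?thesis by simp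
qed

lemma poly_map_cnj_real:
  assumes "Im z = 0"
  shows "poly (map_poly cnj p) z = cnj (poly p z)"
proof -
  have "cnj z = z" using assms by (simp add: complex_eq_iff)
  then show ?thesis by (induction p) (auto simp: map_poly_pCons)
qed

text \<open>This and the next two lemmas are the spectral mapping theorem for polynomials. For this inclusion, \<open>a - x\<close>
  is a factor of \<open>p(a) - p(x)\<close>; for the other one, \<open>p - z\<close> is split into linear factors.\<close>

lemma poly_in_spectrum:
  assumes "x \<in> spectrum a"
  shows "poly p x \<in> spectrum (poly_eval p a)"
proof (rule ccontr)
  assume "\<not> ?thesis"
  then obtain m where m: "is_inverse (poly_eval (p - [:poly p x:]) a) m"
    by (auto simp: spectrum_iff poly_eval_diff poly_eval_const)
  have "[:- x, 1:] dvd p - [:poly p x:]" by (simp add: poly_eq_0_iff_dvd[symmetric])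
  then obtain q where q: "p - [:poly p x:] = [:- x, 1:] * q" by (auto elim: dvdE)
  let ?l = "poly_eval [:- x, 1:] a" and ?q = "poly_eval q a"
  have e: "?l * ?q * m = 1" "m * (?q * ?l) = 1"
    using m unfolding q poly_eval_mult is_inverse_def by (simp_all add: poly_eval_commute)
  have "m * ?q = (m * ?q) * (?l * ?q * m)" using e(1) by simp
  also have "\<dots> = (m * (?q * ?l)) * (?q * m)" by (simp only: mult.assoc)
  also have "\<dots> = ?q * m" using e(2) by simp
  finally have "?q * m * ?l = m * (?q * ?l)" by (simp only: mult.assoc [symmetric])
  with e have "is_inverse ?l (?q * m)" by (simp add: is_inverse_def mult.assoc)
  with assms show False by (auto simp: spectrum_iff poly_eval_linear)
qed

lemma poly_eval_invertible:
  assumes "q \<noteq> 0" "\<And>x. x \<in> spectrum a \<Longrightarrow> poly q x \<noteq> 0"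
  shows "\<exists>m. is_inverse (poly_eval q a) m"
  using assms
proof (induction "degree q" arbitrary: q rule: less_induct)
  case less
  show ?case
  proof (cases "degree q = 0")
    case True
    then obtain c where c: "q = [:c:]" by (meson degree_eq_zeroE)
    with less.prems have "c \<noteq> 0" by auto
    from is_inverse_scaleC[OF _ this, of 1 1] show ?thesis
      by (auto simp: c poly_eval_const is_inverse_def)
  next
    case False
    then have "\<not> constant (poly q)" by (simp add: constant_degree)
    then obtain r where r: "poly q r = 0" using fundamental_theorem_of_algebra by blast
    then obtain q' where q': "q = [:- r, 1:] * q'" by (auto simp: poly_eq_0_iff_dvd elim: dvdE)
    have "q' \<noteq> 0" using less.prems(1) q' by auto
    then have "degree q' < degree q" by (simp add: q' degree_mult_eq del: mult_pCons_left)
    moreover have "\<And>x. x \<in> spectrum a \<Longrightarrow> poly q' x \<noteq> 0"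
      using less.prems(2) q' by (auto simp del: mult_pCons_left)
    ultimately obtain m where m: "is_inverse (poly_eval q' a) m"
      using less.hyps \<open>q' \<noteq> 0\<close> by blast
    have "r \<notin> spectrum a" using r less.prems(2) by auto
    then obtain m' where "is_inverse (poly_eval [:- r, 1:] a) m'"
      by (auto simp: spectrum_iff poly_eval_linear)
    from is_inverse_mult[OF this m] show ?thesis unfolding q' poly_eval_mult by blast
  qed
qed

lemma spectrum_poly_eval_subset:
  assumes sa: "star a = a" and z: "z \<in> spectrum (poly_eval p a)"
  shows "\<exists>x\<in>spectrum a. z = poly p x"
proof (cases "p = [:z:]")
  case True
  then show ?thesis using norm_attained_on_spectrum[OF sa] by auto
next
  case False
  then have "p - [:z:] \<noteq> 0" by simp
  moreover have "\<nexists>m. is_inverse (poly_eval (p - [:z:]) a) m"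
    using z by (simp add: spectrum_iff poly_eval_diff poly_eval_const)
  ultimately obtain x where "x \<in> spectrum a" "poly (p - [:z:]) x = 0"
    using poly_eval_invertible by blast
  then show ?thesis by (intro bexI[of _ x]) auto
qed

text \<open>Apply the norm formula for self-adjoint elements to \<open>p(a)\<^sup>* p(a)\<close>, which is again a polynomial
  in \<open>a\<close>.\<close>

lemma norm_poly_eval_attained:
  assumes sa: "star a = a"
  shows "\<exists>x\<in>spectrum a. norm (poly_eval p a) = cmod (poly p x)"
proof -
  let ?q = "map_poly cnj p * p"
  have q: "poly_eval ?q a = star (poly_eval p a) * poly_eval p a"
    by (simp add: poly_eval_mult poly_eval_star[OF sa])
  then have "star (poly_eval ?q a) = poly_eval ?q a" by (simp add: star_mult star_star)
  from norm_attained_on_spectrum[OF this] obtain z where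
    z: "z \<in> spectrum (poly_eval ?q a)" "cmod z = (norm (poly_eval p a))\<^sup>2"
    by (auto simp: q norm_star_mult)
  from spectrum_poly_eval_subset[OF sa z(1)] obtain x where
    x: "x \<in> spectrum a" "z = poly ?q x" by auto
  then have "cmod z = (cmod (poly p x))\<^sup>2"
    using spectrum_self_adjoint_real[OF sa]
    by (simp add: poly_map_cnj_real norm_mult power2_eq_square del: poly_map_poly_cnj)
  with z(2) have "norm (poly_eval p a) = cmod (poly p x)" by simp
  with x(1) show ?thesis by blast
qed

lemma cmod_poly_le_norm:
  assumes "x \<in> spectrum a"
  shows "cmod (poly p x) \<le> norm (poly_eval p a)"
  using cmod_spectrum_le[OF poly_in_spectrum[OF assms]] .


section \<open>Continuous functional calculus\<close>

text \<open>The relation \<open>calculus_limit a g b\<close> says that \<open>b\<close> is \<open>g\<close> of \<open>a\<close>, in a form that is convenient to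
  verify for concrete functions: polynomials converging to \<open>g\<close> uniformly on the spectrum converge
  to \<open>b\<close> when evaluated at \<open>a\<close>.\<close>

definition calculus_limit :: "'a::cstar_algebra \<Rightarrow> (complex \<Rightarrow> complex) \<Rightarrow> 'a \<Rightarrow> bool" where
  "calculus_limit a g b \<longleftrightarrow> (\<exists>p. uniform_limit (spectrum a) (\<lambda>n. poly (p n)) g sequentially \<and>
     (\<lambda>n. poly_eval (p n) a) \<longlonglongrightarrow> b)"

lemma calculus_limit_poly: "calculus_limit a (poly p) (poly_eval p a)"
  unfolding calculus_limit_def by (intro exI[of _ "\<lambda>_. p"]) (auto intro: uniform_limit_const)

lemma calculus_limit_cong:
  assumes "calculus_limit a g b" "\<And>x. x \<in> spectrum a \<Longrightarrow> g x = h x"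
  shows "calculus_limit a h b"
  using assms unfolding calculus_limit_def by (metis uniform_limit_cong')

lemma calculus_limit_add:
  assumes "calculus_limit a g b" "calculus_limit a h c"
  shows "calculus_limit a (\<lambda>z. g z + h z) (b + c)"
proof -
  obtain p q where p: "uniform_limit (spectrum a) (\<lambda>n. poly (p n)) g sequentially"
    "(\<lambda>n. poly_eval (p n) a) \<longlonglongrightarrow> b" and q: "uniform_limit (spectrum a) (\<lambda>n. poly (q n)) h sequentially"
    "(\<lambda>n. poly_eval (q n) a) \<longlonglongrightarrow> c" using assms unfolding calculus_limit_def by blast
  show ?thesis unfolding calculus_limit_def
    using uniform_limit_add[OF p(1) q(1)] tendsto_add[OF p(2) q(2)]
    by (intro exI[of _ "\<lambda>n. p n + q n"]) (simp add: poly_eval_add poly_add [abs_def])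
qed

lemma calculus_limit_continuous:
  assumes "calculus_limit a g b"
  shows "continuous_on (spectrum a) g"
proof -
  obtain p where p: "uniform_limit (spectrum a) (\<lambda>n. poly (p n)) g sequentially"
    using assms unfolding calculus_limit_def by blast
  show ?thesis
    by (rule uniform_limit_theorem[OF _ p]) (auto intro!: always_eventually continuous_intros)
qed

lemma calculus_limit_mult:
  assumes "calculus_limit a g b" "calculus_limit a h c"
  shows "calculus_limit a (\<lambda>z. g z * h z) (b * c)"
proof -
  obtain p q where p: "uniform_limit (spectrum a) (\<lambda>n. poly (p n)) g sequentially"
    "(\<lambda>n. poly_eval (p n) a) \<longlonglongrightarrow> b" and q: "uniform_limit (spectrum a) (\<lambda>n. poly (q n)) h sequentially"
    "(\<lambda>n. poly_eval (q n) a) \<longlonglongrightarrow> c" using assms unfolding calculus_limit_def by blast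
  have "bounded (g ` spectrum a)" "bounded (h ` spectrum a)"
    using assms compact_spectrum[of a]
    by (auto intro!: compact_imp_bounded compact_continuous_image calculus_limit_continuous)
  from uniform_lim_mult[OF p(1) q(1) this] tendsto_mult[OF p(2) q(2)] show ?thesis
    unfolding calculus_limit_def
    by (intro exI[of _ "\<lambda>n. p n * q n"]) (simp add: poly_eval_mult poly_mult [abs_def])
qed

lemma calculus_limit_scaleC:
  assumes "calculus_limit a g b"
  shows "calculus_limit a (\<lambda>z. c * g z) (c *\<^sub>C b)"
  using calculus_limit_mult[OF calculus_limit_poly[of a "[:c:]"] assms]
  by (simp add: poly_eval_const mult_scaleC_left)

lemma calculus_limit_diff:
  assumes "calculus_limit a g b" "calculus_limit a h c"
  shows "calculus_limit a (\<lambda>z. g z - h z) (b - c)"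
  using calculus_limit_add[OF assms(1) calculus_limit_scaleC[OF assms(2), of "-1"]]
  by (simp add: scaleC_minus_left scaleC_one)

lemma calculus_limit_sum:
  assumes "\<And>i. i \<in> S \<Longrightarrow> calculus_limit a (g i) (b i)"
  shows "calculus_limit a (\<lambda>z. \<Sum>i\<in>S. g i z) (\<Sum>i\<in>S. b i)"
proof -
  have "calculus_limit a (\<lambda>z. 0) 0"
    using calculus_limit_poly[of a 0] by (simp add: poly_0 [abs_def])
  then show ?thesis using assms
    by (induction S rule: infinite_finite_induct) (auto intro: calculus_limit_add)
qed

lemma calculus_limit_star:
  assumes sa: "star a = a" and "calculus_limit a g b"
  shows "calculus_limit a (\<lambda>z. cnj (g z)) (star b)"
proof -
  obtain p where p: "uniform_limit (spectrum a) (\<lambda>n. poly (p n)) g sequentially"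
    "(\<lambda>n. poly_eval (p n) a) \<longlonglongrightarrow> b" using assms unfolding calculus_limit_def by blast
  have "uniform_limit (spectrum a) (\<lambda>n z. cnj (poly (p n) z)) (\<lambda>z. cnj (g z)) sequentially"
    using p(1) by (simp add: uniform_limit_iff dist_norm complex_cnj_diff[symmetric] del: complex_cnj_diff)
  then have "uniform_limit (spectrum a) (\<lambda>n. poly (map_poly cnj (p n))) (\<lambda>z. cnj (g z)) sequentially"
    by (rule uniform_limit_cong'[THEN iffD1, rotated -1])
       (simp_all add: poly_map_cnj_real spectrum_self_adjoint_real[OF sa] del: poly_map_poly_cnj)
  moreover have "(\<lambda>n. poly_eval (map_poly cnj (p n)) a) \<longlonglongrightarrow> star b"
    unfolding poly_eval_star[OF sa] by (rule bounded_linear.tendsto[OF bounded_linear_star p(2)])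
  ultimately show ?thesis
    unfolding calculus_limit_def by (intro exI[of _ "\<lambda>n. map_poly cnj (p n)"]) simp
qed

lemma calculus_limit_norm_le:
  assumes sa: "star a = a" and "calculus_limit a g b" and le: "\<And>x. x \<in> spectrum a \<Longrightarrow> cmod (g x) \<le> M"
  shows "norm b \<le> M"
proof -
  obtain p where p: "uniform_limit (spectrum a) (\<lambda>n. poly (p n)) g sequentially"
    "(\<lambda>n. poly_eval (p n) a) \<longlonglongrightarrow> b" using assms unfolding calculus_limit_def by blast
  have "norm b \<le> M + e" if "e > 0" for e
  proof (rule tendsto_upperbound)
    show "((\<lambda>n. norm (poly_eval (p n) a)) \<longlongrightarrow> norm b) sequentially" by (rule tendsto_norm[OF p(2)])
    have "\<forall>\<^sub>F n in sequentially. \<forall>x\<in>spectrum a. dist (poly (p n) x) (g x) < e"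
      using p(1) that by (simp add: uniform_limit_iff)
    then show "\<forall>\<^sub>F n in sequentially. norm (poly_eval (p n) a) \<le> M + e"
    proof eventually_elim
      case (elim n)
      obtain x where x: "x \<in> spectrum a" "norm (poly_eval (p n) a) = cmod (poly (p n) x)"
        using norm_poly_eval_attained[OF sa] by blast
      have "cmod (poly (p n) x) \<le> cmod (g x) + dist (poly (p n) x) (g x)"
        using norm_triangle_ineq[of "g x" "poly (p n) x - g x"] by (simp add: dist_norm)
      with elim x le[of x] show ?case by force
    qed
  qed simp
  then show ?thesis by (rule field_le_epsilon)
qed

lemma cmod_le_calculus_limit:
  assumes "calculus_limit a g b" "x \<in> spectrum a"
  shows "cmod (g x) \<le> norm b"
proof -
  obtain p where p: "uniform_limit (spectrum a) (\<lambda>n. poly (p n)) g sequentially"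
    "(\<lambda>n. poly_eval (p n) a) \<longlonglongrightarrow> b" using assms unfolding calculus_limit_def by blast
  have "(\<lambda>n. poly (p n) x) \<longlonglongrightarrow> g x" using p(1) assms(2) by (rule tendsto_uniform_limitI)
  from tendsto_norm[OF this] tendsto_norm[OF p(2)] show ?thesis
    by (rule LIMSEQ_le) (use cmod_poly_le_norm[OF assms(2)] in auto)
qed

lemma calculus_limit_norm:
  assumes sa: "star a = a" and g: "calculus_limit a g b"
  shows "norm b = (SUP x\<in>spectrum a. cmod (g x))"
proof (rule antisym)
  have ne: "spectrum a \<noteq> {}" using norm_attained_on_spectrum[OF sa] by auto
  have bdd: "bdd_above ((\<lambda>x. cmod (g x)) ` spectrum a)"
    using cmod_le_calculus_limit[OF g] by (auto intro!: bdd_aboveI)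
  show "norm b \<le> (SUP x\<in>spectrum a. cmod (g x))"
    by (rule calculus_limit_norm_le[OF sa g]) (auto intro: cSUP_upper bdd)
  show "(SUP x\<in>spectrum a. cmod (g x)) \<le> norm b"
    by (rule cSUP_least[OF ne]) (rule cmod_le_calculus_limit[OF g])
qed

lemma calculus_limit_unique:
  assumes sa: "star a = a" and "calculus_limit a g b" "calculus_limit a g b'"
  shows "b = b'"
proof -
  have "norm (b - b') \<le> 0"
    by (rule calculus_limit_norm_le[OF sa calculus_limit_diff[OF assms(2,3)]]) simp
  then show ?thesis by simp
qed

text \<open>Every real continuous function on the spectrum is a uniform limit of polynomials by the
  Weierstrass theorem, since the spectrum is a compact set of reals.\<close>

lemma calculus_limit_exists_real:
  assumes sa: "star a = a" and g: "continuous_on (spectrum a) g"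
    and real: "\<And>x. x \<in> spectrum a \<Longrightarrow> g x \<in> \<real>"
  shows "\<exists>b. calculus_limit a g b"
proof -
  let ?S = "Re ` spectrum a"
  have re: "x \<in> spectrum a \<Longrightarrow> complex_of_real (Re x) = x" for x
    using spectrum_self_adjoint_real[OF sa, of x] by (simp add: complex_eq_iff)
  have cS: "compact ?S" by (intro compact_continuous_image compact_spectrum continuous_intros)
  have "continuous_on ?S (\<lambda>t. Re (g (complex_of_real t)))"
    by (intro continuous_intros continuous_on_compose2[OF g]) (auto simp: re)
  then have "\<exists>q. real_polynomial_function q \<and>
      (\<forall>t\<in>?S. \<bar>Re (g (complex_of_real t)) - q t\<bar> < 1 / real (Suc n))" for n
    using Stone_Weierstrass_real_polynomial_function[OF cS, of _ "1 / real (Suc n)"]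
    by (metis of_nat_0_less_iff zero_less_Suc zero_less_divide_1_iff)
  then obtain q where q: "\<And>n. real_polynomial_function (q n)"
    "\<And>n t. t \<in> ?S \<Longrightarrow> \<bar>Re (g (complex_of_real t)) - q n t\<bar> < 1 / real (Suc n)" by metis
  have "\<exists>p. \<forall>t. poly p (complex_of_real t) = complex_of_real (q n t)" for n
  proof -
    obtain c m where "q n = (\<lambda>x. \<Sum>i\<le>m. c i * x ^ i)"
      using q(1)[of n] by (auto simp: real_polynomial_function_iff_sum)
    then show ?thesis
      by (intro exI[of _ "\<Sum>i\<le>m. monom (complex_of_real (c i)) i"])
         (simp add: poly_sum poly_monom)
  qed
  then obtain p where p: "\<And>n t. poly (p n) (complex_of_real t) = complex_of_real (q n t)" by metis
  have close: "cmod (poly (p n) x - g x) < 1 / real (Suc n)" if x: "x \<in> spectrum a" for n x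
  proof -
    have "poly (p n) x - g x = complex_of_real (q n (Re x) - Re (g x))"
      using p[of n "Re x"] re[OF x] real[OF x] by (simp add: of_real_Re)
    then have "cmod (poly (p n) x - g x) = \<bar>q n (Re x) - Re (g x)\<bar>"
      by (metis norm_of_real)
    then show ?thesis using q(2)[of "Re x" n] x re[OF x] by (simp add: abs_minus_commute)
  qed
  have ul: "uniform_limit (spectrum a) (\<lambda>n. poly (p n)) g sequentially"
    unfolding uniform_limit_iff
  proof safe
    fix e :: real assume "e > 0"
    then obtain N where N: "1 / real (Suc N) < e" using nat_approx_posE by blast
    show "\<forall>\<^sub>F n in sequentially. \<forall>x\<in>spectrum a. dist (poly (p n) x) (g x) < e"
      unfolding eventually_sequentially
    proof (intro exI[of _ N] allI impI ballI)
      fix n x assume "N \<le> n" "x \<in> spectrum a"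
      then have "1 / real (Suc n) \<le> 1 / real (Suc N)" by (simp add: field_simps)
      with close[OF \<open>x \<in> spectrum a\<close>, of n] N show "dist (poly (p n) x) (g x) < e"
        by (simp add: dist_norm)
    qed
  qed
  have "Cauchy (\<lambda>n. poly_eval (p n) a)"
  proof (rule Cauchy_if_le_null)
    show "(\<lambda>n. 1 / real (Suc n)) \<longlonglongrightarrow> 0" by (rule LIMSEQ_Suc[OF lim_1_over_n])
    fix m n
    obtain x where x: "x \<in> spectrum a" "norm (poly_eval (p m - p n) a) = cmod (poly (p m - p n) x)"
      using norm_poly_eval_attained[OF sa] by blast
    have "cmod (poly (p m - p n) x) \<le> cmod (poly (p m) x - g x) + cmod (poly (p n) x - g x)"
      using norm_triangle_ineq4[of "poly (p m) x - g x" "poly (p n) x - g x"] by simp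
    then show "norm (poly_eval (p m) a - poly_eval (p n) a) \<le> 1 / real (Suc m) + 1 / real (Suc n)"
      using close[OF x(1), of m] close[OF x(1), of n] x(2) by (simp add: poly_eval_diff)
  qed
  then obtain b where "(\<lambda>n. poly_eval (p n) a) \<longlonglongrightarrow> b"
    using Cauchy_convergent convergent_def by blast
  with ul show ?thesis unfolding calculus_limit_def by blast
qed

lemma calculus_limit_exists:
  assumes sa: "star a = a" and g: "continuous_on (spectrum a) g"
  shows "\<exists>b. calculus_limit a g b"
proof -
  obtain b where b: "calculus_limit a (\<lambda>z. complex_of_real (Re (g z))) b"
    using calculus_limit_exists_real[OF sa, of "\<lambda>z. complex_of_real (Re (g z))"] g
    by (auto intro: continuous_intros)
  obtain c where c: "calculus_limit a (\<lambda>z. complex_of_real (Im (g z))) c"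
    using calculus_limit_exists_real[OF sa, of "\<lambda>z. complex_of_real (Im (g z))"] g
    by (auto intro: continuous_intros)
  have "calculus_limit a g (b + \<i> *\<^sub>C c)"
    by (rule calculus_limit_cong[OF calculus_limit_add[OF b calculus_limit_scaleC[OF c, of \<i>]]])
       (simp add: complex_eq[symmetric])
  then show ?thesis ..
qed

lemma is_functional_calculusD:
  assumes "is_functional_calculus a \<Phi>" "continuous_on (spectrum a) g"
  shows "continuous_on (spectrum a) h \<Longrightarrow> \<Phi> (\<lambda>z. g z + h z) = \<Phi> g + \<Phi> h"
    and "continuous_on (spectrum a) h \<Longrightarrow> \<Phi> (\<lambda>z. g z * h z) = \<Phi> g * \<Phi> h"
    and "\<Phi> (\<lambda>z. c * g z) = c *\<^sub>C \<Phi> g"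
    and "norm (\<Phi> g) = (SUP z\<in>spectrum a. cmod (g z))"
  using assms unfolding is_functional_calculus_def by blast+

lemma is_functional_calculus_poly:
  assumes fc: "is_functional_calculus a \<Phi>"
  shows "\<Phi> (poly p) = poly_eval p a"
proof (induction p)
  case 0
  show ?case
    using is_functional_calculusD(3)[OF fc continuous_on_const, of 0 0] by (simp add: poly_0 [abs_def])
next
  case (pCons c p)
  have cp: "continuous_on (spectrum a) (poly p)" by (intro continuous_intros)
  have one: "\<Phi> (\<lambda>z. 1) = 1" and id: "\<Phi> (\<lambda>z. z) = a"
    using fc by (simp_all add: is_functional_calculus_def)
  have "\<Phi> (\<lambda>z. c * 1) = c *\<^sub>C 1"
    using is_functional_calculusD(3)[OF fc continuous_on_const, of c 1] by (simp add: one)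
  moreover have "\<Phi> (\<lambda>z. z * poly p z) = a * \<Phi> (poly p)"
    using is_functional_calculusD(2)[OF fc continuous_on_id cp] by (simp add: id)
  moreover have "\<Phi> (\<lambda>z. c * 1 + z * poly p z) = \<Phi> (\<lambda>z. c * 1) + \<Phi> (\<lambda>z. z * poly p z)"
    by (rule is_functional_calculusD(1)[OF fc]) (intro continuous_intros)+
  moreover have "poly (pCons c p) = (\<lambda>z. c * 1 + z * poly p z)" by (simp add: fun_eq_iff)
  ultimately show ?case by (simp add: poly_eval_pCons pCons.IH)
qed

text \<open>A functional calculus is determined on polynomials, and it is isometric for the supremum over the
  spectrum, so it is continuous under uniform convergence there.\<close>

lemma is_functional_calculus_eq_limit:
  assumes sa: "star a = a" and \<Phi>: "is_functional_calculus a \<Phi>" and g: "calculus_limit a g b"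
  shows "\<Phi> g = b"
proof -
  obtain p where p: "uniform_limit (spectrum a) (\<lambda>n. poly (p n)) g sequentially"
    "(\<lambda>n. poly_eval (p n) a) \<longlonglongrightarrow> b" using g unfolding calculus_limit_def by blast
  have ne: "spectrum a \<noteq> {}" using norm_attained_on_spectrum[OF sa] by auto
  have cg: "continuous_on (spectrum a) g" by (rule calculus_limit_continuous[OF g])
  have diff: "norm (\<Phi> g - poly_eval (p n) a) = (SUP z\<in>spectrum a. cmod (g z - poly (p n) z))" for n
  proof -
    have c: "continuous_on (spectrum a) (poly (p n))" by (intro continuous_intros)
    then have c': "continuous_on (spectrum a) (\<lambda>z. (-1) * poly (p n) z)" by (intro continuous_intros)
    have c'': "continuous_on (spectrum a) (\<lambda>z. g z + (-1) * poly (p n) z)"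
      by (intro continuous_intros cg)
    have "\<Phi> (\<lambda>z. (-1) * poly (p n) z) = (-1) *\<^sub>C poly_eval (p n) a"
      using is_functional_calculusD(3)[OF \<Phi> c] by (simp only: is_functional_calculus_poly[OF \<Phi>])
    moreover have "\<Phi> (\<lambda>z. g z + (-1) * poly (p n) z) = \<Phi> g + \<Phi> (\<lambda>z. (-1) * poly (p n) z)"
      by (rule is_functional_calculusD(1)[OF \<Phi> cg c'])
    moreover have "norm (\<Phi> (\<lambda>z. g z + (-1) * poly (p n) z)) =
        (SUP z\<in>spectrum a. cmod (g z + (-1) * poly (p n) z))"
      by (rule is_functional_calculusD(4)[OF \<Phi> c''])
    ultimately show ?thesis by (simp add: scaleC_minus_left scaleC_one)
  qed
  have "(\<lambda>n. poly_eval (p n) a) \<longlonglongrightarrow> \<Phi> g"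
    unfolding tendsto_iff
  proof safe
    fix e :: real assume e: "e > 0"
    have "\<forall>\<^sub>F n in sequentially. \<forall>x\<in>spectrum a. dist (poly (p n) x) (g x) < e / 2"
      using p(1) half_gt_zero[OF e] unfolding uniform_limit_iff by blast
    then show "\<forall>\<^sub>F n in sequentially. dist (poly_eval (p n) a) (\<Phi> g) < e"
    proof eventually_elim
      case (elim n)
      have "(SUP z\<in>spectrum a. cmod (g z - poly (p n) z)) \<le> e / 2"
        using elim by (intro cSUP_least[OF ne]) (auto simp: dist_norm norm_minus_commute less_imp_le)
      with e show ?case by (simp add: dist_norm norm_minus_commute[of _ "\<Phi> g"] diff)
    qed
  qed
  with p(2) show ?thesis by (metis LIMSEQ_unique)
qed

text \<open>Existence of the functional calculus amounts to the closure properties of the relation above;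
  its uniqueness on continuous functions is the previous lemma.\<close>

lemma functional_calculus_eqI:
  assumes sa: "star a = a" and g: "calculus_limit a g b"
  shows "functional_calculus a g = b"
proof -
  define \<Phi> where "\<Phi> h = (SOME b. calculus_limit a h b)" for h
  have lim: "calculus_limit a h (\<Phi> h)" if "continuous_on (spectrum a) h" for h
    unfolding \<Phi>_def using calculus_limit_exists[OF sa that] by (rule someI_ex)
  have eq: "\<Phi> h = b" if "calculus_limit a h b" for h b
    using calculus_limit_unique[OF sa lim that] calculus_limit_continuous[OF that] by blast
  have "is_functional_calculus a \<Phi>"
    unfolding is_functional_calculus_def
  proof (intro conjI allI impI)
    fix g h :: "complex \<Rightarrow> complex" assume gh: "continuous_on (spectrum a) g" "continuous_on (spectrum a) h"
    show "\<Phi> (\<lambda>z. g z + h z) = \<Phi> g + \<Phi> h" "\<Phi> (\<lambda>z. g z * h z) = \<Phi> g * \<Phi> h"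
      using gh by (auto intro!: eq calculus_limit_add calculus_limit_mult lim)
  next
    fix c and g :: "complex \<Rightarrow> complex" assume g: "continuous_on (spectrum a) g"
    show "\<Phi> (\<lambda>z. c * g z) = c *\<^sub>C \<Phi> g" "\<Phi> (\<lambda>z. cnj (g z)) = star (\<Phi> g)"
      using g by (auto intro!: eq calculus_limit_scaleC calculus_limit_star[OF sa] lim)
    show "norm (\<Phi> g) = (SUP z\<in>spectrum a. cmod (g z))"
      by (rule calculus_limit_norm[OF sa lim[OF g]])
  next
    show "\<Phi> (\<lambda>z. 1) = 1"
    proof -
      have "poly [:1:] = (\<lambda>z::complex. 1)" by auto
      then show ?thesis using eq[OF calculus_limit_poly[of a "[:1:]"]]
        by (simp add: poly_eval_const scaleC_one)
    qed
    show "\<Phi> (\<lambda>z. z) = a"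
    proof -
      have "poly [:0, 1:] = (\<lambda>z::complex. z)" by auto
      then show ?thesis using eq[OF calculus_limit_poly[of a "[:0, 1:]"]]
        by (simp add: poly_eval_pCons scaleC_one)
    qed
  qed
  then show ?thesis
    unfolding functional_calculus_def
    by (intro the_equality) (auto dest: is_functional_calculus_eq_limit[OF sa _ g])
qed

lemma calculus_limit_exp:
  assumes sa: "star a = a"
  shows "calculus_limit a (\<lambda>z. exp (c * z)) (exp (c *\<^sub>C a))"
proof -
  define p where "p n = (\<Sum>k<n. monom (c ^ k / fact k) k)" for n :: nat
  have pe: "poly_eval (monom d k) a = d *\<^sub>C a ^ k" for d k
  proof -
    have "poly_eval (monom d k) a = (\<Sum>i\<le>k. coeff (monom d k) i *\<^sub>C a ^ i)"
      by (rule poly_eval_altdef[OF degree_monom_le])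
    also have "\<dots> = (\<Sum>i\<le>k. (if i = k then d *\<^sub>C a ^ k else 0))"
      by (rule sum.cong) auto
    finally show ?thesis by simp
  qed
  have pows: "(c *\<^sub>C a) ^ k = c ^ k *\<^sub>C a ^ k" for k
    by (induction k) (auto simp: scaleC_one mult_scaleC_left mult_scaleC_right scaleC_scaleC mult.commute)
  have ev: "poly_eval (p n) a = (\<Sum>k<n. (c *\<^sub>C a) ^ k /\<^sub>R fact k)" for n
  proof (induction n)
    case (Suc n)
    then show ?case
      by (simp add: p_def poly_eval_add pe pows scaleR_scaleC scaleC_scaleC divide_inverse mult.commute)
  qed (simp add: p_def)
  have "(\<lambda>n. poly_eval (p n) a) \<longlonglongrightarrow> exp (c *\<^sub>C a)"
    unfolding ev exp_def by (rule summable_LIMSEQ[OF summable_exp_generic])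
  moreover have "uniform_limit (spectrum a) (\<lambda>n z. \<Sum>k<n. (c * z) ^ k /\<^sub>R fact k)
      (\<lambda>z. \<Sum>k. (c * z) ^ k /\<^sub>R fact k) sequentially"
  proof (rule Weierstrass_m_test)
    show "summable (\<lambda>k. (cmod c * norm a) ^ k /\<^sub>R fact k)" by (rule summable_exp_generic)
    fix k z assume z: "z \<in> spectrum a"
    have "cmod (c * z) ^ k \<le> (cmod c * norm a) ^ k"
      using cmod_spectrum_le[OF z] by (intro power_mono) (auto simp: norm_mult mult_left_mono)
    then show "cmod ((c * z) ^ k /\<^sub>R fact k) \<le> (cmod c * norm a) ^ k /\<^sub>R fact k"
      by (simp add: norm_power norm_mult mult_left_mono)
  qed
  moreover have "poly (p n) = (\<lambda>z. \<Sum>k<n. (c * z) ^ k /\<^sub>R fact k)" for n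
    by (rule ext) (simp add: p_def poly_sum poly_monom power_mult_distrib scaleR_conv_of_real
        divide_inverse mult_ac)
  ultimately show ?thesis unfolding calculus_limit_def
    by (intro exI[of _ p]) (simp add: exp_def [where 'a = complex])
qed


section \<open>Orthogonal projections in a Hilbert space\<close>

lemma cinner_add_left: "cinner (x + y) (z::'h::complex_hilbert_space) = cinner x z + cinner y z"
  by (metis cinner_add_right cinner_commute complex_cnj_add)

lemma cinner_zero_right [simp]: "cinner (x::'h::complex_hilbert_space) 0 = 0"
  using cinner_scaleC_right[of x 0 x] by simp

lemma cinner_zero_left [simp]: "cinner 0 (x::'h::complex_hilbert_space) = 0"
  using cinner_commute[of 0 x] by simp

lemma cinner_minus_right: "cinner x (- y::'h::complex_hilbert_space) = - cinner x y"
  using cinner_add_right[of x "-y" y] by (simp add: eq_neg_iff_add_eq_0)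

lemma cinner_diff_right: "cinner x (y - z::'h::complex_hilbert_space) = cinner x y - cinner x z"
  using cinner_add_right[of x y "-z"] by (simp add: cinner_minus_right)

lemma cinner_diff_left: "cinner (x - y) (z::'h::complex_hilbert_space) = cinner x z - cinner y z"
  by (metis cinner_diff_right cinner_commute complex_cnj_diff)

lemma cinner_sum_right: "cinner x (\<Sum>i\<in>S. f i::'h::complex_hilbert_space) = (\<Sum>i\<in>S. cinner x (f i))"
  by (induction S rule: infinite_finite_induct) (auto simp: cinner_add_right)

lemma norm_add_square:
  "(norm (x + y::'h::complex_hilbert_space))\<^sup>2 = (norm x)\<^sup>2 + (norm y)\<^sup>2 + 2 * Re (cinner x y)"
proof -
  have "complex_of_real ((norm (x + y))\<^sup>2) = cinner (x + y) (x + y)" by (simp add: cinner_self)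
  also have "\<dots> = cinner x x + cinner y y + (cinner x y + cnj (cinner x y))"
    by (simp add: cinner_add_left cinner_add_right cinner_commute[of y x])
  also have "\<dots> = complex_of_real ((norm x)\<^sup>2 + (norm y)\<^sup>2 + 2 * Re (cinner x y))"
    by (simp add: cinner_self complex_add_cnj)
  finally show ?thesis by (simp only: of_real_eq_iff)
qed

lemma norm_diff_square:
  "(norm (x - y::'h::complex_hilbert_space))\<^sup>2 = (norm x)\<^sup>2 + (norm y)\<^sup>2 - 2 * Re (cinner x y)"
  using norm_add_square[of x "-y"] by (simp add: cinner_minus_right)

text \<open>The point of the line through \<open>0\<close> and \<open>z\<close> closest to \<open>w\<close>; this identity yields both the
  Cauchy-Schwarz inequality and the orthogonality of nearest points.\<close>

lemma norm_diff_component_square: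
  fixes w z :: "'h::complex_hilbert_space"
  assumes "z \<noteq> 0"
  shows "(norm (w - (cinner z w / complex_of_real ((norm z)\<^sup>2)) *\<^sub>C z))\<^sup>2 =
    (norm w)\<^sup>2 - (cmod (cinner z w))\<^sup>2 / (norm z)\<^sup>2"
proof -
  define s where "s = (norm z)\<^sup>2"
  have s: "s \<noteq> 0" using assms by (simp add: s_def)
  have "cinner w ((cinner z w / complex_of_real s) *\<^sub>C z) = cinner z w * cnj (cinner z w) / complex_of_real s"
    by (simp add: cinner_scaleC_right cinner_commute[of w z])
  also have "\<dots> = complex_of_real ((cmod (cinner z w))\<^sup>2 / s)"
    by (simp add: complex_mult_cnj cmod_power2 [symmetric] del: of_real_power)
  finally have 1: "Re (cinner w ((cinner z w / complex_of_real s) *\<^sub>C z)) = (cmod (cinner z w))\<^sup>2 / s"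
    by simp
  have 2: "(norm ((cinner z w / complex_of_real s) *\<^sub>C z))\<^sup>2 = (cmod (cinner z w))\<^sup>2 / s"
  proof -
    have "(norm ((cinner z w / complex_of_real s) *\<^sub>C z))\<^sup>2 = (cmod (cinner z w))\<^sup>2 / s\<^sup>2 * s"
      by (simp add: norm_scaleC norm_divide power_mult_distrib power_divide s_def[symmetric])
    then show ?thesis using s by (simp add: power2_eq_square)
  qed
  show ?thesis unfolding norm_diff_square s_def[symmetric] 1 2 by simp
qed

lemma Cauchy_Schwarz_cinner: "cmod (cinner x (y::'h::complex_hilbert_space)) \<le> norm x * norm y"
proof (cases "x = 0")
  case False
  have "0 \<le> (norm y)\<^sup>2 - (cmod (cinner x y))\<^sup>2 / (norm x)\<^sup>2"
    by (metis norm_diff_component_square[OF False] zero_le_power2)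
  then have "(cmod (cinner x y))\<^sup>2 \<le> (norm x * norm y)\<^sup>2"
    using False by (simp add: field_simps power_mult_distrib)
  then show ?thesis by (rule power2_le_imp_le) simp
qed simp

lemma module_scaleC: "module ((*\<^sub>C) :: complex \<Rightarrow> 'a::complex_normed_vector \<Rightarrow> 'a)"
  by unfold_locales (auto simp: scaleC_add_left scaleC_add_right scaleC_scaleC scaleC_one)

lemma csubspace_iff: "module.subspace (*\<^sub>C) (S::'a::complex_normed_vector set) \<longleftrightarrow>
    0 \<in> S \<and> (\<forall>x\<in>S. \<forall>y\<in>S. x + y \<in> S) \<and> (\<forall>c. \<forall>x\<in>S. c *\<^sub>C x \<in> S)"
  by (rule module.subspace_def[OF module_scaleC])

lemma csubspace_diff: "module.subspace (*\<^sub>C) S \<Longrightarrow> x \<in> S \<Longrightarrow> y \<in> S \<Longrightarrow> x - y \<in> (S::'a::complex_normed_vector set)"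
  by (rule module.subspace_diff[OF module_scaleC])

lemma csubspace_closure:
  assumes "module.subspace (*\<^sub>C) (S::'a::complex_normed_vector set)"
  shows "module.subspace (*\<^sub>C) (closure S)"
  unfolding csubspace_iff
proof (intro conjI allI ballI)
  show "0 \<in> closure S" using assms closure_subset[of S] by (auto simp: csubspace_iff)
next
  fix x y assume "x \<in> closure S" "y \<in> closure S"
  then obtain f g where "\<And>n. f n \<in> S" "f \<longlonglongrightarrow> x" "\<And>n. g n \<in> S" "g \<longlonglongrightarrow> y"
    by (auto simp: closure_sequential)
  then show "x + y \<in> closure S" unfolding closure_sequential
    using assms by (intro exI[of _ "\<lambda>n. f n + g n"]) (auto simp: csubspace_iff intro: tendsto_add)
next
  fix c x assume "x \<in> closure S"
  then obtain f where "\<And>n. f n \<in> S" "f \<longlonglongrightarrow> x"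
    by (auto simp: closure_sequential)
  then show "c *\<^sub>C x \<in> closure S" unfolding closure_sequential
    using assms by (intro exI[of _ "\<lambda>n. c *\<^sub>C f n"]) (auto simp: csubspace_iff intro: tendsto_scaleC)
qed

text \<open>A minimizing sequence for the distance to \<open>x\<close> is Cauchy by the parallelogram law.\<close>

lemma orthogonal_decomposition_exists:
  fixes M :: "'h::complex_hilbert_space set"
  assumes sub: "module.subspace (*\<^sub>C) M" and cl: "closed M"
  shows "\<exists>y\<in>M. \<forall>z\<in>M. cinner z (x - y) = 0"
proof -
  define D where "D = Inf ((\<lambda>y. (norm (x - y))\<^sup>2) ` M)"
  have "0 \<in> M" using sub by (simp add: csubspace_iff)
  have Dle: "D \<le> (norm (x - y))\<^sup>2" if "y \<in> M" for y
    unfolding D_def using that by (intro cInf_lower bdd_belowI[of _ 0]) auto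
  have "\<exists>y\<in>M. (norm (x - y))\<^sup>2 < D + 1 / real (Suc n)" for n
    using cInf_lessD[of "(\<lambda>y. (norm (x - y))\<^sup>2) ` M" "D + 1 / real (Suc n)"] \<open>0 \<in> M\<close>
    by (auto simp: D_def)
  then obtain y where y: "\<And>n. y n \<in> M" "\<And>n. (norm (x - y n))\<^sup>2 < D + 1 / real (Suc n)" by metis
  have par: "(norm (y n - y m))\<^sup>2 \<le> 2 / real (Suc n) + 2 / real (Suc m)" for n m
  proof -
    let ?u = "x - y n" and ?v = "x - y m"
    have "(1/2) *\<^sub>R (y n + y m) \<in> M" using sub y(1) by (simp add: csubspace_iff scaleR_scaleC)
    then have "D \<le> (norm (x - (1/2) *\<^sub>R (y n + y m)))\<^sup>2" by (rule Dle)
    also have "x - (1/2) *\<^sub>R (y n + y m) = (1/2) *\<^sub>R (?u + ?v)"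
    proof -
      have "x = (1/2) *\<^sub>R (x + x)" by (simp add: scaleR_half_double)
      then show ?thesis by (simp add: algebra_simps)
    qed
    also have "(norm ((1/2) *\<^sub>R (?u + ?v)))\<^sup>2 = (norm (?u + ?v))\<^sup>2 / 4"
      by (simp add: power_divide)
    finally have "4 * D \<le> (norm (?u + ?v))\<^sup>2" by simp
    moreover have "(norm (?u + ?v))\<^sup>2 + (norm (?u - ?v))\<^sup>2 = 2 * (norm ?u)\<^sup>2 + 2 * (norm ?v)\<^sup>2"
      unfolding norm_add_square norm_diff_square by simp
    moreover have "norm (?u - ?v) = norm (y n - y m)" by (simp add: norm_minus_commute)
    ultimately show ?thesis using y(2)[of n] y(2)[of m] by simp
  qed
  have "Cauchy y"
  proof (rule Cauchy_if_le_null)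
    have "(\<lambda>n. sqrt (2 * (1 / real (Suc n)))) \<longlonglongrightarrow> sqrt (2 * 0)"
      by (intro tendsto_intros LIMSEQ_Suc[OF lim_1_over_n])
    then show "(\<lambda>n. sqrt (2 / real (Suc n))) \<longlonglongrightarrow> 0" by simp
    show "norm (y m - y n) \<le> sqrt (2 / real (Suc m)) + sqrt (2 / real (Suc n))" for m n
      using real_le_rsqrt[OF par[of m n]]
        sqrt_add_le_add_sqrt[of "2 / real (Suc m)" "2 / real (Suc n)"] by simp
  qed
  then obtain l where l: "y \<longlonglongrightarrow> l" using Cauchy_convergent convergent_def by blast
  have lM: "l \<in> M" using closed_sequentially[OF cl _ l] y(1) by blast
  have lD: "(norm (x - l))\<^sup>2 \<le> D"
  proof (rule LIMSEQ_le)
    show "(\<lambda>n. (norm (x - y n))\<^sup>2) \<longlonglongrightarrow> (norm (x - l))\<^sup>2" by (intro tendsto_intros l)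
    show "(\<lambda>n. D + 1 / real (Suc n)) \<longlonglongrightarrow> D"
      using tendsto_add[OF tendsto_const LIMSEQ_Suc[OF lim_1_over_n], of D] by simp
    show "\<exists>N. \<forall>n\<ge>N. (norm (x - y n))\<^sup>2 \<le> D + 1 / real (Suc n)" using y(2) less_imp_le by blast
  qed
  have "cinner z (x - l) = 0" if z: "z \<in> M" for z
  proof (cases "z = 0")
    case False
    define c where "c = cinner z (x - l) / complex_of_real ((norm z)\<^sup>2)"
    have "l + c *\<^sub>C z \<in> M" using sub lM z by (simp add: csubspace_iff)
    then have "D \<le> (norm (x - (l + c *\<^sub>C z)))\<^sup>2" by (rule Dle)
    also have "\<dots> = (norm (x - l - c *\<^sub>C z))\<^sup>2" by (simp add: diff_diff_eq)
    also have "\<dots> = (norm (x - l))\<^sup>2 - (cmod (cinner z (x - l)))\<^sup>2 / (norm z)\<^sup>2"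
      unfolding c_def by (rule norm_diff_component_square[OF False])
    finally have "(cmod (cinner z (x - l)))\<^sup>2 / (norm z)\<^sup>2 \<le> 0" using lD by linarith
    then show ?thesis using False by (simp add: divide_le_0_iff)
  qed simp
  with lM show ?thesis by blast
qed

lemma orthogonal_projection_eqI:
  fixes M :: "'h::complex_hilbert_space set"
  assumes sub: "module.subspace (*\<^sub>C) M" and y: "y \<in> M" "\<And>z. z \<in> M \<Longrightarrow> cinner z (x - y) = 0"
  shows "orthogonal_projection M x = y"
  unfolding orthogonal_projection_def
proof (rule the_equality)
  show "y \<in> M \<and> (\<forall>z\<in>M. cinner z (x - y) = 0)" using y by blast
  fix y' assume y': "y' \<in> M \<and> (\<forall>z\<in>M. cinner z (x - y') = 0)"
  then have "y' - y \<in> M" using csubspace_diff[OF sub] y(1) by blast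
  then have "cinner (y' - y) ((x - y) - (x - y')) = 0"
    using y y' by (simp only: cinner_diff_right[of _ "x - y"]) simp
  then show "y' = y" by (simp add: cinner_self)
qed

lemma orthogonal_projection:
  fixes M :: "'h::complex_hilbert_space set"
  assumes "module.subspace (*\<^sub>C) M" "closed M"
  shows "orthogonal_projection M x \<in> M"
    and "z \<in> M \<Longrightarrow> cinner z (x - orthogonal_projection M x) = 0"
  using orthogonal_decomposition_exists[OF assms, of x] orthogonal_projection_eqI[OF assms(1)]
  by metis+


section \<open>The two norms of a C*-probability space\<close>

locale faithful_gns =
  fixes \<rho> :: "'a::cstar_algebra \<Rightarrow> complex" and hat :: "'a \<Rightarrow> 'h::complex_hilbert_space"
  assumes state: "state \<rho>" and faithful: "faithful \<rho>" and gns: "gns_space \<rho> hat"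
begin

abbreviation norm2 :: "'a \<Rightarrow> real" where "norm2 a \<equiv> norm (hat a)"

lemma hat_add: "hat (a + b) = hat a + hat b" and hat_scaleC: "hat (c *\<^sub>C a) = c *\<^sub>C hat a"
  using gns unfolding gns_space_def linear_iff_module_hom module_hom_iff by auto

lemma hat_scaleR: "hat (r *\<^sub>R a) = r *\<^sub>R hat a"
  by (simp add: scaleR_scaleC hat_scaleC)

lemma hat_zero [simp]: "hat 0 = 0"
  using hat_scaleC[of 0 0] by simp

lemma hat_diff: "hat (a - b) = hat a - hat b"
  using hat_add[of "a - b" b] by simp

lemma hat_sum: "hat (\<Sum>i\<in>S. f i) = (\<Sum>i\<in>S. hat (f i))"
  by (induction S rule: infinite_finite_induct) (auto simp: hat_add)

lemma cinner_hat: "cinner (hat a) (hat b) = \<rho> (star a * b)"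
  using gns by (simp add: gns_space_def)

lemma norm2_square: "complex_of_real ((norm2 a)\<^sup>2) = \<rho> (star a * a)"
  by (metis cinner_hat cinner_self)

lemma cinner_hat_mult: "cinner (hat a) (hat (b * c)) = cinner (hat (star b * a)) (hat c)"
  by (simp add: cinner_hat star_mult star_star mult.assoc)

lemma hat_eq_zero_iff [simp]: "hat a = 0 \<longleftrightarrow> a = 0"
  using norm2_square[of a] faithful by (auto simp: faithful_def)

lemma hat_inject: "hat a = hat b \<longleftrightarrow> a = b"
  using hat_eq_zero_iff[of "a - b"] by (simp add: hat_diff)

lemma norm2_one [simp]: "norm2 1 = 1"
proof -
  have "complex_of_real ((norm2 1)\<^sup>2) = complex_of_real 1"
    using state by (simp add: norm2_square state_def del: of_real_power)
  then have "(norm2 1)\<^sup>2 = 1" by (simp only: of_real_eq_iff)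
  then show ?thesis using norm_ge_zero[of "hat 1"] unfolding power2_eq_1_iff by linarith
qed

lemma norm2_mult_unitary:
  assumes "star u * u = 1"
  shows "norm2 (u * x) = norm2 x"
proof -
  have "star (u * x) * (u * x) = star x * x"
    using assms by (simp add: star_mult mult.assoc) (simp add: mult.assoc[symmetric])
  then have "(norm2 (u * x))\<^sup>2 = (norm2 x)\<^sup>2"
    by (metis norm2_square of_real_eq_iff)
  then show ?thesis by simp
qed

text \<open>With \<open>b = (\<parallel>a\<parallel>\<^sup>2 - a\<^sup>* a)\<^bsup>1/2\<^esup>\<close>, the inequality is \<open>\<parallel>b c\<parallel>\<^sub>2\<^sup>2 \<ge> 0\<close>.\<close>

lemma norm2_mult_le: "norm2 (a * c) \<le> norm a * norm2 c"
proof -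
  define h where "h = star a * a"
  have sh: "star h = h" by (simp add: h_def star_mult star_star)
  have nh: "norm h = (norm a)\<^sup>2" by (simp add: h_def norm_star_mult)
  define g where "g z = complex_of_real (sqrt ((norm a)\<^sup>2 - Re z))" for z
  have "continuous_on (spectrum h) g" unfolding g_def by (intro continuous_intros)
  then obtain b where b: "calculus_limit h g b" using calculus_limit_exists[OF sh] by blast
  have "calculus_limit h g (star b)"
  proof -
    have "(\<lambda>z. cnj (g z)) = g" by (simp add: g_def fun_eq_iff)
    with calculus_limit_star[OF sh b] show ?thesis by (simp only:)
  qed
  then have sb: "star b = b" by (rule calculus_limit_unique[OF sh _ b])
  have "calculus_limit h (poly [:complex_of_real ((norm a)\<^sup>2), -1:]) (b * b)"
  proof (rule calculus_limit_cong[OF calculus_limit_mult[OF b b]])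
    fix z assume z: "z \<in> spectrum h"
    have "Re z \<le> (norm a)\<^sup>2" using cmod_spectrum_le[OF z] complex_Re_le_cmod[of z] nh by simp
    then have "g z * g z = complex_of_real ((norm a)\<^sup>2 - Re z)"
      unfolding g_def of_real_mult[symmetric] by simp
    also have "\<dots> = poly [:complex_of_real ((norm a)\<^sup>2), -1:] z"
      using spectrum_self_adjoint_real[OF sh z] by (simp add: complex_eq_iff)
    finally show "g z * g z = poly [:complex_of_real ((norm a)\<^sup>2), -1:] z" .
  qed
  from calculus_limit_unique[OF sh this calculus_limit_poly]
  have bb: "b * b = complex_of_real ((norm a)\<^sup>2) *\<^sub>C 1 - h"
    by (simp add: poly_eval_pCons scaleC_minus_left scaleC_one)
  have "star (b * c) * (b * c) = star c * (b * b) * c"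
    by (simp add: star_mult sb mult.assoc)
  also have "\<dots> = complex_of_real ((norm a)\<^sup>2) *\<^sub>C (star c * c) - star (a * c) * (a * c)"
    unfolding bb h_def
    by (simp add: algebra_simps mult_scaleC_left mult_scaleC_right star_mult)
  finally have eq: "star (b * c) * (b * c) =
      complex_of_real ((norm a)\<^sup>2) *\<^sub>C (star c * c) - star (a * c) * (a * c)" .
  have \<rho>: "\<rho> x = cinner (hat 1) (hat x)" for x by (simp add: cinner_hat)
  have lin: "\<rho> (x - y) = \<rho> x - \<rho> y" "\<rho> (k *\<^sub>C x) = k * \<rho> x" for x y k
    by (simp_all only: \<rho> hat_diff hat_scaleC cinner_diff_right cinner_scaleC_right)
  have "complex_of_real ((norm2 (b * c))\<^sup>2) =
      complex_of_real ((norm a)\<^sup>2 * (norm2 c)\<^sup>2 - (norm2 (a * c))\<^sup>2)"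
    unfolding of_real_mult of_real_diff norm2_square eq lin ..
  then have "(norm2 (a * c))\<^sup>2 \<le> (norm a * norm2 c)\<^sup>2"
    using zero_le_power2[of "norm2 (b * c)"] by (simp only: of_real_eq_iff power_mult_distrib)
  then show ?thesis by (rule power2_le_imp_le) simp
qed

lemma norm2_le: "norm2 a \<le> norm a"
  using norm2_mult_le[of a 1] by simp

lemma bounded_linear_hat: "bounded_linear hat"
  by (rule bounded_linear_intro[where K = 1]) (auto simp: hat_add hat_scaleR norm2_le)

lemma tendsto_hat: "(f \<longlongrightarrow> a) F \<Longrightarrow> ((\<lambda>n. hat (f n)) \<longlongrightarrow> hat a) F"
  by (rule bounded_linear.tendsto[OF bounded_linear_hat])

end


section \<open>Fourier inversion for test functions\<close>

abbreviation deriv_fun :: "(real \<Rightarrow> complex) \<Rightarrow> real \<Rightarrow> complex" where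
  "deriv_fun f \<equiv> (\<lambda>y. vector_derivative f (at y))"

lemma test_function_has_derivative:
  "test_function f \<Longrightarrow> (f has_vector_derivative deriv_fun f x) (at x)"
  unfolding test_function_def
  by (metis (mono_tags, lifting) funpow_0 vector_derivative_works)

lemma test_function_continuous: "test_function f \<Longrightarrow> continuous_on S f"
  by (meson continuous_at_imp_continuous_on has_vector_derivative_continuous test_function_has_derivative)

lemma eq_0_outside_closure_support: "x \<notin> closure {x. f x \<noteq> 0} \<Longrightarrow> f x = 0"
  using subsetD[OF closure_subset, of x "{x. f x \<noteq> 0}"] by auto

lemma deriv_fun_eq_0:
  assumes "x \<notin> closure {x. f x \<noteq> 0}"
  shows "deriv_fun f x = 0"
proof -
  have "eventually (\<lambda>y. y \<in> - closure {x. f x \<noteq> 0}) (nhds x)"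
    using assms by (intro eventually_nhds_in_open) auto
  then have "eventually (\<lambda>y. f y = 0) (nhds x)"
    by eventually_elim (rule eq_0_outside_closure_support, simp)
  then have "(f has_vector_derivative 0) (at x)"
    by (subst has_vector_derivative_cong_ev[where g = "\<lambda>_. 0"])
       (use eventually_nhds_x_imp_x in \<open>auto elim: eventually_mono\<close>)
  then show ?thesis by (rule vector_derivative_at)
qed

lemma test_function_deriv:
  assumes "test_function f"
  shows "test_function (deriv_fun f)"
proof -
  let ?D = "\<lambda>g y. vector_derivative g (at y) :: complex"
  have "closure {x. ?D f x \<noteq> 0} \<subseteq> closure {x. f x \<noteq> 0}"
    using deriv_fun_eq_0[of _ f] by (intro closure_minimal) auto
  then have "compact (closure {x. ?D f x \<noteq> 0})"
    using assms unfolding test_function_def compact_eq_bounded_closed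
    by (auto intro: bounded_subset)
  moreover have "((?D ^^ k) (?D f)) differentiable (at x)" for k x
    using assms unfolding test_function_def by (metis funpow_Suc_right o_apply)
  ultimately show ?thesis unfolding test_function_def by blast
qed

lemma test_function_support:
  assumes "test_function f"
  shows "\<exists>R>0. \<forall>x. \<bar>x\<bar> \<ge> R \<longrightarrow> f x = 0 \<and> deriv_fun f x = 0"
proof -
  have "bounded (closure {x. f x \<noteq> 0})"
    using assms unfolding test_function_def by (blast intro: compact_imp_bounded)
  then obtain R where R: "R > 0" "\<And>x. x \<in> closure {x. f x \<noteq> 0} \<Longrightarrow> \<bar>x\<bar> \<le> R"
    by (auto simp: bounded_pos)
  show ?thesis
  proof (intro exI[of _ "R + 1"] conjI allI impI)
    fix x assume "\<bar>x\<bar> \<ge> R + 1"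
    then have x: "x \<notin> closure {x. f x \<noteq> 0}" using R(2)[of x] by auto
    then show "f x = 0" by (rule eq_0_outside_closure_support)
    show "deriv_fun f x = 0" by (rule deriv_fun_eq_0[OF x])
  next
    show "0 < R + 1" using R by simp
  qed
qed

lemma test_function_measurable: "test_function f \<Longrightarrow> f \<in> borel_measurable borel"
  by (intro borel_measurable_continuous_onI test_function_continuous)

lemma integrable_continuous_compact_support:
  fixes h :: "real \<Rightarrow> complex"
  assumes "continuous_on UNIV h" "\<And>x. \<bar>x\<bar> \<ge> R \<Longrightarrow> h x = 0"
  shows "integrable lborel h"
proof -
  have "integrable lborel (\<lambda>x. indicator {-R..R} x *\<^sub>R h x)"
    by (intro borel_integrable_compact continuous_on_subset[OF assms(1)]) auto
  also have "(\<lambda>x. indicator {-R..R} x *\<^sub>R h x) = h"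
  proof
    fix x show "indicator {-R..R} x *\<^sub>R h x = h x"
      using assms(2)[of x] by (cases "\<bar>x\<bar> \<ge> R") (auto simp: indicator_def)
  qed
  finally show ?thesis .
qed

lemma test_function_integrable_mult:
  assumes f: "test_function f" and g: "continuous_on UNIV g"
  shows "integrable lborel (\<lambda>x. f x * g x)"
proof -
  obtain R where R: "\<And>x. \<bar>x\<bar> \<ge> R \<Longrightarrow> f x = 0" using test_function_support[OF f] by blast
  show ?thesis
    by (rule integrable_continuous_compact_support[of _ R])
       (use R in \<open>auto intro!: continuous_intros g test_function_continuous[OF f]\<close>)
qed

lemma test_function_integrable: "test_function f \<Longrightarrow> integrable lborel f"
  using test_function_integrable_mult[of f "\<lambda>_. 1"] by (simp add: continuous_on_const)

lemma fourier_alt: "fourier f t = (LINT s|lborel. f s * iexp (- (t * s)))"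
  unfolding fourier_def by (simp add: mult_ac)

lemma fourier_integrable:
  "test_function f \<Longrightarrow> integrable lborel (\<lambda>s. f s * iexp (- (t * s)))"
  by (erule test_function_integrable_mult) (intro continuous_intros)

lemma norm_fourier_le:
  assumes "test_function f"
  shows "cmod (fourier f t) \<le> (LINT s|lborel. cmod (f s))"
proof -
  have "cmod (fourier f t) \<le> (LINT s|lborel. cmod (f s * iexp (- (t * s))))"
    unfolding fourier_alt by (rule integral_norm_bound)
  then show ?thesis by (simp add: norm_mult del: of_real_minus of_real_mult)
qed

lemma continuous_fourier:
  assumes f: "test_function f"
  shows "continuous_on UNIV (fourier f)"
  unfolding continuous_on_eq_continuous_within
proof (intro ballI continuous_within_sequentiallyI)
  fix t and u :: "nat \<Rightarrow> real" assume u: "u \<longlonglongrightarrow> t"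
  note meas = borel_measurable_integrable[OF fourier_integrable[OF f]]
  show "(\<lambda>n. fourier f (u n)) \<longlonglongrightarrow> fourier f t"
    unfolding fourier_alt
  proof (rule integral_dominated_convergence[OF meas meas, where w = "\<lambda>s. cmod (f s)"])
    show "integrable lborel (\<lambda>s. cmod (f s))" by (rule integrable_norm[OF test_function_integrable[OF f]])
    show "AE s in lborel. (\<lambda>n. f s * iexp (- (u n * s))) \<longlonglongrightarrow> f s * iexp (- (t * s))"
      by (intro AE_I2 tendsto_intros u)
    show "AE s in lborel. cmod (f s * iexp (- (u n * s))) \<le> cmod (f s)" for n
      by (intro AE_I2) (simp add: norm_mult del: of_real_minus of_real_mult)
  qed
qed

text \<open>Integration by parts.\<close>

lemma fourier_deriv:
  assumes f: "test_function f"
  shows "fourier (deriv_fun f) t = \<i> * complex_of_real t * fourier f t"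
proof -
  let ?e = "\<lambda>s. iexp (- (t * s))"
  obtain R where R: "R > 0" "\<And>x. \<bar>x\<bar> \<ge> R \<Longrightarrow> f x = 0" "\<And>x. \<bar>x\<bar> \<ge> R \<Longrightarrow> deriv_fun f x = 0"
    using test_function_support[OF f] by blast
  define h where "h s = deriv_fun f s * ?e s - \<i> * complex_of_real t * (f s * ?e s)" for s
  have ih: "integrable lborel h" unfolding h_def
    by (intro Bochner_Integration.integrable_diff integrable_mult_right fourier_integrable f test_function_deriv)
  have der: "((\<lambda>s. f s * ?e s) has_vector_derivative h s) (at s)" for s
  proof -
    have "(?e has_vector_derivative (- \<i> * complex_of_real t) * ?e s) (at s)"
    proof -
      have "((\<lambda>z. exp (- \<i> * complex_of_real t * z)) has_field_derivative
          (- \<i> * complex_of_real t) * exp (- \<i> * complex_of_real t * complex_of_real s)) (at (complex_of_real s))"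
        by (auto intro!: derivative_eq_intros)
      from has_vector_derivative_real_field[OF this] show ?thesis by (simp add: mult.assoc)
    qed
    from has_vector_derivative_mult[OF test_function_has_derivative[OF f] this]
    show ?thesis by (simp add: h_def algebra_simps)
  qed
  have "(h has_integral (f R * ?e R - f (- R) * ?e (- R))) {-R..R}"
    by (rule fundamental_theorem_of_calculus) (use R(1) der in \<open>auto intro: has_vector_derivative_at_within\<close>)
  then have "(h has_integral 0) {-R..R}" using R by simp
  then have "(h has_integral 0) UNIV"
    by (rule has_integral_on_superset) (use R in \<open>auto simp: h_def\<close>)
  with has_integral_integral_lborel[OF ih] have "integral\<^sup>L lborel h = 0"
    using has_integral_unique by blast
  moreover have "integral\<^sup>L lborel h = fourier (deriv_fun f) t - \<i> * complex_of_real t * fourier f t"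
    unfolding h_def fourier_alt
    by (subst Bochner_Integration.integral_diff)
       (rule integrable_mult_right fourier_integrable f test_function_deriv
          arg_cong2[of _ _ _ _ "(-)"] refl integral_mult_right_zero)+
  ultimately show ?thesis by simp
qed

text \<open>Multiplication by \<open>t\<close> on the transform side is differentiation of \<open>f\<close>, and derivatives of test functions
  are test functions.\<close>

lemma fourier_rapid_decay:
  assumes "test_function f"
  shows "\<exists>M. \<forall>t. cmod (fourier f t) * (1 + \<bar>t\<bar>) ^ m \<le> M"
  using assms
proof (induction m arbitrary: f)
  case 0
  then show ?case using norm_fourier_le by auto
next
  case (Suc m)
  obtain M1 where M1: "\<And>t. cmod (fourier f t) * (1 + \<bar>t\<bar>) ^ m \<le> M1"
    using Suc by blast
  obtain M2 where M2: "\<And>t. cmod (fourier (deriv_fun f) t) * (1 + \<bar>t\<bar>) ^ m \<le> M2"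
    using Suc.IH[OF test_function_deriv[OF Suc.prems]] by blast
  have "cmod (fourier f t) * (1 + \<bar>t\<bar>) ^ Suc m \<le> M1 + M2" for t
    using M1[of t] M2[of t] by (simp add: fourier_deriv[OF Suc.prems] norm_mult algebra_simps)
  then show ?case by blast
qed

lemma integrable_inverse_one_plus_abs_square: "integrable lborel (\<lambda>t::real. 1 / (1 + \<bar>t\<bar>)\<^sup>2)"
proof (rule Bochner_Integration.integrable_bound[of lborel "\<lambda>x. inverse (1 + x\<^sup>2)"])
  have "integrable lborel (\<lambda>x. inverse (1 + x\<^sup>2) :: real)"
    using integrable_inverse_1_plus_square by (simp add: set_integrable_def)
  then show "integrable lborel (\<lambda>x. inverse (1 + x\<^sup>2) :: real)" .
  show "AE t in lborel. norm (1 / (1 + \<bar>t\<bar>)\<^sup>2) \<le> norm (inverse (1 + t\<^sup>2) :: real)"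
  proof (rule AE_I2)
    fix t :: real
    have "1 + t\<^sup>2 \<le> (1 + \<bar>t\<bar>)\<^sup>2" by (simp add: power2_sum)
    moreover have "0 < 1 + t\<^sup>2" by (simp add: add_pos_nonneg)
    ultimately show "norm (1 / (1 + \<bar>t\<bar>)\<^sup>2) \<le> norm (inverse (1 + t\<^sup>2))"
      by (simp add: divide_inverse le_imp_inverse_le)
  qed
qed simp

lemma fourier_weighted_decay:
  assumes f: "test_function f"
  shows "\<exists>D. \<forall>t. cmod (fourier f t) * (1 + \<bar>t\<bar>) ^ m \<le> D / (1 + \<bar>t\<bar>)\<^sup>2"
proof -
  obtain M where M: "\<And>t. cmod (fourier f t) * (1 + \<bar>t\<bar>) ^ (m + 2) \<le> M"
    using fourier_rapid_decay[OF f] by blast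
  have "cmod (fourier f t) * (1 + \<bar>t\<bar>) ^ m \<le> M / (1 + \<bar>t\<bar>)\<^sup>2" for t
  proof -
    have p: "0 < (1 + \<bar>t\<bar>)\<^sup>2" by (simp add: add_pos_nonneg)
    show ?thesis using M[of t] unfolding power_add pos_le_divide_eq[OF p] by (simp only: mult.assoc)
  qed
  then show ?thesis by blast
qed

lemma fourier_weighted_integrable:
  assumes f: "test_function f"
  shows "integrable lborel (\<lambda>t. cmod (fourier f t) * (1 + \<bar>t\<bar>) ^ m)"
proof -
  obtain D where D: "\<And>t. cmod (fourier f t) * (1 + \<bar>t\<bar>) ^ m \<le> D / (1 + \<bar>t\<bar>)\<^sup>2"
    using fourier_weighted_decay[OF f] by blast
  have "(\<lambda>t. cmod (fourier f t) * (1 + \<bar>t\<bar>) ^ m) \<in> borel_measurable lborel"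
    using borel_measurable_continuous_onI[OF continuous_fourier[OF f]] by simp
  then show ?thesis
    by (rule Bochner_Integration.integrable_bound
        [OF integrable_mult_right[OF integrable_inverse_one_plus_abs_square, of D]])
       (use order_trans[OF D abs_ge_self] in \<open>simp add: abs_mult\<close>)
qed

lemma fourier_integrable_lborel:
  assumes f: "test_function f"
  shows "integrable lborel (fourier f)"
  using fourier_weighted_integrable[OF f, of 0] borel_measurable_continuous_onI[OF continuous_fourier[OF f]]
  by (simp add: integrable_norm_iff)

lemma fourier_std_normal_density:
  "(LINT u|lborel. std_normal_density u *\<^sub>R iexp (y * u)) = complex_of_real (exp (- y\<^sup>2 / 2))"
proof -
  have "(LINT u|lborel. std_normal_density u *\<^sub>R iexp (y * u)) = char std_normal_distribution y"
    unfolding char_def by (subst integral_density) (auto simp: normal_density_nonneg)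
  then show ?thesis by (simp add: char_std_normal_distribution)
qed

lemma gaussian_fourier:
  assumes \<sigma>: "\<sigma> > 0"
  shows "(LINT t|lborel. exp (- (\<sigma> * t)\<^sup>2 / 2) *\<^sub>R iexp (t * y))
     = complex_of_real (2 * pi / \<sigma> * std_normal_density (y / \<sigma>))"
proof -
  define c where "c = sqrt (2 * pi)"
  have c: "c > 0" "c * c = 2 * pi" by (simp_all add: c_def)
  have sd: "exp (- x\<^sup>2 / 2) = c * std_normal_density x" for x
    using c(1) by (simp add: std_normal_density_def c_def)
  have "(LINT t|lborel. exp (- (\<sigma> * t)\<^sup>2 / 2) *\<^sub>R iexp (t * y))
     = \<bar>1 / \<sigma>\<bar> *\<^sub>R (LINT u|lborel. exp (- (\<sigma> * (0 + 1 / \<sigma> * u))\<^sup>2 / 2) *\<^sub>R iexp ((0 + 1 / \<sigma> * u) * y))"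
    by (rule lborel_integral_real_affine) (use \<sigma> in simp)
  also have "\<dots> = (1 / \<sigma>) *\<^sub>R (LINT u|lborel. c *\<^sub>R (std_normal_density u *\<^sub>R iexp (y / \<sigma> * u)))"
  proof -
    have "(\<sigma> * (0 + 1 / \<sigma> * u)) = u" "(0 + 1 / \<sigma> * u) * y = y / \<sigma> * u" for u
      using \<sigma> by simp_all
    then show ?thesis using \<sigma> by (simp only: sd scaleR_scaleR) simp
  qed
  also have "\<dots> = (1 / \<sigma>) *\<^sub>R (c *\<^sub>R complex_of_real (exp (- (y / \<sigma>)\<^sup>2 / 2)))"
    by (simp only: integral_scaleR_right fourier_std_normal_density)
  also have "\<dots> = complex_of_real ((1 / \<sigma>) * (c * (c * std_normal_density (y / \<sigma>))))"
    by (simp only: sd scaleR_conv_of_real of_real_mult)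
  also have "(1 / \<sigma>) * (c * (c * std_normal_density (y / \<sigma>))) = 2 * pi / \<sigma> * std_normal_density (y / \<sigma>)"
    using c(2) by (metis mult.assoc mult.commute times_divide_eq_left mult_1_left)
  finally show ?thesis .
qed

text \<open>Insert the factor \<open>exp (- (\<sigma> t)\<^sup>2 / 2)\<close>, exchange the integrals, and let \<open>\<sigma>\<close> tend to \<open>0\<close>: the left side
  tends to the inverse transform, the right side is an average of \<open>f\<close> over a Gaussian of variance
  \<open>\<sigma>\<^sup>2\<close> around \<open>x\<close>.\<close>

lemma fourier_regularized:
  fixes f :: "real \<Rightarrow> complex"
  assumes f: "test_function f" and \<sigma>: "\<sigma> > 0"
  shows "(LINT t|lborel. fourier f t * iexp (t * x) * complex_of_real (exp (- (\<sigma> * t)\<^sup>2 / 2)))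
     = 2 * pi * (LINT v|lborel. std_normal_density v *\<^sub>R f (x + \<sigma> * v))"
proof -
  define G where "G t = exp (- (\<sigma> * t)\<^sup>2 / 2)" for t :: real
  define k where "k s t = f s * (G t *\<^sub>R iexp (t * (x - s)))" for s t
  have fm [measurable]: "f \<in> borel_measurable borel"
    by (rule test_function_measurable[OF f])
  have Gm [measurable]: "G \<in> borel_measurable borel" unfolding G_def by measurable
  have iG: "integrable lborel G"
  proof -
    have "integrable lborel (\<lambda>t. std_normal_density (0 + \<sigma> * t))"
      using \<sigma> by (intro lborel_integrable_real_affine) auto
    then have "integrable lborel (\<lambda>t. sqrt (2 * pi) * std_normal_density (0 + \<sigma> * t))" by simp
    then show ?thesis by (simp add: std_normal_density_def G_def [abs_def])
  qed
  have nk: "cmod (k s t) = cmod (f s) * G t" for s t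
    by (simp add: k_def norm_mult G_def del: of_real_mult of_real_diff)
  have ik: "integrable (lborel \<Otimes>\<^sub>M lborel) (case_prod k)"
  proof (rule lborel_pair.Fubini_integrable)
    show "case_prod k \<in> borel_measurable (lborel \<Otimes>\<^sub>M lborel)" unfolding k_def by measurable
    show "integrable lborel (\<lambda>s. LINT t|lborel. cmod (case (s, t) of (s, t) \<Rightarrow> k s t))"
      using integrable_norm[OF test_function_integrable[OF f]] by (simp add: nk)
    have "integrable lborel (k s)" for s
    proof (rule Bochner_Integration.integrable_bound[of _ "\<lambda>t. cmod (f s) * G t"])
      show "k s \<in> borel_measurable lborel" unfolding k_def [abs_def] by measurable
      show "integrable lborel (\<lambda>t. cmod (f s) * G t)" using iG by simp
      show "AE t in lborel. norm (k s t) \<le> norm (cmod (f s) * G t)" by (simp add: nk G_def)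
    qed
    then show "AE s in lborel. integrable lborel (\<lambda>t. case (s, t) of (s, t) \<Rightarrow> k s t)" by simp
  qed
  have "(LINT t|lborel. fourier f t * iexp (t * x) * complex_of_real (G t))
      = (LINT t|lborel. LINT s|lborel. k s t)"
  proof (rule Bochner_Integration.integral_cong[OF refl])
    fix t
    have "k s t = f s * iexp (- (t * s)) * (iexp (t * x) * complex_of_real (G t))" for s
      by (simp add: k_def scaleR_conv_of_real algebra_simps exp_diff exp_minus divide_inverse)
    then have "(LINT s|lborel. k s t) =
        (LINT s|lborel. f s * iexp (- (t * s))) * (iexp (t * x) * complex_of_real (G t))"
      by (simp only: integral_mult_left_zero)
    then show "fourier f t * iexp (t * x) * complex_of_real (G t) = (LINT s|lborel. k s t)"
      by (simp only: fourier_alt mult.assoc)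
  qed
  also have "\<dots> = (LINT s|lborel. LINT t|lborel. k s t)"
    by (rule lborel_pair.Fubini_integral[OF ik])
  also have "\<dots> = (LINT s|lborel. f s * complex_of_real (2 * pi / \<sigma> * std_normal_density ((x - s) / \<sigma>)))"
    unfolding k_def G_def by (simp only: integral_mult_right_zero gaussian_fourier[OF \<sigma>])
  also have "\<dots> = \<bar>\<sigma>\<bar> *\<^sub>R (LINT v|lborel. f (x + \<sigma> * v) * complex_of_real (2 * pi / \<sigma> * std_normal_density ((x - (x + \<sigma> * v)) / \<sigma>)))"
    by (rule lborel_integral_real_affine) (use \<sigma> in simp)
  also have "\<dots> = (LINT v|lborel. 2 * pi * (std_normal_density v *\<^sub>R f (x + \<sigma> * v)))"
    unfolding integral_scaleR_right[symmetric]
    by (rule Bochner_Integration.integral_cong[OF refl])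
       (use \<sigma> in \<open>simp add: std_normal_density_def scaleR_conv_of_real\<close>)
  finally show ?thesis by (simp only: G_def integral_mult_right_zero)
qed

theorem fourier_inversion:
  fixes f :: "real \<Rightarrow> complex"
  assumes f: "test_function f"
  shows "(LINT t|lborel. fourier f t * iexp (t * x)) = 2 * pi * f x"
proof (rule LIMSEQ_unique)
  have fm [measurable]: "f \<in> borel_measurable borel"
    by (rule test_function_measurable[OF f])
  have fhm [measurable]: "fourier f \<in> borel_measurable borel"
    by (rule borel_measurable_continuous_onI[OF continuous_fourier[OF f]])
  define \<sigma> where "\<sigma> n = 1 / real (Suc n)" for n
  have \<sigma>: "\<sigma> n > 0" "\<sigma> \<longlonglongrightarrow> 0" for n
    using LIMSEQ_Suc[OF lim_1_over_n] by (simp_all add: \<sigma>_def [abs_def])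
  let ?J = "\<lambda>n. LINT t|lborel. fourier f t * iexp (t * x) * complex_of_real (exp (- (\<sigma> n * t)\<^sup>2 / 2))"
  show "?J \<longlonglongrightarrow> (LINT t|lborel. fourier f t * iexp (t * x))"
  proof (rule integral_dominated_convergence[where w = "\<lambda>t. cmod (fourier f t)"])
    show "integrable lborel (\<lambda>t. cmod (fourier f t))" using fourier_integrable_lborel[OF f] by simp
    show "AE t in lborel. (\<lambda>n. fourier f t * iexp (t * x) * complex_of_real (exp (- (\<sigma> n * t)\<^sup>2 / 2)))
       \<longlonglongrightarrow> fourier f t * iexp (t * x)"
    proof (rule AE_I2)
      fix t
      have "(\<lambda>n. fourier f t * iexp (t * x) * complex_of_real (exp (- (\<sigma> n * t)\<^sup>2 / 2)))
       \<longlonglongrightarrow> fourier f t * iexp (t * x) * complex_of_real (exp (- (0 * t)\<^sup>2 / 2))"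
        by (intro tendsto_intros \<sigma>) simp
      then show "(\<lambda>n. fourier f t * iexp (t * x) * complex_of_real (exp (- (\<sigma> n * t)\<^sup>2 / 2)))
       \<longlonglongrightarrow> fourier f t * iexp (t * x)" by simp
    qed
    show "AE t in lborel. cmod (fourier f t * iexp (t * x) * complex_of_real (exp (- (\<sigma> n * t)\<^sup>2 / 2)))
      \<le> cmod (fourier f t)" for n
      by (intro AE_I2) (simp add: norm_mult mult_left_le del: of_real_mult)
  qed measurable
  obtain R where R: "\<And>x. \<bar>x\<bar> \<ge> R \<Longrightarrow> f x = 0" using test_function_support[OF f] by blast
  have "compact (f ` {-R..R})"
    by (intro compact_continuous_image test_function_continuous[OF f]) simp
  then obtain B where B: "\<And>y. y \<in> {-R..R} \<Longrightarrow> cmod (f y) \<le> B"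
    using compact_imp_bounded by (fastforce simp: bounded_iff)
  have bd: "cmod (f y) \<le> max B 0" for y
  proof (cases "\<bar>y\<bar> \<ge> R")
    case False
    then have "y \<in> {-R..R}" by auto
    from B[OF this] show ?thesis by simp
  qed (simp add: R)
  have "(\<lambda>n. LINT v|lborel. std_normal_density v *\<^sub>R f (x + \<sigma> n * v)) \<longlonglongrightarrow>
      (LINT v|lborel. std_normal_density v *\<^sub>R f x)"
  proof (rule integral_dominated_convergence[where w = "\<lambda>v. std_normal_density v * max B 0"])
    show "integrable lborel (\<lambda>v. std_normal_density v * max B 0)" by simp
    show "AE v in lborel. (\<lambda>n. std_normal_density v *\<^sub>R f (x + \<sigma> n * v)) \<longlonglongrightarrow> std_normal_density v *\<^sub>R f x"
    proof (rule AE_I2)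
      fix v
      have "isCont f x" using test_function_continuous[OF f, of UNIV] by (simp add: continuous_on_eq_continuous_at)
      moreover have "(\<lambda>n. x + \<sigma> n * v) \<longlonglongrightarrow> x + 0 * v" by (intro tendsto_intros \<sigma>)
      ultimately have "(\<lambda>n. f (x + \<sigma> n * v)) \<longlonglongrightarrow> f x" by (intro isCont_tendsto_compose[of x f]) simp_all
      then show "(\<lambda>n. std_normal_density v *\<^sub>R f (x + \<sigma> n * v)) \<longlonglongrightarrow> std_normal_density v *\<^sub>R f x"
        by (intro tendsto_intros)
    qed
    show "AE v in lborel. norm (std_normal_density v *\<^sub>R f (x + \<sigma> n * v)) \<le> std_normal_density v * max B 0" for n
      by (intro AE_I2) (simp add: normal_density_nonneg mult_left_mono bd)
  qed measurable
  moreover have "(LINT v|lborel. std_normal_density v *\<^sub>R f x) = f x"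
    by simp
  ultimately have "(\<lambda>n. 2 * pi * (LINT v|lborel. std_normal_density v *\<^sub>R f (x + \<sigma> n * v))) \<longlonglongrightarrow> 2 * pi * f x"
    by (intro tendsto_mult tendsto_const) simp
  then show "?J \<longlonglongrightarrow> 2 * pi * f x"
    by (simp only: fourier_regularized[OF f \<sigma>(1)])
qed


section \<open>Filtrations with rapid decay\<close>

locale rapid_decay_filtration = faithful_gns \<rho> hat
  for \<rho> :: "'a::cstar_algebra \<Rightarrow> complex" and hat :: "'a \<Rightarrow> 'h::complex_hilbert_space" +
  fixes L :: "nat \<Rightarrow> 'a set" and C \<alpha> :: real
  assumes filtration: "filtration L" and rd: "rapid_decay_constants hat L C \<alpha>"
begin

definition level :: "nat \<Rightarrow> 'a set" where "level k = closure (L k)"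

lemma C_pos: "C > 0" and \<alpha>_pos: "\<alpha> > 0"
  using rd by (auto simp: rapid_decay_constants_def)

lemma level_subspace: "module.subspace (*\<^sub>C) (level k)"
  using filtration unfolding level_def filtration_def by (intro csubspace_closure) blast

lemma level_mono: "j \<le> k \<Longrightarrow> level j \<subseteq> level k"
  using filtration unfolding level_def filtration_def by (intro closure_mono) (auto dest: monoD)

lemma level_seq: "x \<in> level k \<longleftrightarrow> (\<exists>f. (\<forall>n. f n \<in> L k) \<and> f \<longlonglongrightarrow> x)"
  by (simp add: level_def closure_sequential)

lemma level_star: "a \<in> level k \<Longrightarrow> star a \<in> level k"
proof -
  assume "a \<in> level k"
  then obtain f where f: "\<forall>n. f n \<in> L k" "f \<longlonglongrightarrow> a" unfolding level_seq by blast
  then have "(\<lambda>n. star (f n)) \<longlonglongrightarrow> star a"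
    using bounded_linear.tendsto[OF bounded_linear_star] by blast
  moreover have "\<forall>n. star (f n) \<in> L k" using f(1) filtration unfolding filtration_def by blast
  ultimately show ?thesis unfolding level_seq by (intro exI[of _ "\<lambda>n. star (f n)"]) simp
qed

lemma level_mult:
  assumes "a \<in> level j" "b \<in> level k"
  shows "a * b \<in> level (j + k)"
proof -
  obtain f g where "\<And>n. f n \<in> L j" "f \<longlonglongrightarrow> a" "\<And>n. g n \<in> L k" "g \<longlonglongrightarrow> b"
    using assms unfolding level_seq by blast
  then show ?thesis
    using filtration unfolding level_seq filtration_def
    by (intro exI[of _ "\<lambda>n. f n * g n"]) (auto intro: tendsto_mult)
qed

lemma one_in_level: "1 \<in> level k"
proof -
  have "1 *\<^sub>C 1 \<in> L 0" using filtration unfolding filtration_def by blast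
  then have "1 \<in> level 0" using closure_subset by (auto simp: level_def scaleC_one)
  then show ?thesis using level_mono[of 0 k] by auto
qed

lemma norm_le_on_level:
  assumes "b \<in> level m"
  shows "norm b \<le> C * (real m + 1) powr \<alpha> * norm2 b"
proof -
  obtain f where f: "\<And>n. f n \<in> L m" "f \<longlonglongrightarrow> b" using assms unfolding level_seq by blast
  have "(\<lambda>n. C * (real m + 1) powr \<alpha> * norm2 (f n)) \<longlonglongrightarrow> C * (real m + 1) powr \<alpha> * norm2 b"
    by (intro tendsto_intros tendsto_hat f)
  with tendsto_norm[OF f(2)] show ?thesis
    by (rule LIMSEQ_le) (use f(1) rd in \<open>auto simp: rapid_decay_constants_def\<close>)
qed

text \<open>On a fixed level the norms \<open>\<parallel>\<cdot>\<parallel>\<close> and \<open>\<parallel>\<cdot>\<parallel>\<^sub>2\<close> are equivalent, so the closures in \<open>L\<^sup>2\<close> consist of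
  elements of the algebra, and all arguments below take place inside the algebra.\<close>

lemma closure_hat_level: "closure (hat ` L k) = hat ` level k"
proof (intro subset_antisym subsetI)
  fix \<xi> assume "\<xi> \<in> hat ` level k"
  then obtain b where b: "b \<in> level k" "\<xi> = hat b" by blast
  then obtain f where "\<forall>n. f n \<in> L k" "f \<longlonglongrightarrow> b" unfolding level_seq by blast
  then show "\<xi> \<in> closure (hat ` L k)" unfolding closure_sequential
    using tendsto_hat b(2) by (intro exI[of _ "\<lambda>n. hat (f n)"]) auto
next
  fix \<xi> assume "\<xi> \<in> closure (hat ` L k)"
  then obtain h where h: "\<And>n. h n \<in> hat ` L k" "h \<longlonglongrightarrow> \<xi>" unfolding closure_sequential by blast
  from h(1) have "\<exists>f. \<forall>n. f n \<in> L k \<and> h n = hat (f n)" by (intro choice) blast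
  then obtain f where f: "\<And>n. f n \<in> L k" "\<And>n. h n = hat (f n)" by blast
  define B where "B = C * (real k + 1) powr \<alpha>"
  have B: "B > 0" using C_pos by (simp add: B_def)
  have "Cauchy f"
  proof (rule Cauchy_if_le_null)
    have "(\<lambda>n. B * norm (h n - \<xi>)) \<longlonglongrightarrow> B * norm (\<xi> - \<xi>)" by (intro tendsto_intros h)
    then show "(\<lambda>n. B * norm (h n - \<xi>)) \<longlonglongrightarrow> 0" by simp
    fix m n
    have "module.subspace (*\<^sub>C) (L k)" using filtration by (simp add: filtration_def)
    then have "f m - f n \<in> L k" by (rule csubspace_diff) (rule f(1))+
    then have "norm (f m - f n) \<le> B * norm (h m - h n)"
      using rd unfolding rapid_decay_constants_def B_def by (simp add: f(2) hat_diff[symmetric])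
    also have "\<dots> \<le> B * (norm (h m - \<xi>) + norm (h n - \<xi>))"
      using B norm_triangle_ineq4[of "h m - \<xi>" "h n - \<xi>"] by (intro mult_left_mono) auto
    finally show "norm (f m - f n) \<le> B * norm (h m - \<xi>) + B * norm (h n - \<xi>)"
      by (simp add: distrib_left)
  qed
  then obtain b where b: "f \<longlonglongrightarrow> b" using Cauchy_convergent convergent_def by blast
  moreover have "h = (\<lambda>n. hat (f n))" using f(2) by auto
  ultimately have "h \<longlonglongrightarrow> hat b" using tendsto_hat[OF b] by simp
  with h(2) have "\<xi> = hat b" by (rule LIMSEQ_unique)
  moreover have "b \<in> level k" using b f(1) unfolding level_seq by blast
  ultimately show "\<xi> \<in> hat ` level k" by blast
qed

text \<open>The orthogonal projections onto the closed levels, regarded as maps of the algebra into itself.\<close>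

definition proj :: "nat \<Rightarrow> 'a \<Rightarrow> 'a" where
  "proj k a = (THE b. hat b = filtration_proj hat L k (hat a))"

lemma hat_level_subspace: "module.subspace (*\<^sub>C) (closure (hat ` L k))"
proof (rule csubspace_closure)
  have "module.subspace (*\<^sub>C) (L k)" using filtration unfolding filtration_def by blast
  then show "module.subspace (*\<^sub>C) (hat ` L k)"
    unfolding csubspace_iff
    by (safe; (simp only: hat_add[symmetric] hat_scaleC[symmetric] hat_zero[symmetric])?)
       (blast intro: imageI)+
qed

lemma hat_proj: "hat (proj k a) = filtration_proj hat L k (hat a)"
  and proj_in_level: "proj k a \<in> level k"
proof -
  have "filtration_proj hat L k (hat a) \<in> hat ` level k"
    unfolding filtration_proj_def closure_hat_level[symmetric]
    by (rule orthogonal_projection(1)[OF hat_level_subspace closed_closure])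
  then obtain b where b: "b \<in> level k" "filtration_proj hat L k (hat a) = hat b" by blast
  then have "proj k a = b" unfolding proj_def by (simp add: hat_inject)
  with b show "hat (proj k a) = filtration_proj hat L k (hat a)" "proj k a \<in> level k" by auto
qed

lemma proj_orthogonal: "z \<in> level k \<Longrightarrow> cinner (hat z) (hat (a - proj k a)) = 0"
  unfolding hat_diff hat_proj filtration_proj_def
  by (rule orthogonal_projection(2)[OF hat_level_subspace closed_closure]) (simp add: closure_hat_level)

lemma proj_eqI:
  assumes "b \<in> level k" "\<And>z. z \<in> level k \<Longrightarrow> cinner (hat z) (hat (a - b)) = 0"
  shows "proj k a = b"
proof -
  have "hat (proj k a) = hat b"
    unfolding hat_proj filtration_proj_def
    by (rule orthogonal_projection_eqI[OF hat_level_subspace])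
       (use assms in \<open>auto simp: closure_hat_level hat_diff\<close>)
  then show ?thesis by (simp add: hat_inject)
qed

lemma level_add: "x \<in> level k \<Longrightarrow> y \<in> level k \<Longrightarrow> x + y \<in> level k"
  and level_scaleC: "x \<in> level k \<Longrightarrow> c *\<^sub>C x \<in> level k"
  and level_zero: "0 \<in> level k"
  and level_diff: "x \<in> level k \<Longrightarrow> y \<in> level k \<Longrightarrow> x - y \<in> level k"
  using level_subspace[of k] csubspace_diff[OF level_subspace] by (auto simp: csubspace_iff)

lemma proj_add: "proj k (x + y) = proj k x + proj k y"
proof (rule proj_eqI)
  fix z assume z: "z \<in> level k"
  have "x + y - (proj k x + proj k y) = (x - proj k x) + (y - proj k y)" by simp
  then show "cinner (hat z) (hat (x + y - (proj k x + proj k y))) = 0"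
    using proj_orthogonal[OF z] by (simp only: hat_add cinner_add_right) simp
qed (intro level_add proj_in_level)

lemma proj_scaleC: "proj k (c *\<^sub>C x) = c *\<^sub>C proj k x"
proof (rule proj_eqI)
  fix z assume z: "z \<in> level k"
  show "cinner (hat z) (hat (c *\<^sub>C x - c *\<^sub>C proj k x)) = 0"
    using proj_orthogonal[OF z] by (simp add: scaleC_diff_right[symmetric] hat_scaleC cinner_scaleC_right)
qed (intro level_scaleC proj_in_level)

lemma proj_diff: "proj k (x - y) = proj k x - proj k y"
  using proj_add[of k "x - y" y] by simp

lemma proj_id: "a \<in> level k \<Longrightarrow> proj k a = a"
  by (rule proj_eqI) auto

lemma proj_zero [simp]: "proj k 0 = 0"
  by (rule proj_id[OF level_zero])

lemma proj_sum: "proj k (\<Sum>i\<in>S. f i) = (\<Sum>i\<in>S. proj k (f i))"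
  by (induction S rule: infinite_finite_induct) (auto simp: proj_add)

lemma proj_proj: "proj i (proj j a) = proj (min i j) a"
proof (cases "i \<le> j")
  case True
  have "proj i (proj j a) = proj i a"
  proof (rule proj_eqI[OF proj_in_level])
    fix z assume z: "z \<in> level i"
    then have "z \<in> level j" using level_mono[OF True] by blast
    then have "cinner (hat z) (hat ((a - proj i a) - (a - proj j a))) = 0"
      using z by (simp only: hat_diff[of "a - proj i a"] cinner_diff_right proj_orthogonal) simp
    then show "cinner (hat z) (hat (proj j a - proj i a)) = 0" by simp
  qed
  then show ?thesis using True by (simp add: min_def)
next
  case False
  then have "proj j a \<in> level i" using level_mono[of j i] proj_in_level by auto
  with False show ?thesis by (simp add: proj_id min_def)
qed

lemma cinner_proj: "cinner (hat x) (hat (proj k y)) = cinner (hat (proj k x)) (hat y)"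
proof -
  have 1: "cinner (hat (proj k x)) (hat (y - proj k y)) = 0"
    by (rule proj_orthogonal[OF proj_in_level])
  have "cinner (hat (proj k y)) (hat (x - proj k x)) = 0"
    by (rule proj_orthogonal[OF proj_in_level])
  then have 2: "cinner (hat (x - proj k x)) (hat (proj k y)) = 0"
    by (metis cinner_commute complex_cnj_zero)
  show ?thesis using 1 2 by (simp add: hat_diff cinner_diff_left cinner_diff_right)
qed

lemma norm2_orthogonal:
  assumes "b \<in> level k"
  shows "(norm2 (a - b))\<^sup>2 = (norm2 (a - proj k a))\<^sup>2 + (norm2 (proj k a - b))\<^sup>2"
proof -
  have "cinner (hat (proj k a - b)) (hat (a - proj k a)) = 0"
    by (rule proj_orthogonal) (intro level_diff proj_in_level assms)
  then have "cinner (hat (a - proj k a)) (hat (proj k a - b)) = 0"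
    by (metis cinner_commute complex_cnj_zero)
  then show ?thesis
    using norm_add_square[of "hat (a - proj k a)" "hat (proj k a - b)"]
    by (simp add: hat_add[symmetric])
qed

lemma norm2_proj_pythagoras:
  "(norm2 a)\<^sup>2 = (norm2 (a - proj k a))\<^sup>2 + (norm2 (proj k a))\<^sup>2"
  using norm2_orthogonal[OF level_zero, of a k] by simp

lemma norm2_proj_le: "norm2 (proj k a) \<le> norm2 a"
  by (rule power2_le_imp_le) (simp_all add: norm2_proj_pythagoras[of a k])

lemma norm2_proj_diff:
  "j \<le> k \<Longrightarrow> (norm2 (proj k a - proj j a))\<^sup>2 = (norm2 (proj k a))\<^sup>2 - (norm2 (proj j a))\<^sup>2"
  using norm2_proj_pythagoras[of "proj k a" j] by (simp add: proj_proj min_def)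

lemma norm2_minus_proj_le: "b \<in> level k \<Longrightarrow> norm2 (a - proj k a) \<le> norm2 (a - b)"
  by (rule power2_le_imp_le) (simp_all add: norm2_orthogonal[of b k a])

text \<open>Bounded for the C*-norm, by rapid decay. Hence the weights below are bounded on the algebra and can be
  applied to differentiable curves in it.\<close>

lemma bounded_linear_proj: "bounded_linear (proj k)"
proof (rule bounded_linear_intro)
  fix x
  have "norm (proj k x) \<le> C * (real k + 1) powr \<alpha> * norm2 (proj k x)"
    by (rule norm_le_on_level[OF proj_in_level])
  also have "\<dots> \<le> C * (real k + 1) powr \<alpha> * norm x"
    using C_pos order_trans[OF norm2_proj_le norm2_le] by (intro mult_left_mono) auto
  finally show "norm (proj k x) \<le> norm x * (C * (real k + 1) powr \<alpha>)" by (simp add: mult.commute)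
qed (simp_all add: proj_add proj_scaleC scaleR_scaleC)

lemma hat_proj_tendsto: "(\<lambda>k. hat (proj k a)) \<longlonglongrightarrow> hat a"
proof (rule metric_LIMSEQ_I)
  fix e :: real assume e: "e > 0"
  have "a \<in> closure (\<Union>k. L k)" using filtration by (simp add: filtration_def)
  then obtain b k where b: "b \<in> L k" "dist b a < e"
    using e unfolding closure_approachable by blast
  have "dist (hat (proj m a)) (hat a) < e" if "k \<le> m" for m
  proof -
    have "b \<in> level m" using b(1) closure_subset level_mono[OF that] unfolding level_def by blast
    then have "norm2 (a - proj m a) \<le> norm2 (a - b)" by (rule norm2_minus_proj_le)
    also have "\<dots> \<le> norm (a - b)" by (rule norm2_le)
    also have "\<dots> < e" using b(2) by (simp add: dist_norm norm_minus_commute)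
    finally show ?thesis by (simp add: dist_norm hat_diff norm_minus_commute)
  qed
  then show "\<exists>k. \<forall>m\<ge>k. dist (hat (proj m a)) (hat a) < e" by blast
qed


section \<open>Commutators with the truncated number operator\<close>

text \<open>Operators that move the filtration degree by at most \<open>k\<close> in either direction. The second of the two
  degree conditions says that the adjoint also raises degrees by at most \<open>k\<close>.\<close>

definition band :: "nat \<Rightarrow> ('a \<Rightarrow> 'a) \<Rightarrow> real \<Rightarrow> bool" where
  "band k T c \<longleftrightarrow> (\<forall>x y. T (x + y) = T x + T y) \<and>
     (\<forall>j x. proj (j + k) (T (proj j x)) = T (proj j x)) \<and>
     (\<forall>j x. proj j (T (proj (j + k) x)) = proj j (T x)) \<and>
     (\<forall>x. norm2 (T x) \<le> c * norm2 x)"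

lemma band_mult:
  assumes a: "a \<in> level k"
  shows "band k ((*) a) (norm a)"
  unfolding band_def
proof (intro conjI allI)
  fix j x
  have "a * proj j x \<in> level (k + j)" by (rule level_mult[OF a proj_in_level])
  then show "proj (j + k) (a * proj j x) = a * proj j x" by (simp add: proj_id add.commute)
  have "proj j (a * (x - proj (j + k) x)) = 0"
  proof (rule proj_eqI[OF level_zero])
    fix z assume "z \<in> level j"
    then have "star a * z \<in> level (j + k)"
      using level_mult[OF level_star[OF a]] by (simp add: add.commute)
    from proj_orthogonal[OF this] show "cinner (hat z) (hat (a * (x - proj (j + k) x) - 0)) = 0"
      by (simp add: cinner_hat_mult)
  qed
  then show "proj j (a * proj (j + k) x) = proj j (a * x)"
    by (simp add: right_diff_distrib proj_diff)
qed (simp_all add: distrib_left norm2_mult_le)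

text \<open>The number operator multiplies the component of degree \<open>k\<close> by \<open>k\<close>; this is its
  truncation, which multiplies that component by \<open>min k N\<close>.\<close>

definition num :: "nat \<Rightarrow> 'a \<Rightarrow> 'a" where
  "num N x = (\<Sum>j<N. x - proj j x)"

lemma num_add: "num N (x + y) = num N x + num N y"
  by (simp add: num_def proj_add sum.distrib[symmetric] algebra_simps)

lemma proj_num: "proj i (num N x) = num N (proj i x)"
  by (simp add: num_def proj_sum proj_diff proj_proj min.commute)

lemma additive_zero: "(\<And>x y. T (x + y) = T x + T y) \<Longrightarrow> T (0::'a) = (0::'a)"
  by (metis add_cancel_left_left add_0)

lemma additive_diff: "(\<And>x y. T (x + y) = T x + T y) \<Longrightarrow> T (x - y :: 'a) = T x - (T y :: 'a)"
  by (metis add_diff_cancel diff_add_cancel)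

lemma additive_sum:
  assumes "\<And>x y. T (x + y) = T x + T y"
  shows "T (\<Sum>i\<in>S. f i :: 'a) = (\<Sum>i\<in>S. T (f i) :: 'a)"
  by (induction S rule: infinite_finite_induct) (auto simp: assms additive_zero[of T, OF assms])

text \<open>Telescoping in \<open>k\<close> instead of \<open>j\<close> makes the bounds in this and the next lemma independent of the number
  of summands.\<close>

lemma telescope_shift_le:
  fixes g :: "nat \<Rightarrow> real"
  assumes "\<And>j. 0 \<le> g j" "\<And>j. g j \<le> G"
  shows "(\<Sum>j<N. g (j + k) - g j) \<le> real k * G"
proof (induction k)
  case (Suc k)
  have "(\<Sum>j<N. g (j + Suc k) - g j) = (\<Sum>j<N. g (j + k) - g j) + (\<Sum>j<N. g (Suc j + k) - g (j + k))"
    by (simp add: sum.distrib[symmetric])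
  also have "(\<Sum>j<N. g (Suc j + k) - g (j + k)) = g (N + k) - g (0 + k)"
    by (rule sum_lessThan_telescope)
  finally show ?case using Suc assms(2)[of "N + k"] assms(1)[of "0 + k"] by (simp add: algebra_simps)
qed simp

lemma telescope_shift_back_le:
  fixes g :: "nat \<Rightarrow> real"
  assumes "\<And>j. 0 \<le> g j" "\<And>j. g j \<le> G"
  shows "(\<Sum>j<N. g j - (if k \<le> j then g (j - k) else 0)) \<le> real k * G"
proof (induction k)
  case (Suc k)
  define e where "e k j = (if k \<le> j then g (j - k) else 0)" for k j
  have e: "e k j = e (Suc k) (Suc j)" for j by (simp add: e_def)
  have "(\<Sum>j<N. g j - e (Suc k) j) = (\<Sum>j<N. g j - e k j) + (\<Sum>j<N. e (Suc k) (Suc j) - e (Suc k) j)"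
    by (simp add: sum.distrib[symmetric] e)
  also have "(\<Sum>j<N. e (Suc k) (Suc j) - e (Suc k) j) = e (Suc k) N - e (Suc k) 0"
    by (rule sum_lessThan_telescope)
  also have "\<dots> \<le> G" using assms(2)[of "N - Suc k"] order_trans[OF assms(1)[of 0] assms(2)[of 0]]
    by (auto simp: e_def)
  finally show ?case using Suc by (simp add: e_def algebra_simps)
qed simp

text \<open>Write \<open>q\<^sub>j\<close> for the projections. The commutator is the sum over \<open>j < N\<close> of
  \<open>T q\<^sub>j - q\<^sub>j T = F\<^sub>j T E\<^sub>j - E\<^sub>j T F\<^sub>j\<close> with \<open>E\<^sub>j = q\<^sub>j - q\<^bsub>j - k\<^esub>\<close> and \<open>F\<^sub>j = q\<^bsub>j + k\<^esub> - q\<^sub>j\<close>. Each degree occurs in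
  at most \<open>k\<close> of the \<open>E\<^sub>j\<close> and in at most \<open>k\<close> of the \<open>F\<^sub>j\<close>, so by the Cauchy-Schwarz inequality the sum has
  norm at most \<open>2 k \<parallel>T\<parallel>\<close>, whatever the number of summands.\<close>

lemma num_commutator_le:
  assumes T: "band k T c" and c: "c \<ge> 0"
  shows "norm2 (num N (T x) - T (num N x)) \<le> 2 * real k * c * norm2 x"
proof -
  have add: "T (x + y) = T x + T y" and up: "proj (j + k) (T (proj j x)) = T (proj j x)"
    and down: "proj j (T (proj (j + k) x)) = proj j (T x)" and bd: "norm2 (T x) \<le> c * norm2 x"
    for x y j using T by (auto simp: band_def)
  note Tdiff = additive_diff[of T, OF add]
  define E where "E j z = proj j z - (if k \<le> j then proj (j - k) z else 0)" for j z
  define F where "F j z = proj (j + k) z - proj j z" for j z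
  have EF: "T (proj j x) - proj j (T x) = F j (T (E j x)) - E j (T (F j x))" for j x
  proof (cases "k \<le> j")
    case True
    have a: "proj j (T (proj (j - k) x)) = T (proj (j - k) x)" using up[of "j - k" x] True by simp
    have b: "proj (j + k) (T (proj (j - k) x)) = T (proj (j - k) x)"
      using a proj_proj[of "j + k" j "T (proj (j - k) x)"] by (simp add: min_absorb2)
    have d: "proj (j - k) (T (proj j z)) = proj (j - k) (T z)" for z
      using down[of "j - k" z] True by simp
    have e: "proj (j - k) (T (proj (j + k) x)) = proj (j - k) (T (proj j x))"
      using d[of "proj (j + k) x"] by (simp add: proj_proj min_absorb1)
    show ?thesis using True
      by (simp add: E_def F_def Tdiff proj_diff up down a b e)
  next
    case False
    then show ?thesis by (simp add: E_def F_def Tdiff proj_diff up down)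
  qed
  have adjE: "cinner (hat y) (hat (E j z)) = cinner (hat (E j y)) (hat z)"
    and adjF: "cinner (hat y) (hat (F j z)) = cinner (hat (F j y)) (hat z)" for j y z
    by (simp_all add: E_def F_def hat_diff cinner_diff_left cinner_diff_right cinner_proj)
  have sumE: "(\<Sum>j<N. (norm2 (E j z))\<^sup>2) \<le> real k * (norm2 z)\<^sup>2"
    and sumF: "(\<Sum>j<N. (norm2 (F j z))\<^sup>2) \<le> real k * (norm2 z)\<^sup>2" for z
  proof -
    define g where "g j = (norm2 (proj j z))\<^sup>2" for j
    have g: "0 \<le> g j" "g j \<le> (norm2 z)\<^sup>2" for j
      by (simp_all add: g_def norm2_proj_le power_mono)
    have "(norm2 (E j z))\<^sup>2 = g j - (if k \<le> j then g (j - k) else 0)" for j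
      by (simp add: E_def g_def norm2_proj_diff)
    then show "(\<Sum>j<N. (norm2 (E j z))\<^sup>2) \<le> real k * (norm2 z)\<^sup>2"
      using telescope_shift_back_le[of g, OF g] by simp
    have "(norm2 (F j z))\<^sup>2 = g (j + k) - g j" for j
      by (simp add: F_def g_def norm2_proj_diff)
    then show "(\<Sum>j<N. (norm2 (F j z))\<^sup>2) \<le> real k * (norm2 z)\<^sup>2"
      using telescope_shift_le[of g, OF g] by simp
  qed
  have L2: "L2_set (\<lambda>j. norm2 (E j z)) {..<N} \<le> sqrt (real k) * norm2 z"
    "L2_set (\<lambda>j. norm2 (F j z)) {..<N} \<le> sqrt (real k) * norm2 z" for z
    using real_sqrt_le_mono[OF sumE[of z]] real_sqrt_le_mono[OF sumF[of z]]
    by (simp_all add: L2_set_def real_sqrt_mult)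
  define S where "S = num N (T x) - T (num N x)"
  have S: "S = (\<Sum>j<N. F j (T (E j x)) - E j (T (F j x)))"
    by (simp add: S_def num_def additive_sum[of T, OF add] Tdiff sum_subtractf[symmetric] EF[symmetric])
  have "cmod (cinner (hat S) (hat S)) \<le>
      (\<Sum>j<N. cmod (cinner (hat S) (hat (F j (T (E j x)) - E j (T (F j x))))))"
    by (subst (2) S) (simp add: hat_sum cinner_sum_right norm_sum)
  also have "\<dots> \<le> (\<Sum>j<N. c * (norm2 (F j S) * norm2 (E j x)) + c * (norm2 (E j S) * norm2 (F j x)))"
  proof (rule sum_mono)
    fix j
    have *: "cmod (cinner (hat y) (hat (T z))) \<le> c * (norm2 y * norm2 z)" for y z
    proof -
      have "cmod (cinner (hat y) (hat (T z))) \<le> norm2 y * norm2 (T z)"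
        by (rule Cauchy_Schwarz_cinner)
      also have "\<dots> \<le> norm2 y * (c * norm2 z)" by (intro mult_left_mono bd) simp
      finally show ?thesis by (simp add: mult_ac)
    qed
    show "cmod (cinner (hat S) (hat (F j (T (E j x)) - E j (T (F j x)))))
       \<le> c * (norm2 (F j S) * norm2 (E j x)) + c * (norm2 (E j S) * norm2 (F j x))"
      unfolding hat_diff[of "F j (T (E j x))"] cinner_diff_right adjE adjF
      by (rule order_trans[OF norm_triangle_ineq4]) (intro add_mono *)
  qed
  also have "\<dots> = c * ((\<Sum>j<N. norm2 (F j S) * norm2 (E j x)) + (\<Sum>j<N. norm2 (E j S) * norm2 (F j x)))"
    by (simp add: sum.distrib sum_distrib_left distrib_left)
  also have "\<dots> \<le> c * ((sqrt (real k) * norm2 S) * (sqrt (real k) * norm2 x) + (sqrt (real k) * norm2 S) * (sqrt (real k) * norm2 x))"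
  proof (intro mult_left_mono[OF _ c] add_mono)
    have m: "(\<Sum>j<N. norm2 (P j) * norm2 (Q j)) \<le> u * v"
      if "L2_set (\<lambda>j. norm2 (P j)) {..<N} \<le> u" "L2_set (\<lambda>j. norm2 (Q j)) {..<N} \<le> v" for P Q u v
    proof -
      have "(\<Sum>j<N. norm2 (P j) * norm2 (Q j)) \<le>
          L2_set (\<lambda>j. norm2 (P j)) {..<N} * L2_set (\<lambda>j. norm2 (Q j)) {..<N}"
        using L2_set_mult_ineq[of "\<lambda>j. norm2 (P j)" "\<lambda>j. norm2 (Q j)"] by simp
      also have "\<dots> \<le> u * v"
        using that order_trans[OF L2_set_nonneg that(1)] by (intro mult_mono) (auto simp: L2_set_nonneg)
      finally show ?thesis .
    qed
    show "(\<Sum>j<N. norm2 (F j S) * norm2 (E j x)) \<le> (sqrt (real k) * norm2 S) * (sqrt (real k) * norm2 x)"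
      "(\<Sum>j<N. norm2 (E j S) * norm2 (F j x)) \<le> (sqrt (real k) * norm2 S) * (sqrt (real k) * norm2 x)"
      by (intro m L2)+
  qed
  also have "\<dots> = norm2 S * (2 * real k * c * norm2 x)"
  proof -
    have "c * ((s * u) * (s * v) + (s * u) * (s * v)) = u * (2 * (s * s) * c * v)" for s u v :: real
      by algebra
    then show ?thesis by simp
  qed
  finally have "norm2 S * norm2 S \<le> norm2 S * (2 * real k * c * norm2 x)"
    by (simp add: cinner_self norm_power power2_eq_square norm_mult)
  then have "norm2 S \<le> 2 * real k * c * norm2 x"
    using c by (cases "norm2 S = 0") auto
  then show ?thesis by (simp add: S_def)
qed

lemma band_num_commutator:
  assumes T: "band k T c" and c: "c \<ge> 0"
  shows "band k (\<lambda>x. num N (T x) - T (num N x)) (2 * real k * c)"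
proof -
  have add: "T (x + y) = T x + T y" and up: "proj (j + k) (T (proj j x)) = T (proj j x)"
    and down: "proj j (T (proj (j + k) x)) = proj j (T x)" for x y j using T by (auto simp: band_def)
  show ?thesis unfolding band_def
  proof (intro conjI allI)
    fix j x
    have "proj (j + k) (T (num N (proj j x))) = T (num N (proj j x))"
      using up[of j "num N x"] by (simp only: proj_num)
    then show "proj (j + k) (num N (T (proj j x)) - T (num N (proj j x))) = num N (T (proj j x)) - T (num N (proj j x))"
      by (simp add: proj_diff proj_num up)
    have "proj j (T (num N (proj (j + k) x))) = proj j (T (num N x))"
      using down[of j "num N x"] by (simp only: proj_num)
    then show "proj j (num N (T (proj (j + k) x)) - T (num N (proj (j + k) x))) = proj j (num N (T x) - T (num N x))"
      by (simp add: proj_diff proj_num down)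
  qed (use num_commutator_le[OF T c] in \<open>auto simp: add num_add\<close>)
qed

text \<open>The truncation of \<open>(1 + D)\<^sup>n\<close>, where \<open>D\<close> is the number operator.\<close>

definition weight :: "nat \<Rightarrow> nat \<Rightarrow> 'a \<Rightarrow> 'a" where
  "weight N n = (\<lambda>x. x + num N x) ^^ n"

lemma weight_0 [simp]: "weight N 0 x = x" by (simp add: weight_def)

lemma weight_Suc: "weight N (Suc n) x = weight N n x + num N (weight N n x)"
  by (simp add: weight_def)

lemma weight_Suc': "weight N (Suc n) x = weight N n (x + num N x)"
  by (simp add: weight_def funpow_Suc_right del: funpow.simps)

lemma num_scaleC: "num N (c *\<^sub>C x) = c *\<^sub>C num N x"
  by (simp add: num_def proj_scaleC scaleC_sum_right scaleC_diff_right)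

lemma weight_add: "weight N n (x + y) = weight N n x + weight N n y"
  by (induction n) (auto simp: weight_Suc num_add)

lemma weight_scaleC: "weight N n (c *\<^sub>C x) = c *\<^sub>C weight N n x"
  by (induction n) (auto simp: weight_Suc num_scaleC scaleC_add_right)

lemma weight_sum: "weight N n (\<Sum>i\<in>S. f i) = (\<Sum>i\<in>S. weight N n (f i))"
  by (rule additive_sum) (rule weight_add)

lemma bounded_linear_weight: "bounded_linear (weight N n)"
proof (induction n)
  case 0
  show ?case by (simp add: weight_0 [abs_def] bounded_linear_ident)
next
  case (Suc n)
  have "bounded_linear (num N)"
    unfolding num_def
    by (intro bounded_linear_sum bounded_linear_sub bounded_linear_ident bounded_linear_proj)
  from bounded_linear_add[OF Suc bounded_linear_compose[OF this Suc]]
  show ?case by (simp add: weight_Suc [abs_def])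
qed

lemma weight_one [simp]: "weight N n 1 = 1"
proof -
  have "num N 1 = 0" by (simp add: num_def proj_id[OF one_in_level])
  then show ?thesis by (induction n) (auto simp: weight_Suc)
qed

lemma norm2_weight_mono_Suc: "norm2 (weight N n x) \<le> norm2 (weight N (Suc n) x)"
proof (rule power2_le_imp_le)
  let ?y = "weight N n x"
  have "Re (cinner (hat ?y) (hat (?y - proj j ?y))) = (norm2 (?y - proj j ?y))\<^sup>2" for j
  proof -
    have "cinner (hat (proj j ?y)) (hat (?y - proj j ?y)) = 0" by (rule proj_orthogonal[OF proj_in_level])
    then have "cinner (hat ?y) (hat (?y - proj j ?y)) = cinner (hat (?y - proj j ?y)) (hat (?y - proj j ?y))"
      by (simp add: hat_diff[of ?y "proj j ?y"] cinner_diff_left)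
    then show ?thesis by (simp add: cinner_self)
  qed
  then have "Re (cinner (hat ?y) (hat (num N ?y))) \<ge> 0"
    unfolding num_def hat_sum cinner_sum_right Re_sum by (intro sum_nonneg) simp
  then show "(norm2 ?y)\<^sup>2 \<le> (norm2 (weight N (Suc n) x))\<^sup>2"
    by (simp add: weight_Suc hat_add norm_add_square)
qed simp

text \<open>By induction on \<open>n\<close>: with \<open>S\<close> the commutator of the number operator and \<open>T\<close>, the next commutator applied
  to \<open>x\<close> is the previous one applied to \<open>x + num N x\<close> plus the weight applied to \<open>S x\<close>, and \<open>S\<close> has band
  width \<open>k\<close> again.\<close>

lemma weight_commutator_le:
  assumes "band k T c" "c \<ge> 0"
  shows "norm2 (weight N (Suc n) (T x) - T (weight N (Suc n) x))
     \<le> ((1 + 2 * real k) ^ Suc n - 1) * c * norm2 (weight N n x)"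
  using assms
proof (induction n arbitrary: T c x)
  case 0
  have add: "T (x + y) = T x + T y" for x y using 0(1) by (auto simp: band_def)
  show ?case using num_commutator_le[OF 0] by (simp add: weight_Suc add)
next
  case (Suc n)
  have add: "T (x + y) = T x + T y" for x y using Suc.prems(1) by (auto simp: band_def)
  define S where "S = (\<lambda>x. num N (T x) - T (num N x))"
  define q where "q = (1 + 2 * real k) ^ Suc n"
  define w where "w = norm2 (weight N (Suc n) x)"
  have q: "q \<ge> 1" unfolding q_def by (rule one_le_power) simp
  have S: "band k S (2 * real k * c)" unfolding S_def by (rule band_num_commutator[OF Suc.prems])
  have k0: "0 \<le> 2 * real k * c" using Suc.prems(2) by simp
  let ?y = "x + num N x"
  have "weight N (Suc (Suc n)) (T x) - T (weight N (Suc (Suc n)) x) =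
      (weight N (Suc n) (T ?y) - T (weight N (Suc n) ?y)) + (weight N (Suc n) (S x) - S (weight N (Suc n) x))
        + S (weight N (Suc n) x)"
  proof -
    have "T x + num N (T x) = T ?y + S x" by (simp add: S_def add)
    then show ?thesis by (simp only: weight_Suc'[of N "Suc n"] weight_add[of N "Suc n"]) simp
  qed
  then have "norm2 (weight N (Suc (Suc n)) (T x) - T (weight N (Suc (Suc n)) x)) \<le>
      norm2 (weight N (Suc n) (T ?y) - T (weight N (Suc n) ?y))
       + norm2 (weight N (Suc n) (S x) - S (weight N (Suc n) x)) + norm2 (S (weight N (Suc n) x))"
    by (simp only: hat_add) (meson add_right_mono norm_triangle_ineq order_trans)
  also have "\<dots> \<le> (q - 1) * c * w + (q - 1) * (2 * real k * c) * w + 2 * real k * c * w"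
  proof (intro add_mono)
    show "norm2 (weight N (Suc n) (T ?y) - T (weight N (Suc n) ?y)) \<le> (q - 1) * c * w"
      using Suc.IH[OF Suc.prems, of ?y] by (simp add: q_def w_def weight_Suc')
    have "norm2 (weight N (Suc n) (S x) - S (weight N (Suc n) x))
        \<le> (q - 1) * (2 * real k * c) * norm2 (weight N n x)"
      using Suc.IH[OF S k0, of x] by (simp add: q_def)
    also have "\<dots> \<le> (q - 1) * (2 * real k * c) * w"
      using q k0 norm2_weight_mono_Suc unfolding w_def by (intro mult_left_mono) auto
    finally show "norm2 (weight N (Suc n) (S x) - S (weight N (Suc n) x))
        \<le> (q - 1) * (2 * real k * c) * w" .
    show "norm2 (S (weight N (Suc n) x)) \<le> 2 * real k * c * w"
      using S unfolding band_def w_def by blast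
  qed
  also have "\<dots> = ((1 + 2 * real k) * q - 1) * c * w" by (simp add: algebra_simps)
  finally show ?case by (simp add: q_def w_def)
qed

end


section \<open>Riemann sums in a seminormed space\<close>

abbreviation simple_integrable :: "(real \<Rightarrow> 'v::real_vector) \<Rightarrow> bool" where
  "simple_integrable \<equiv> Bochner_Integration.simple_bochner_integrable lborel"

abbreviation simple_integral :: "(real \<Rightarrow> 'v::real_vector) \<Rightarrow> 'v" where
  "simple_integral \<equiv> Bochner_Integration.simple_bochner_integral lborel"

text \<open>Truncated step functions that are constant on the intervals of length \<open>1 / (i + 1)\<close>.\<close>

definition grid_index :: "nat \<Rightarrow> real \<Rightarrow> int" where
  "grid_index i t = \<lfloor>real (Suc i) * t\<rfloor>"

definition grid_point :: "nat \<Rightarrow> int \<Rightarrow> real" where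
  "grid_point i j = real_of_int j / real (Suc i)"

definition grid_bound :: "nat \<Rightarrow> int" where
  "grid_bound i = (int (Suc i))\<^sup>2"

definition grid_step :: "nat \<Rightarrow> (real \<Rightarrow> 'v::real_vector) \<Rightarrow> real \<Rightarrow> 'v" where
  "grid_step i g t = (if \<bar>grid_index i t\<bar> \<le> grid_bound i then g (grid_point i (grid_index i t)) else 0)"

definition riemann_sum :: "nat \<Rightarrow> (real \<Rightarrow> 'v::real_vector) \<Rightarrow> 'v" where
  "riemann_sum i g = (\<Sum>j = - grid_bound i..grid_bound i. (1 / real (Suc i)) *\<^sub>R g (grid_point i j))"

lemma grid_point_close: "grid_point i (grid_index i t) \<le> t" "t - grid_point i (grid_index i t) < 1 / real (Suc i)"
proof -
  have "real_of_int \<lfloor>real (Suc i) * t\<rfloor> \<le> real (Suc i) * t" by (rule of_int_floor_le)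
  then show "grid_point i (grid_index i t) \<le> t"
    by (simp add: grid_point_def grid_index_def divide_le_eq mult.commute)
  have "real (Suc i) * t < real_of_int \<lfloor>real (Suc i) * t\<rfloor> + 1" by (rule real_of_int_floor_add_one_gt)
  then have "t < (real_of_int \<lfloor>real (Suc i) * t\<rfloor> + 1) / real (Suc i)"
    by (simp add: less_divide_eq mult.commute)
  then show "t - grid_point i (grid_index i t) < 1 / real (Suc i)"
    by (simp add: grid_point_def grid_index_def add_divide_distrib)
qed

lemma grid_point_tendsto: "(\<lambda>i. grid_point i (grid_index i t)) \<longlonglongrightarrow> t"
proof (rule LIMSEQ_I)
  fix e :: real assume "e > 0"
  then obtain n where n: "1 / real (Suc n) < e" using nat_approx_posE by blast
  have "norm (grid_point i (grid_index i t) - t) < e" if "n \<le> i" for i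
  proof -
    have "1 / real (Suc i) \<le> 1 / real (Suc n)" using that by (simp add: field_simps)
    then show ?thesis using grid_point_close[where i = i and t = t] n by simp
  qed
  then show "\<exists>n. \<forall>i\<ge>n. norm (grid_point i (grid_index i t) - t) < e" by blast
qed

lemma grid_index_bound_eventually: "\<forall>\<^sub>F i in sequentially. \<bar>grid_index i t\<bar> \<le> grid_bound i"
  unfolding eventually_sequentially
proof (intro exI allI impI)
  fix i assume i: "nat \<lceil>\<bar>t\<bar>\<rceil> \<le> i"
  then have "\<bar>t\<bar> \<le> real i" by linarith
  then have "- real i \<le> t" "t \<le> real i" by auto
  then have "real (Suc i) * - real i \<le> real (Suc i) * t" "real (Suc i) * t \<le> real (Suc i) * real i"
    by (intro mult_left_mono; simp)+
  then have "- (real (Suc i) * real i) \<le> real (Suc i) * t" "real (Suc i) * t \<le> real (Suc i) * real i"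
    by (simp_all only: mult_minus_right)
  moreover have "real (Suc i) * real i \<le> real (Suc i) * real (Suc i)" by (intro mult_left_mono) auto
  moreover have "of_int (grid_bound i) = real (Suc i) * real (Suc i)"
    by (simp add: grid_bound_def power2_eq_square)
  ultimately have "- of_int (grid_bound i) \<le> real (Suc i) * t" "real (Suc i) * t \<le> of_int (grid_bound i)"
    by linarith+
  then show "\<bar>grid_index i t\<bar> \<le> grid_bound i"
    unfolding grid_index_def by linarith
qed

lemma measurable_grid_index: "grid_index i \<in> measurable lborel (count_space UNIV)"
  unfolding grid_index_def [abs_def] by measurable

text \<open>The step function only depends on the index of the interval; all intervals outside the
  truncation are given the common index \<open>grid_bound i + 1\<close>.\<close>

lemma grid_step_simple:
  fixes g :: "real \<Rightarrow> 'v::real_vector"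
  shows "simple_integrable (grid_step i g)"
    and "simple_integral (grid_step i g) = riemann_sum i g"
proof -
  define m where "m = grid_bound i"
  define k where "k t = (if \<bar>grid_index i t\<bar> \<le> m then grid_index i t else m + 1)" for t
  define v where "v j = (if \<bar>j\<bar> \<le> m then g (grid_point i j) else 0)" for j
  have m0: "m \<ge> 0" by (simp add: m_def grid_bound_def)
  have step: "grid_step i g t = v (k t)" for t
    using m0 by (simp add: grid_step_def v_def k_def m_def[symmetric])
  have vm: "v (m + 1) = 0" using m0 by (simp add: v_def)
  have km: "k \<in> measurable lborel (count_space UNIV)" unfolding k_def [abs_def]
    by (rule measurable_compose[OF measurable_grid_index, where g = "\<lambda>j. if \<bar>j\<bar> \<le> m then j else m + 1"]) simp
  have idx: "grid_index i (real_of_int j / real (Suc i)) = j" for j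
    by (simp add: grid_index_def)
  have kr: "range k = {- m..m + 1}"
  proof (intro subset_antisym subsetI)
    fix j assume j: "j \<in> {- m..m + 1}"
    then have "k (real_of_int j / real (Suc i)) = j" unfolding k_def idx by auto
    then show "j \<in> range k" by (metis rangeI)
  qed (use m0 in \<open>auto simp: k_def\<close>)
  have ks: "simple_function lborel k"
  proof -
    have "k -` {j} \<inter> space lborel \<in> sets lborel" for j by (rule measurable_sets[OF km]) simp
    moreover have "finite (k ` space lborel)" by (simp add: kr)
    ultimately show ?thesis unfolding simple_function_def by blast
  qed
  have meas: "{t \<in> space lborel. k t = j} = {real_of_int j / real (Suc i) ..< (real_of_int j + 1) / real (Suc i)}"
    if "j \<in> {- m..m}" for j
  proof -
    have pos: "0 < real (Suc i)" by simp
    have "k t = j \<longleftrightarrow> real_of_int j / real (Suc i) \<le> t \<and> t < (real_of_int j + 1) / real (Suc i)" for t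
    proof -
      have "k t = j \<longleftrightarrow> grid_index i t = j" using that by (auto simp: k_def)
      also have "\<dots> \<longleftrightarrow> real_of_int j \<le> real (Suc i) * t \<and> real (Suc i) * t < real_of_int j + 1"
        unfolding grid_index_def by (rule floor_eq_iff)
      finally show ?thesis
        unfolding pos_divide_le_eq[OF pos] pos_less_divide_eq[OF pos] by (simp only: mult.commute)
    qed
    then show ?thesis by (simp add: set_eq_iff)
  qed
  have meas1: "measure lborel {t \<in> space lborel. k t = j} = 1 / real (Suc i)" if "j \<in> {- m..m}" for j
    unfolding meas[OF that]
    by (subst measure_lborel_Ico) (simp_all add: divide_right_mono add_divide_distrib)
  show int: "simple_integrable (grid_step i g)"
  proof
    show "simple_function lborel (grid_step i g)"
      using simple_function_compose1[OF ks, of v] by (simp add: step [abs_def])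
    have "{t \<in> space lborel. grid_step i g t \<noteq> 0} \<subseteq>
        (\<Union>j\<in>{-m..m}. {real_of_int j / real (Suc i) ..< (real_of_int j + 1) / real (Suc i)})"
    proof
      fix t assume "t \<in> {t \<in> space lborel. grid_step i g t \<noteq> 0}"
      then have "k t \<noteq> m + 1" using vm step by auto
      moreover have "k t \<in> {- m..m + 1}" using kr by blast
      ultimately have "k t \<in> {- m..m}" by auto
      moreover have "t \<in> {s \<in> space lborel. k s = k t}" by simp
      ultimately show "t \<in> (\<Union>j\<in>{-m..m}. {real_of_int j / real (Suc i) ..< (real_of_int j + 1) / real (Suc i)})"
        using meas by blast
    qed
    moreover have "bounded {u..<v}" for u v :: real by (rule bounded_subset[of "{u..v}"]) auto
    ultimately have "bounded {t \<in> space lborel. grid_step i g t \<noteq> 0}"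
      by (elim bounded_subset[rotated]) (intro bounded_UN ballI; simp)
    then show "emeasure lborel {t \<in> space lborel. grid_step i g t \<noteq> 0} \<noteq> \<infinity>"
      using emeasure_bounded_finite by fastforce
  qed
  have "simple_integral (grid_step i g) =
      (\<Sum>j\<in>k ` space lborel. measure lborel {t \<in> space lborel. k t = j} *\<^sub>R v j)"
    by (rule simple_bochner_integral_partition[OF int ks]) (simp_all add: step)
  also have "k ` space lborel = insert (m + 1) {- m..m}" using kr m0 by auto
  also have "(\<Sum>j\<in>\<dots>. measure lborel {t \<in> space lborel. k t = j} *\<^sub>R v j) =
      (\<Sum>j\<in>{- m..m}. (1 / real (Suc i)) *\<^sub>R g (grid_point i j))"
    using meas1 vm by (subst sum.insert) (auto simp: v_def intro!: sum.cong)
  finally show "simple_integral (grid_step i g) = riemann_sum i g"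
    by (simp add: riemann_sum_def m_def)
qed

lemma riemann_sum_linear:
  assumes "\<And>x y. T (x + y) = T x + T y" "\<And>r x. T (r *\<^sub>R x) = r *\<^sub>R T x" "T 0 = 0"
  shows "T (riemann_sum i g) = riemann_sum i (\<lambda>t. T (g t))"
proof -
  have "T (sum f S) = (\<Sum>j\<in>S. T (f j))" for f and S :: "int set"
    by (induction S rule: infinite_finite_induct) (auto simp: assms)
  then show ?thesis by (simp add: riemann_sum_def assms)
qed

text \<open>A curve in a seminormed space that is continuous and decays like \<open>1 / t\<^sup>2\<close>. Its Riemann sums are
  Cauchy for the seminorm; in the applications below their limits are found by other means.\<close>

locale seminormed_curve =
  fixes V :: "'v::real_vector set" and N :: "'v \<Rightarrow> real" and g :: "real \<Rightarrow> 'v" and D :: real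
  assumes zero: "0 \<in> V" and add: "x \<in> V \<Longrightarrow> y \<in> V \<Longrightarrow> x + y \<in> V"
    and scale: "x \<in> V \<Longrightarrow> r *\<^sub>R x \<in> V"
    and N_scale: "x \<in> V \<Longrightarrow> N (r *\<^sub>R x) = \<bar>r\<bar> * N x"
    and N_triangle: "x \<in> V \<Longrightarrow> y \<in> V \<Longrightarrow> N (x + y) \<le> N x + N y"
    and g_in: "g t \<in> V"
    and g_cont: "((\<lambda>t'. N (g t' - g t)) \<longlongrightarrow> 0) (at t)"
    and g_bound: "N (g t) \<le> D / (1 + \<bar>t\<bar>)\<^sup>2"
begin

abbreviation err :: "nat \<Rightarrow> ennreal" where
  "err i \<equiv> \<integral>\<^sup>+ t. ennreal (N (g t - grid_step i g t)) \<partial>lborel"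

lemma N_zero: "N 0 = 0" using N_scale[OF zero, of 0] by simp

lemma minus: "x \<in> V \<Longrightarrow> - x \<in> V" using scale[of x "-1"] by simp

lemma diff: "x \<in> V \<Longrightarrow> y \<in> V \<Longrightarrow> x - y \<in> V" using add[of x "-y"] minus[of y] by simp

lemma N_minus: "x \<in> V \<Longrightarrow> N (- x) = N x" using N_scale[of x "-1"] by simp

lemma N_commute: "x \<in> V \<Longrightarrow> y \<in> V \<Longrightarrow> N (x - y) = N (y - x)"
  using N_minus[of "x - y"] diff[of x y] by simp

lemma N_nonneg: "x \<in> V \<Longrightarrow> 0 \<le> N x"
  using N_triangle[of x "-x"] minus[of x] by (simp add: N_zero N_minus)

lemma N_triangle_diff: "x \<in> V \<Longrightarrow> y \<in> V \<Longrightarrow> N (x - y) \<le> N x + N y"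
  using N_triangle[of x "-y"] minus[of y] by (simp add: N_minus)

lemma N_triangle3: "x \<in> V \<Longrightarrow> y \<in> V \<Longrightarrow> z \<in> V \<Longrightarrow> N (x - z) \<le> N (x - y) + N (y - z)"
  using N_triangle[of "x - y" "y - z"] by (simp add: diff)

lemma sum_in: "(\<And>i. i \<in> S \<Longrightarrow> f i \<in> V) \<Longrightarrow> sum f S \<in> V"
  by (induction S rule: infinite_finite_induct) (auto intro: zero add)

lemma N_sum: "(\<And>i. i \<in> S \<Longrightarrow> f i \<in> V) \<Longrightarrow> N (sum f S) \<le> (\<Sum>i\<in>S. N (f i))"
proof (induction S rule: infinite_finite_induct)
  case (insert x F)
  then have "N (f x + sum f F) \<le> N (f x) + N (sum f F)" by (intro N_triangle sum_in) auto
  with insert show ?case by force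
qed (auto simp: N_zero)

lemma step_in: "grid_step i g t \<in> V" by (simp add: grid_step_def g_in zero)

lemma riemann_sum_in: "riemann_sum i g \<in> V"
  unfolding riemann_sum_def by (intro sum_in scale g_in)

lemma continuous_N_diff:
  assumes v: "v \<in> V"
  shows "continuous_on UNIV (\<lambda>t. N (g t - v))"
  unfolding continuous_on_def
proof
  fix t :: real
  have le: "norm (N (g t' - v) - N (g t - v)) \<le> N (g t' - g t)" for t'
    using N_triangle3[OF g_in[of t'] g_in[of t] v] N_triangle3[OF g_in[of t] g_in[of t'] v]
      N_commute[OF g_in[of t'] g_in[of t]] by simp
  have "((\<lambda>t'. N (g t' - v) - N (g t - v)) \<longlongrightarrow> 0) (at t)"
    by (rule Lim_null_comparison[OF _ g_cont]) (use le in simp)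
  then show "((\<lambda>t'. N (g t' - v)) \<longlongrightarrow> N (g t - v)) (at t within UNIV)"
    by (rule LIM_zero_cancel)
qed

lemma measurable_N_g: "(\<lambda>t. N (g t)) \<in> borel_measurable lborel"
  using borel_measurable_continuous_onI[OF continuous_N_diff[OF zero]] by simp

lemma measurable_N_diff: "(\<lambda>t. N (g t - grid_step i g t)) \<in> borel_measurable lborel"
proof -
  define F where "F j t = N (g t - (if \<bar>j\<bar> \<le> grid_bound i then g (grid_point i j) else 0))" for j t
  have "(\<lambda>t. F (grid_index i t) t) \<in> borel_measurable lborel"
  proof (rule measurable_compose_countable[OF _ measurable_grid_index])
    fix j
    show "(\<lambda>t. F j t) \<in> borel_measurable lborel"
      unfolding F_def using borel_measurable_continuous_onI[OF continuous_N_diff] g_in zero by simp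
  qed
  then show ?thesis by (simp add: F_def grid_step_def)
qed

lemmas measurable_ennreal_N = measurable_compose[OF measurable_N_g measurable_ennreal]
  measurable_compose[OF measurable_N_diff measurable_ennreal]

text \<open>By dominated convergence. A grid point \<open>s\<close> next to \<open>t\<close> satisfies \<open>1 + \<bar>t\<bar> \<le> 2 (1 + \<bar>s\<bar>)\<close>, so the step
  function is bounded by \<open>4 D / (1 + \<bar>t\<bar>)\<^sup>2\<close>.\<close>

lemma integral_error_tendsto: "err \<longlonglongrightarrow> 0"
proof -
  have D0: "D \<ge> 0" using order_trans[OF N_nonneg[OF g_in] g_bound[of 0]] by simp
  have "err \<longlonglongrightarrow> (\<integral>\<^sup>+ (t::real). 0 \<partial>lborel)"
  proof (rule nn_integral_dominated_convergence[where w = "\<lambda>t. ennreal (5 * D * (1 / (1 + \<bar>t\<bar>)\<^sup>2))"])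
    show "(\<lambda>t. ennreal (N (g t - grid_step i g t))) \<in> borel_measurable lborel" for i
      by (rule measurable_ennreal_N)
    have "integrable lborel (\<lambda>t. 5 * D * (1 / (1 + \<bar>t\<bar>)\<^sup>2))"
      by (rule integrable_mult_right[OF integrable_inverse_one_plus_abs_square])
    then show "(\<integral>\<^sup>+ t. ennreal (5 * D * (1 / (1 + \<bar>t\<bar>)\<^sup>2)) \<partial>lborel) < \<infinity>"
      using D0 by (subst nn_integral_eq_integral) auto
    show "AE t in lborel. ennreal (N (g t - grid_step i g t)) \<le> ennreal (5 * D * (1 / (1 + \<bar>t\<bar>)\<^sup>2))" for i
    proof (rule AE_I2, rule ennreal_leI)
      fix t
      let ?s = "grid_point i (grid_index i t)"
      have p: "0 < 1 + \<bar>t\<bar>" "0 < 1 + \<bar>?s\<bar>" by (simp_all add: add_pos_nonneg)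
      have "1 / real (Suc i) \<le> 1" by simp
      then have "\<bar>t\<bar> \<le> \<bar>?s\<bar> + 1" using grid_point_close[where i = i and t = t] by linarith
      then have "1 + \<bar>t\<bar> \<le> 2 * (1 + \<bar>?s\<bar>)" by simp
      then have "(1 + \<bar>t\<bar>)\<^sup>2 \<le> (2 * (1 + \<bar>?s\<bar>))\<^sup>2" by (rule power_mono) simp
      then have "(1 + \<bar>t\<bar>)\<^sup>2 \<le> 4 * (1 + \<bar>?s\<bar>)\<^sup>2" by (simp only: power_mult_distrib) simp
      then have q: "1 / (1 + \<bar>?s\<bar>)\<^sup>2 \<le> 4 * (1 / (1 + \<bar>t\<bar>)\<^sup>2)" using p by (simp add: field_simps)
      have "N (grid_step i g t) \<le> D / (1 + \<bar>?s\<bar>)\<^sup>2"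
        using g_bound[of ?s] D0 by (simp add: grid_step_def N_zero)
      also have "\<dots> \<le> D * (4 * (1 / (1 + \<bar>t\<bar>)\<^sup>2))" using mult_left_mono[OF q D0] by simp
      finally have "N (grid_step i g t) \<le> D * (4 * (1 / (1 + \<bar>t\<bar>)\<^sup>2))" .
      then show "N (g t - grid_step i g t) \<le> 5 * D * (1 / (1 + \<bar>t\<bar>)\<^sup>2)"
        using N_triangle_diff[OF g_in[of t] step_in[of i t]] g_bound[of t] by simp
    qed
    show "AE t in lborel. (\<lambda>i. ennreal (N (g t - grid_step i g t))) \<longlonglongrightarrow> 0"
    proof (rule AE_I2)
      fix t
      have "((\<lambda>t'. N (g t - g t')) \<longlongrightarrow> N (g t - g t)) (at t)"
        using g_cont[of t] by (simp add: N_zero N_commute[OF g_in g_in])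
      then have "isCont (\<lambda>t'. N (g t - g t')) t" by (simp add: isCont_def)
      from isCont_tendsto_compose[OF this grid_point_tendsto]
      have "(\<lambda>i. N (g t - g (grid_point i (grid_index i t)))) \<longlonglongrightarrow> 0" by (simp add: N_zero)
      then have "(\<lambda>i. N (g t - grid_step i g t)) \<longlonglongrightarrow> 0"
        by (rule Lim_transform_eventually)
           (use grid_index_bound_eventually[of t] in \<open>auto elim!: eventually_mono simp: grid_step_def\<close>)
      then show "(\<lambda>i. ennreal (N (g t - grid_step i g t))) \<longlonglongrightarrow> 0"
        using tendsto_ennrealI by fastforce
    qed
  qed simp_all
  then show ?thesis by simp
qed

lemma N_simple_integral_le:
  assumes h: "simple_integrable h" and hV: "\<And>t. h t \<in> V"
  shows "ennreal (N (simple_integral h)) \<le> (\<integral>\<^sup>+ t. ennreal (N (h t)) \<partial>lborel)"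
proof -
  have hs: "simple_function lborel h" using h by (auto elim: simple_bochner_integrable.cases)
  have hN: "simple_integrable (\<lambda>t. N (h t))"
    using simple_bochner_integrable_compose2[of "\<lambda>x y. N x", OF _ h h] by (simp add: N_zero)
  have "N (simple_integral h) \<le>
      (\<Sum>y\<in>h ` space lborel. N (measure lborel {t \<in> space lborel. h t = y} *\<^sub>R y))"
    unfolding simple_bochner_integral_def by (rule N_sum) (use hV in \<open>auto intro: scale\<close>)
  also have "\<dots> = (\<Sum>y\<in>h ` space lborel. measure lborel {t \<in> space lborel. h t = y} *\<^sub>R N y)"
    by (rule sum.cong) (use hV in \<open>auto simp: N_scale\<close>)
  also have "\<dots> = simple_integral (\<lambda>t. N (h t))"
    by (rule simple_bochner_integral_partition[symmetric, OF hN hs]) auto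
  finally have "ennreal (N (simple_integral h)) \<le>
      ennreal (simple_integral (\<lambda>t. N (h t)))" by (rule ennreal_leI)
  also have "\<dots> = (\<integral>\<^sup>+ t. ennreal (N (h t)) \<partial>lborel)"
    by (rule simple_bochner_integral_eq_nn_integral[OF hN]) (rule N_nonneg[OF hV])
  finally show ?thesis .
qed

lemma N_riemann_sum_le:
  "ennreal (N (riemann_sum i g)) \<le> (\<integral>\<^sup>+ t. ennreal (N (g t)) \<partial>lborel) + err i"
proof -
  have "ennreal (N (riemann_sum i g)) \<le> (\<integral>\<^sup>+ t. ennreal (N (grid_step i g t)) \<partial>lborel)"
    using N_simple_integral_le[OF grid_step_simple(1) step_in, of i] by (simp add: grid_step_simple(2))
  also have "\<dots> \<le> (\<integral>\<^sup>+ t. ennreal (N (g t)) + ennreal (N (g t - grid_step i g t)) \<partial>lborel)"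
  proof (rule nn_integral_mono)
    fix t
    have "N (grid_step i g t) \<le> N (g t) + N (g t - grid_step i g t)"
      using N_triangle_diff[OF g_in[of t] diff[OF g_in[of t] step_in[of i t]]] by simp
    then show "ennreal (N (grid_step i g t)) \<le> ennreal (N (g t)) + ennreal (N (g t - grid_step i g t))"
      by (subst ennreal_plus[symmetric]) (auto intro!: N_nonneg diff g_in step_in ennreal_leI)
  qed
  also have "\<dots> = (\<integral>\<^sup>+ t. ennreal (N (g t)) \<partial>lborel) + err i"
    by (intro nn_integral_add measurable_ennreal_N)
  finally show ?thesis .
qed

lemma riemann_sum_Cauchy:
  assumes e: "e > 0"
  shows "\<exists>i0. \<forall>i\<ge>i0. \<forall>k\<ge>i0. N (riemann_sum i g - riemann_sum k g) \<le> e"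
proof -
  have "\<forall>\<^sub>F i in sequentially. err i < ennreal (e / 2)"
    using integral_error_tendsto by (rule order_tendstoD(2)) (use e in simp)
  then obtain i0 where i0: "\<And>i. i \<ge> i0 \<Longrightarrow> err i < ennreal (e / 2)"
    unfolding eventually_sequentially by blast
  have "N (riemann_sum i g - riemann_sum k g) \<le> e" if "i \<ge> i0" "k \<ge> i0" for i k
  proof -
    have s: "simple_integrable (\<lambda>t. grid_step i g t - grid_step k g t)"
      by (rule simple_bochner_integrable_compose2[OF _ grid_step_simple(1) grid_step_simple(1)]) simp
    have "ennreal (N (riemann_sum i g - riemann_sum k g)) =
        ennreal (N (simple_integral (\<lambda>t. grid_step i g t - grid_step k g t)))"
      by (simp add: simple_bochner_integral_diff grid_step_simple)
    also have "\<dots> \<le> (\<integral>\<^sup>+ t. ennreal (N (grid_step i g t - grid_step k g t)) \<partial>lborel)"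
      by (rule N_simple_integral_le[OF s]) (intro diff step_in)
    also have "\<dots> \<le> (\<integral>\<^sup>+ t. ennreal (N (g t - grid_step i g t)) + ennreal (N (g t - grid_step k g t)) \<partial>lborel)"
    proof (rule nn_integral_mono)
      fix t
      have "N (grid_step i g t - grid_step k g t) \<le> N (g t - grid_step i g t) + N (g t - grid_step k g t)"
        using N_triangle3[OF step_in[of i t] g_in[of t] step_in[of k t]] N_commute[OF step_in[of i t] g_in[of t]]
        by simp
      then show "ennreal (N (grid_step i g t - grid_step k g t)) \<le>
          ennreal (N (g t - grid_step i g t)) + ennreal (N (g t - grid_step k g t))"
        by (subst ennreal_plus[symmetric]) (auto intro!: N_nonneg diff g_in step_in ennreal_leI)
    qed
    also have "\<dots> = err i + err k"
      by (intro nn_integral_add measurable_ennreal_N)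
    also have "\<dots> \<le> ennreal (e / 2) + ennreal (e / 2)"
      using i0[OF that(1)] i0[OF that(2)] by (intro add_mono less_imp_le)
    also have "\<dots> = ennreal e" using e by (simp add: ennreal_plus[symmetric] del: ennreal_plus)
    finally show ?thesis using e by (simp add: ennreal_le_iff)
  qed
  then show ?thesis by blast
qed

end

lemma riemann_sum_tendsto_integral:
  fixes g :: "real \<Rightarrow> complex"
  assumes g: "continuous_on UNIV g" and b: "\<And>t. cmod (g t) \<le> D / (1 + \<bar>t\<bar>)\<^sup>2"
  shows "(\<lambda>i. riemann_sum i g) \<longlonglongrightarrow> (LINT t|lborel. g t)"
proof -
  interpret seminormed_curve UNIV cmod g D
  proof
    show "((\<lambda>t'. cmod (g t' - g t)) \<longlongrightarrow> 0) (at t)" for t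
      using g by (auto simp: continuous_on_def LIM_zero intro: tendsto_norm_zero)
  qed (auto simp: b norm_triangle_ineq)
  have "Cauchy (\<lambda>i. riemann_sum i g)"
  proof (rule metric_CauchyI)
    fix e :: real assume "e > 0"
    then obtain i0 where "\<forall>i\<ge>i0. \<forall>k\<ge>i0. cmod (riemann_sum i g - riemann_sum k g) \<le> e / 2"
      using riemann_sum_Cauchy[of "e / 2"] by auto
    with \<open>e > 0\<close> show "\<exists>i0. \<forall>i\<ge>i0. \<forall>k\<ge>i0. dist (riemann_sum i g) (riemann_sum k g) < e"
      by (intro exI[of _ i0]) (force simp: dist_norm)
  qed
  then obtain x where x: "(\<lambda>i. riemann_sum i g) \<longlonglongrightarrow> x" using Cauchy_convergent convergent_def by blast
  have "has_bochner_integral lborel g x"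
  proof (rule has_bochner_integral.intros)
    show "g \<in> borel_measurable lborel" using borel_measurable_continuous_onI[OF g] by simp
    show "simple_integrable (grid_step i g)" for i
      by (rule grid_step_simple)
    show "(\<lambda>i. \<integral>\<^sup>+ t. ennreal (cmod (g t - grid_step i g t)) \<partial>lborel) \<longlonglongrightarrow> 0"
      by (rule integral_error_tendsto)
    show "(\<lambda>i. simple_integral (grid_step i g)) \<longlonglongrightarrow> x"
      using x by (simp add: grid_step_simple)
  qed
  then have "(LINT t|lborel. g t) = x" by (rule has_bochner_integral_integral_eq)
  with x show ?thesis by simp
qed


context rapid_decay_filtration
begin

section \<open>Sobolev norms of elements of the algebra\<close>

abbreviation Sob :: "nat \<Rightarrow> 'h set" where "Sob n \<equiv> sobolev_space hat L (real n)"

abbreviation sob :: "nat \<Rightarrow> 'a \<Rightarrow> real" where "sob n x \<equiv> sobolev_norm hat L (real n) (hat x)"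

definition component :: "nat \<Rightarrow> 'a \<Rightarrow> 'a" where
  "component k a = proj k a - (if k = 0 then 0 else proj (k - 1) a)"

lemma hat_component: "hat (component k a) = level_proj hat L k (hat a)"
  by (simp add: component_def level_proj_def hat_diff hat_proj)

lemma component_in_level: "component k a \<in> level k"
  using proj_in_level[of "k - 1"] level_mono[of "k - 1" k]
  by (auto simp: component_def intro!: level_diff proj_in_level level_zero)

lemma component_add: "component k (x + y) = component k x + component k y"
  by (simp add: component_def proj_add)

lemma component_diff: "component k (x - y) = component k x - component k y"
  by (simp add: component_def proj_diff)

lemma component_scaleC: "component k (c *\<^sub>C x) = c *\<^sub>C component k x"
  by (simp add: component_def proj_scaleC scaleC_diff_right)

lemma component_sum: "component k (\<Sum>i\<in>S. f i) = (\<Sum>i\<in>S. component k (f i))"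
  by (simp add: component_def proj_sum sum_subtractf)

lemma sum_component: "(\<Sum>k\<le>K. component k a) = proj K a"
  by (induction K) (simp_all add: component_def)

lemma sum_norm2_component: "(\<Sum>k\<le>K. (norm2 (component k a))\<^sup>2) = (norm2 (proj K a))\<^sup>2"
  by (induction K) (simp_all add: component_def norm2_proj_diff)

lemma component_proj: "component k (proj j a) = (if j < k then 0 else component k a)"
proof (cases "j < k")
  case True
  then have "min k j = j" "min (k - 1) j = j" "k \<noteq> 0" by auto
  with True show ?thesis by (simp add: component_def proj_proj)
next
  case False
  then have "min k j = k" "min (k - 1) j = k - 1" by auto
  with False show ?thesis by (simp add: component_def proj_proj)
qed

lemma component_num:
  assumes "k \<le> N"
  shows "component k (num N x) = real k *\<^sub>R component k x"
proof -
  have "component k (num N x) = (\<Sum>j<N. if j < k then component k x else 0)"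
    by (simp add: num_def component_sum component_diff component_proj cong: sum.cong)
      (rule sum.cong, auto)
  also have "\<dots> = (\<Sum>j<k. component k x)"
    using assms by (intro sum.mono_neutral_cong_right) auto
  finally show ?thesis by (simp only: sum_constant_scaleR card_lessThan)
qed

lemma component_weight:
  assumes "k \<le> N"
  shows "component k (weight N n x) = ((real k + 1) ^ n) *\<^sub>R component k x"
  by (induction n) (auto simp: weight_Suc component_add component_num[OF assms] algebra_simps)

text \<open>The contribution of the degrees up to \<open>K\<close> to the Sobolev norm. It is continuous in \<open>L\<^sup>2\<close>, and the Sobolev
  norm is the supremum over \<open>K\<close>; so bounds on Sobolev norms pass to limits in \<open>L\<^sup>2\<close>.\<close>

definition partial_sobolev :: "nat \<Rightarrow> nat \<Rightarrow> 'a \<Rightarrow> real" where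
  "partial_sobolev K n x = L2_set (\<lambda>k. (real k + 1) ^ n * norm2 (component k x)) {..K}"

lemma partial_sobolev_triangle: "partial_sobolev K n (x + y) \<le> partial_sobolev K n x + partial_sobolev K n y"
proof -
  have "partial_sobolev K n (x + y) \<le>
      L2_set (\<lambda>k. (real k + 1) ^ n * norm2 (component k x) + (real k + 1) ^ n * norm2 (component k y)) {..K}"
    unfolding partial_sobolev_def
  proof (rule L2_set_mono)
    fix k
    have "(real k + 1) ^ n * norm2 (component k (x + y)) \<le>
        (real k + 1) ^ n * (norm2 (component k x) + norm2 (component k y))"
      by (intro mult_left_mono) (simp_all add: component_add hat_add norm_triangle_ineq)
    then show "(real k + 1) ^ n * norm2 (component k (x + y)) \<le>
        (real k + 1) ^ n * norm2 (component k x) + (real k + 1) ^ n * norm2 (component k y)"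
      by (simp add: distrib_left)
  qed simp
  also have "\<dots> \<le> partial_sobolev K n x + partial_sobolev K n y"
    unfolding partial_sobolev_def by (rule L2_set_triangle_ineq)
  finally show ?thesis .
qed

lemma partial_sobolev_scaleC: "partial_sobolev K n (c *\<^sub>C x) = cmod c * partial_sobolev K n x"
  by (simp add: partial_sobolev_def component_scaleC hat_scaleC norm_scaleC L2_set_right_distrib mult_ac)

text \<open>In degrees up to \<open>N\<close> the truncated weight agrees with \<open>(1 + D)\<^sup>n\<close>.\<close>

lemma partial_sobolev_le_weight:
  assumes "K \<le> N"
  shows "partial_sobolev K n x \<le> norm2 (weight N n x)"
proof -
  have "partial_sobolev K n x = L2_set (\<lambda>k. norm2 (component k (weight N n x))) {..K}"
    unfolding partial_sobolev_def
    using assms by (intro L2_set_cong) (auto simp: component_weight hat_scaleR)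
  also have "\<dots> = norm2 (proj K (weight N n x))"
    by (simp add: L2_set_def sum_norm2_component)
  also have "\<dots> \<le> norm2 (weight N n x)" by (rule norm2_proj_le)
  finally show ?thesis .
qed

lemma sobolev_term: "(real k + 1) powr (2 * s) * (norm (level_proj hat L k (hat x)))\<^sup>2 =
    ((real k + 1) powr s * norm2 (component k x))\<^sup>2"
  by (simp add: hat_component power_mult_distrib powr_power mult.commute)

lemma partial_sobolev_square: "(partial_sobolev K n x)\<^sup>2 =
    (\<Sum>k\<le>K. (real k + 1) powr (2 * real n) * (norm (level_proj hat L k (hat x)))\<^sup>2)"
  unfolding sobolev_term by (simp add: partial_sobolev_def L2_set_def sum_nonneg powr_realpow)

lemma partial_sobolev_nonneg [simp]: "0 \<le> partial_sobolev K n x"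
  by (simp add: partial_sobolev_def L2_set_nonneg)

lemma sobolevI:
  assumes "\<And>K. partial_sobolev K n x \<le> c"
  shows "hat x \<in> Sob n" "sob n x \<le> c"
proof -
  let ?f = "\<lambda>k. (real k + 1) powr (2 * real n) * (norm (level_proj hat L k (hat x)))\<^sup>2"
  have c: "c \<ge> 0" using order_trans[OF partial_sobolev_nonneg assms] .
  have le: "sum ?f {..<m} \<le> c\<^sup>2" for m
  proof -
    have "sum ?f {..<m} \<le> sum ?f {..m}" by (rule sum_mono2) auto
    also have "\<dots> \<le> c\<^sup>2" unfolding partial_sobolev_square[symmetric]
      by (rule power_mono[OF assms]) simp
    finally show ?thesis .
  qed
  have s: "summable ?f" by (rule summableI_nonneg_bounded[OF _ le]) simp
  then show "hat x \<in> Sob n" by (simp add: sobolev_space_def)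
  have "suminf ?f \<le> c\<^sup>2" by (rule suminf_le_const[OF s le])
  then have "sqrt (suminf ?f) \<le> sqrt (c\<^sup>2)" by (rule real_sqrt_le_mono)
  then show "sob n x \<le> c" using c by (simp add: sobolev_norm_def)
qed

lemma partial_sobolev_le_norm:
  assumes "hat x \<in> Sob n"
  shows "partial_sobolev K n x \<le> sob n x"
proof -
  have "(partial_sobolev K n x)\<^sup>2 \<le> (\<Sum>k. (real k + 1) powr (2 * real n) * (norm (level_proj hat L k (hat x)))\<^sup>2)"
    unfolding partial_sobolev_square using assms by (intro sum_le_suminf) (auto simp: sobolev_space_def)
  then have "sqrt ((partial_sobolev K n x)\<^sup>2) \<le> sob n x"
    unfolding sobolev_norm_def by (rule real_sqrt_le_mono)
  then show ?thesis by simp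
qed

lemma partial_sobolev_tendsto:
  assumes "(\<lambda>i. hat (f i)) \<longlonglongrightarrow> hat x"
  shows "(\<lambda>i. partial_sobolev K n (f i)) \<longlonglongrightarrow> partial_sobolev K n x"
proof -
  have lim: "(\<lambda>i. norm2 (component k (f i))) \<longlonglongrightarrow> norm2 (component k x)" for k
  proof -
    have le: "norm (hat (component k (f i)) - hat (component k x)) \<le> 2 * norm (hat (f i) - hat x)" for i
    proof -
      have "norm2 (component k z) \<le> 2 * norm2 z" for z
      proof -
        have "norm2 (component k z) \<le> norm2 (proj k z) + norm2 (if k = 0 then 0 else proj (k - 1) z)"
          unfolding component_def hat_diff by (rule norm_triangle_ineq4)
        also have "\<dots> \<le> norm2 z + norm2 z"
          by (intro add_mono) (auto simp: norm2_proj_le)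
        finally show ?thesis by simp
      qed
      from this[of "f i - x"] show ?thesis by (simp add: component_diff hat_diff)
    qed
    have "(\<lambda>i. 2 * norm (hat (f i) - hat x)) \<longlonglongrightarrow> 0"
      using tendsto_mult_right_zero[OF tendsto_norm_zero[OF LIM_zero[OF assms]], of 2] by simp
    then have "(\<lambda>i. hat (component k (f i)) - hat (component k x)) \<longlonglongrightarrow> 0"
      by (rule Lim_null_comparison[rotated]) (use le in simp)
    then show ?thesis by (intro tendsto_norm) (rule LIM_zero_cancel)
  qed
  then show ?thesis unfolding partial_sobolev_def L2_set_def
    by (intro tendsto_real_sqrt tendsto_sum tendsto_power tendsto_mult tendsto_const lim)
qed

text \<open>The Sobolev norm of order \<open>n\<close> is controlled by the norm of \<open>L\<^sup>2\<close> and the Sobolev norm of order \<open>2 n\<close>. Hence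
  a curve that is bounded in the latter and continuous in \<open>L\<^sup>2\<close> is continuous in the former.\<close>

lemma sobolev_interpolation:
  assumes x: "hat x \<in> Sob (2 * n)"
  shows "hat x \<in> Sob n" "sob n x \<le> sqrt (norm2 x * sob (2 * n) x)"
proof -
  have "partial_sobolev K n x \<le> sqrt (norm2 x * sob (2 * n) x)" for K
  proof (rule real_le_rsqrt)
    let ?c = "\<lambda>k. norm2 (component k x)"
    have "(partial_sobolev K n x)\<^sup>2 = (\<Sum>k\<le>K. ((real k + 1) ^ 0 * ?c k) * ((real k + 1) ^ (2 * n) * ?c k))"
    proof -
      have "(real k + 1) ^ (2 * n) = (real k + 1) ^ n * (real k + 1) ^ n" for k
        by (simp add: mult_2 power_add)
      then show ?thesis
        by (simp add: partial_sobolev_def L2_set_def sum_nonneg power2_eq_square mult_ac)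
    qed
    also have "\<dots> \<le> partial_sobolev K 0 x * partial_sobolev K (2 * n) x"
      unfolding partial_sobolev_def
      using L2_set_mult_ineq[of "\<lambda>k. (real k + 1) ^ 0 * ?c k" "\<lambda>k. (real k + 1) ^ (2 * n) * ?c k" "{..K}"]
      by (simp add: abs_mult)
    also have "\<dots> \<le> norm2 x * sob (2 * n) x"
      using partial_sobolev_le_weight[OF order_refl, of K 0 x]
      by (intro mult_mono partial_sobolev_le_norm x) auto
    finally show "(partial_sobolev K n x)\<^sup>2 \<le> norm2 x * sob (2 * n) x" .
  qed
  from sobolevI[OF this] show "hat x \<in> Sob n" "sob n x \<le> sqrt (norm2 x * sob (2 * n) x)" by auto
qed

lemma sobolev_add:
  assumes "hat x \<in> Sob n" "hat y \<in> Sob n"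
  shows "hat (x + y) \<in> Sob n"
    and "sob n (x + y) \<le>
      sob n x + sob n y"
proof -
  have "partial_sobolev K n (x + y) \<le> sob n x + sob n y" for K
    using partial_sobolev_triangle[of K n x y] partial_sobolev_le_norm[OF assms(1), of K]
      partial_sobolev_le_norm[OF assms(2), of K] by linarith
  from sobolevI[OF this] show "hat (x + y) \<in> Sob n"
    "sob n (x + y) \<le>
      sob n x + sob n y" by auto
qed

lemma sobolev_scaleC:
  assumes "hat x \<in> Sob n"
  shows "hat (c *\<^sub>C x) \<in> Sob n"
    and "sob n (c *\<^sub>C x) = cmod c * sob n x"
proof -
  have *: "hat (d *\<^sub>C y) \<in> Sob n \<and>
      sob n (d *\<^sub>C y) \<le> cmod d * sob n y"
    if "hat y \<in> Sob n" for d y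
  proof -
    have "partial_sobolev K n (d *\<^sub>C y) \<le> cmod d * sob n y" for K
      unfolding partial_sobolev_scaleC by (intro mult_left_mono partial_sobolev_le_norm that) simp
    from sobolevI[OF this] show ?thesis by auto
  qed
  show m: "hat (c *\<^sub>C x) \<in> Sob n" using * assms by blast
  show "sob n (c *\<^sub>C x) = cmod c * sob n x"
  proof (cases "c = 0")
    case True
    have "0 \<le> sob n (c *\<^sub>C x)"
      by (rule order_trans[OF partial_sobolev_nonneg partial_sobolev_le_norm[OF m, of 0]])
    with *[OF assms, of c] True show ?thesis by simp
  next
    case False
    have "sob n x \<le> cmod (1 / c) * sob n (c *\<^sub>C x)"
      using *[OF m, of "1 / c"] False by (simp add: scaleC_scaleC scaleC_one)
    then have "cmod c * sob n x \<le> sob n (c *\<^sub>C x)"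
      using False by (simp add: norm_divide pos_le_divide_eq mult.commute)
    with * assms show ?thesis by (intro antisym) auto
  qed
qed


section \<open>Commutators with elements of a Sobolev space\<close>

definition commutator_const :: real where
  "commutator_const = C * sqrt (\<Sum>k. (1 / (real k + 1))\<^sup>2)"

lemma summable_inverse_square: "summable (\<lambda>k. (1 / (real k + 1))\<^sup>2)"
  using inverse_squares_sums by (auto simp: sums_iff power_divide add.commute)

lemma commutator_const_nonneg: "commutator_const \<ge> 0"
  unfolding commutator_const_def using C_pos
  by (intro mult_nonneg_nonneg real_sqrt_ge_zero suminf_nonneg summable_inverse_square) auto

lemma sobolev_norm_nonneg:
  assumes "\<xi> \<in> sobolev_space hat L s"
  shows "sobolev_norm hat L s \<xi> \<ge> 0"
  using assms unfolding sobolev_norm_def sobolev_space_def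
  by (intro real_sqrt_ge_zero suminf_nonneg) auto

text \<open>Rapid decay costs the exponent \<open>\<alpha>\<close>, and the Cauchy-Schwarz inequality against \<open>1 / (k + 1)\<close>
  costs one more.\<close>

lemma sum_weighted_norm_component_le:
  assumes a: "hat a \<in> sobolev_space hat L (\<alpha> + real n + 1)"
  shows "(\<Sum>k\<le>K. (real k + 1) ^ n * norm (component k a))
      \<le> commutator_const * sobolev_norm hat L (\<alpha> + real n + 1) (hat a)"
proof -
  let ?s = "\<alpha> + real n + 1"
  let ?h = "\<lambda>k. (real k + 1) powr ?s * norm2 (component k a)"
  have t: "(real k + 1) ^ n * norm (component k a) \<le> C * (1 / (real k + 1) * ?h k)" for k
  proof -
    have "(real k + 1) ^ n * norm (component k a) \<le>
        (real k + 1) ^ n * (C * (real k + 1) powr \<alpha> * norm2 (component k a))"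
      by (intro mult_left_mono norm_le_on_level component_in_level) simp
    also have "(real k + 1) powr ?s = (real k + 1) powr \<alpha> * (real k + 1) ^ n * (real k + 1)"
      by (simp add: powr_add powr_realpow)
    then have "(real k + 1) ^ n * (C * (real k + 1) powr \<alpha> * norm2 (component k a)) = C * (1 / (real k + 1) * ?h k)"
      by simp
    finally show ?thesis .
  qed
  have "(\<Sum>k\<le>K. (real k + 1) ^ n * norm (component k a)) \<le> C * (\<Sum>k\<le>K. 1 / (real k + 1) * ?h k)"
    unfolding sum_distrib_left by (rule sum_mono) (rule t)
  also have "(\<Sum>k\<le>K. 1 / (real k + 1) * ?h k) \<le> L2_set (\<lambda>k. 1 / (real k + 1)) {..K} * L2_set ?h {..K}"
    using L2_set_mult_ineq[of "\<lambda>k. 1 / (real k + 1)" ?h "{..K}"] by simp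
  also have "\<dots> \<le> sqrt (\<Sum>k. (1 / (real k + 1))\<^sup>2) * sobolev_norm hat L ?s (hat a)"
  proof (rule mult_mono)
    show "L2_set (\<lambda>k. 1 / (real k + 1)) {..K} \<le> sqrt (\<Sum>k. (1 / (real k + 1))\<^sup>2)"
      unfolding L2_set_def by (intro real_sqrt_le_mono sum_le_suminf summable_inverse_square) auto
    show "L2_set ?h {..K} \<le> sobolev_norm hat L ?s (hat a)"
      unfolding L2_set_def sobolev_norm_def sobolev_term[symmetric]
      using a by (intro real_sqrt_le_mono sum_le_suminf) (auto simp: sobolev_space_def)
    show "0 \<le> sqrt (\<Sum>k. (1 / (real k + 1))\<^sup>2)"
      by (intro real_sqrt_ge_zero suminf_nonneg summable_inverse_square) simp
  qed (simp add: L2_set_nonneg)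
  finally show ?thesis using C_pos by (simp add: commutator_const_def mult.assoc)
qed

text \<open>The components of \<open>a\<close> form an absolutely convergent series in the C*-norm; its sum has the same vector in
  \<open>L\<^sup>2\<close> as \<open>a\<close>.\<close>

lemma proj_tendsto:
  assumes a: "hat a \<in> sobolev_space hat L (\<alpha> + real n + 1)"
  shows "(\<lambda>K. proj K a) \<longlonglongrightarrow> a"
proof -
  let ?c = "commutator_const * sobolev_norm hat L (\<alpha> + real n + 1) (hat a)"
  have "(\<Sum>k<m. norm (component k a)) \<le> ?c" for m
  proof -
    have "(\<Sum>k<m. norm (component k a)) \<le> (\<Sum>k\<le>m. norm (component k a))" by (rule sum_mono2) auto
    also have "\<dots> \<le> (\<Sum>k\<le>m. (real k + 1) ^ n * norm (component k a))"
    proof (rule sum_mono)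
      fix k
      have "1 * norm (component k a) \<le> (real k + 1) ^ n * norm (component k a)"
        by (intro mult_right_mono one_le_power) auto
      then show "norm (component k a) \<le> (real k + 1) ^ n * norm (component k a)" by simp
    qed
    also have "\<dots> \<le> ?c" by (rule sum_weighted_norm_component_le[OF a])
    finally show ?thesis .
  qed
  then have "summable (\<lambda>k. norm (component k a))" by (intro summableI_nonneg_bounded) auto
  then have "summable (\<lambda>k. component k a)" by (rule summable_norm_cancel)
  then have "(\<lambda>m. \<Sum>k<m. component k a) \<longlonglongrightarrow> (\<Sum>k. component k a)" by (rule summable_LIMSEQ)
  from LIMSEQ_Suc[OF this] have lim: "(\<lambda>K. proj K a) \<longlonglongrightarrow> (\<Sum>k. component k a)"
    by (simp add: lessThan_Suc_atMost sum_component)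
  have "hat (\<Sum>k. component k a) = hat a"
    by (rule LIMSEQ_unique[OF tendsto_hat[OF lim] hat_proj_tendsto])
  with lim show ?thesis by (simp add: hat_inject)
qed

text \<open>Decompose \<open>a\<close> into its components; the component of degree \<open>k\<close> is an operator of band width \<open>k\<close>,
  whose commutator with the weight costs a factor \<open>(1 + 2 k) ^ Suc m \<le> 2 ^ n * (k + 1) ^ n\<close>.\<close>

lemma weight_commutator_element_le:
  assumes a: "hat a \<in> sobolev_space hat L (\<alpha> + real n + 1)" and m: "m < n"
  shows "norm2 (weight N (Suc m) (a * x) - a * weight N (Suc m) x)
    \<le> 2 ^ n * commutator_const * sobolev_norm hat L (\<alpha> + real n + 1) (hat a) * norm2 (weight N m x)"
    (is "_ \<le> ?B * _")
proof -
  let ?w = "norm2 (weight N m x)"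
  let ?c = "\<lambda>b. weight N (Suc m) (b * x) - b * weight N (Suc m) x"
  have bound: "norm2 (?c (proj K a)) \<le> ?B * ?w" for K
  proof -
    have "?c (proj K a) = (\<Sum>k\<le>K. ?c (component k a))"
      by (simp add: sum_component[symmetric] sum_distrib_right weight_sum sum_subtractf)
    then have "norm2 (?c (proj K a)) \<le> (\<Sum>k\<le>K. norm2 (?c (component k a)))"
      by (simp add: hat_sum norm_sum)
    also have "\<dots> \<le> (\<Sum>k\<le>K. 2 ^ n * ((real k + 1) ^ n * norm (component k a)) * ?w)"
    proof (rule sum_mono)
      fix k
      have "(1 + 2 * real k) ^ Suc m - 1 \<le> (2 * (real k + 1)) ^ Suc m"
      proof -
        have "(1 + 2 * real k) ^ Suc m \<le> (2 * (real k + 1)) ^ Suc m" by (rule power_mono) auto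
        then show ?thesis by linarith
      qed
      also have "\<dots> \<le> (2 * (real k + 1)) ^ n" using m by (intro power_increasing) auto
      also have "\<dots> = 2 ^ n * (real k + 1) ^ n" by (rule power_mult_distrib)
      finally have "((1 + 2 * real k) ^ Suc m - 1) * norm (component k a) * ?w
          \<le> 2 ^ n * (real k + 1) ^ n * norm (component k a) * ?w"
        by (intro mult_right_mono) auto
      with weight_commutator_le[OF band_mult[OF component_in_level] norm_ge_zero, of N m k a x]
      show "norm2 (?c (component k a)) \<le> 2 ^ n * ((real k + 1) ^ n * norm (component k a)) * ?w"
        by (simp add: mult.assoc)
    qed
    also have "\<dots> = 2 ^ n * (\<Sum>k\<le>K. (real k + 1) ^ n * norm (component k a)) * ?w"
      by (simp add: sum_distrib_left sum_distrib_right)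
    also have "\<dots> \<le> 2 ^ n * (commutator_const * sobolev_norm hat L (\<alpha> + real n + 1) (hat a)) * ?w"
      by (intro mult_right_mono mult_left_mono sum_weighted_norm_component_le a) auto
    finally show ?thesis by (simp add: mult.assoc)
  qed
  have "(\<lambda>K. norm2 (?c (proj K a))) \<longlonglongrightarrow> norm2 (?c a)"
    by (intro tendsto_norm tendsto_hat tendsto_intros bounded_linear.tendsto[OF bounded_linear_weight]
        proj_tendsto[OF a])
  then show ?thesis by (rule LIMSEQ_le_const2) (use bound in blast)
qed


section \<open>Sobolev norms of the unitaries generated by a self-adjoint element\<close>

text \<open>Throughout, \<open>B\<close> bounds the commutators of the weights of order at most \<open>n\<close> with \<open>a\<close>.\<close>

definition group_exp :: "'a \<Rightarrow> real \<Rightarrow> 'a" where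
  "group_exp a t = exp ((\<i> * complex_of_real t) *\<^sub>C a)"

lemma group_exp_scaleR: "group_exp a t = exp (t *\<^sub>R (\<i> *\<^sub>C a))"
  by (simp add: group_exp_def scaleR_scaleC scaleC_scaleC mult.commute)

lemma group_exp_0 [simp]: "group_exp a 0 = 1" by (simp add: group_exp_scaleR)

lemma group_exp_inverse: "group_exp a (- t) * group_exp a t = 1"
  using exp_minus_inverse[of "- (t *\<^sub>R (\<i> *\<^sub>C a))"] by (simp add: group_exp_scaleR)

lemma star_group_exp: "star a = a \<Longrightarrow> star (group_exp a t) = group_exp a (- t)"
  by (simp add: group_exp_def star_exp star_scaleC)

lemma group_exp_derivative: "(group_exp a has_vector_derivative (\<i> *\<^sub>C a) * group_exp a t) (at t)"
  unfolding group_exp_scaleR [abs_def] by (rule exp_scaleR_has_vector_derivative_left)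

lemma group_exp_derivative_minus:
  "((\<lambda>t. group_exp a (- t)) has_vector_derivative - (group_exp a (- t) * (\<i> *\<^sub>C a))) (at t)"
proof -
  have "((\<lambda>t. exp (t *\<^sub>R (- (\<i> *\<^sub>C a)))) has_vector_derivative exp (t *\<^sub>R (- (\<i> *\<^sub>C a))) * (- (\<i> *\<^sub>C a))) (at t)"
    by (rule exp_scaleR_has_vector_derivative_right)
  then show ?thesis by (simp add: group_exp_scaleR [abs_def])
qed

lemma norm2_group_exp_mult:
  "star a = a \<Longrightarrow> norm2 (group_exp a t * x) = norm2 x"
  by (rule norm2_mult_unitary) (simp add: star_group_exp group_exp_inverse)

lemma norm_increment_le:
  fixes f :: "real \<Rightarrow> 'b::real_normed_vector"
  assumes der: "\<And>r. (f has_vector_derivative f' r) (at r)"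
    and bd: "\<And>r. r \<in> closed_segment s t \<Longrightarrow> norm (f' r) \<le> M"
  shows "norm (f t - f s) \<le> M * \<bar>t - s\<bar>"
proof -
  have "norm (f t - f s) \<le> M * norm (t - s)"
  proof (rule differentiable_bound[where S = "closed_segment s t" and f' = "\<lambda>r h. h *\<^sub>R f' r"])
    show "(f has_derivative (\<lambda>h. h *\<^sub>R f' r)) (at r within closed_segment s t)" for r
      using der[of r] unfolding has_vector_derivative_def by (rule has_derivative_at_withinI)
    show "onorm (\<lambda>h. h *\<^sub>R f' r) \<le> M" if "r \<in> closed_segment s t" for r
      by (rule onorm_le) (use mult_right_mono[OF bd[OF that] abs_ge_zero] in \<open>simp add: mult.commute\<close>)
  qed auto
  then show ?thesis by simp
qed

text \<open>Differentiate \<open>r \<mapsto> u\<^bsub>-r\<^esub> W u\<^sub>r\<close> for a weight \<open>W\<close> and the unitaries \<open>u\<^sub>r\<close>: the derivative contains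
  only the commutator of \<open>W\<close> with \<open>a\<close>, which is of one order less.\<close>

lemma norm2_weight_group_exp_le:
  assumes sa: "star a = a" and B: "B \<ge> 0"
    and comm: "\<And>m x. m < n \<Longrightarrow> norm2 (weight N (Suc m) (a * x) - a * weight N (Suc m) x) \<le> B * norm2 (weight N m x)"
  shows "m \<le> n \<Longrightarrow> norm2 (weight N m (group_exp a t)) \<le> (1 + B * \<bar>t\<bar>) ^ m"
proof (induction m arbitrary: t)
  case 0
  show ?case using norm2_group_exp_mult[OF sa, of t 1] by simp
next
  case (Suc m)
  let ?u = "group_exp a" and ?W = "weight N (Suc m)"
  define v' where "v' r = ?u (- r) * (\<i> *\<^sub>C (?W (a * ?u r) - a * ?W (?u r)))" for r
  have der: "((\<lambda>r. hat (?u (- r) * ?W (?u r))) has_vector_derivative hat (v' r)) (at r)" for r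
  proof -
    have "((\<lambda>r. ?W (?u r)) has_vector_derivative ?W ((\<i> *\<^sub>C a) * ?u r)) (at r)"
      by (rule bounded_linear.has_vector_derivative[OF bounded_linear_weight group_exp_derivative])
    from has_vector_derivative_mult[OF group_exp_derivative_minus this]
    have "((\<lambda>r. ?u (- r) * ?W (?u r)) has_vector_derivative v' r) (at r)"
      by (simp add: v'_def mult_scaleC_left mult_scaleC_right weight_scaleC scaleC_diff_right
          right_diff_distrib mult.assoc)
    then show ?thesis by (rule bounded_linear.has_vector_derivative[OF bounded_linear_hat])
  qed
  have "norm2 (v' r) \<le> B * (1 + B * \<bar>t\<bar>) ^ m" if "r \<in> closed_segment 0 t" for r
  proof -
    have "\<bar>r\<bar> \<le> \<bar>t\<bar>" using that by (auto simp: closed_segment_eq_real_ivl split: if_splits)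
    have "norm2 (v' r) = norm2 (?W (a * ?u r) - a * ?W (?u r))"
      by (simp add: v'_def norm2_group_exp_mult[OF sa] hat_scaleC norm_scaleC)
    also have "\<dots> \<le> B * norm2 (weight N m (?u r))" using Suc.prems by (intro comm) simp
    also have "\<dots> \<le> B * (1 + B * \<bar>r\<bar>) ^ m" using Suc by (intro mult_left_mono B) auto
    also have "\<dots> \<le> B * (1 + B * \<bar>t\<bar>) ^ m"
      using \<open>\<bar>r\<bar> \<le> \<bar>t\<bar>\<close> B by (intro mult_left_mono power_mono add_mono) auto
    finally show ?thesis .
  qed
  from norm_increment_le[where s = 0 and t = t, OF der this]
  have inc: "norm (hat (?u (- t) * ?W (?u t)) - hat 1) \<le> B * (1 + B * \<bar>t\<bar>) ^ m * \<bar>t\<bar>" by simp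
  have "norm2 (?W (?u t)) = norm2 (?u (- t) * ?W (?u t))"
    by (simp add: norm2_group_exp_mult[OF sa])
  also have "\<dots> \<le> norm2 1 + norm (hat (?u (- t) * ?W (?u t)) - hat 1)"
    using norm_triangle_ineq[of "hat 1" "hat (?u (- t) * ?W (?u t)) - hat 1"] by simp
  also have "\<dots> \<le> 1 + B * (1 + B * \<bar>t\<bar>) ^ m * \<bar>t\<bar>" using inc by simp
  also have "\<dots> \<le> (1 + B * \<bar>t\<bar>) ^ m + B * (1 + B * \<bar>t\<bar>) ^ m * \<bar>t\<bar>"
    using B by (intro add_right_mono one_le_power) simp
  also have "\<dots> = (1 + B * \<bar>t\<bar>) ^ Suc m" by (simp add: algebra_simps)
  finally show ?case .
qed

end

section \<open>The Fourier integral of the unitaries\<close>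

context rapid_decay_filtration
begin

lemma sobolev_inf_mem: "hat a \<in> sobolev_inf hat L \<Longrightarrow> s > 0 \<Longrightarrow> hat a \<in> sobolev_space hat L s"
  by (auto simp: sobolev_inf_def)

definition growth_const :: "nat \<Rightarrow> 'a \<Rightarrow> real" where
  "growth_const n a = 2 ^ n * commutator_const * sobolev_norm hat L (\<alpha> + real n + 1) (hat a)"

context
  fixes a :: 'a
  assumes sa: "star a = a" and ha: "\<And>n. hat a \<in> sobolev_space hat L (\<alpha> + real n + 1)"
begin

lemma growth_const_nonneg: "growth_const n a \<ge> 0"
  unfolding growth_const_def
  by (intro mult_nonneg_nonneg commutator_const_nonneg sobolev_norm_nonneg ha) simp

lemma growth_const_commutator:
  "m < n \<Longrightarrow> norm2 (weight N (Suc m) (a * x) - a * weight N (Suc m) x)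
     \<le> growth_const n a * norm2 (weight N m x)"
  unfolding growth_const_def by (rule weight_commutator_element_le[OF ha])

lemma partial_sobolev_group_exp_le:
  "partial_sobolev K n (group_exp a t) \<le> (1 + growth_const n a * \<bar>t\<bar>) ^ n"
  by (rule order_trans[OF partial_sobolev_le_weight[OF order_refl]
        norm2_weight_group_exp_le[OF sa growth_const_nonneg growth_const_commutator order_refl]])

lemmas sobolev_group_exp = sobolevI[OF partial_sobolev_group_exp_le]

lemma norm_group_exp: "norm (group_exp a t) = 1"
proof -
  have "(norm (group_exp a t))\<^sup>2 = 1"
    using norm_star_mult[of "group_exp a t"] by (simp add: star_group_exp[OF sa] group_exp_inverse)
  then show ?thesis using norm_ge_zero[of "group_exp a t"] unfolding power2_eq_1_iff by linarith
qed

context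
  fixes f :: "real \<Rightarrow> complex"
  assumes f: "test_function f"
begin

abbreviation curve :: "real \<Rightarrow> 'a" where
  "curve t \<equiv> fourier f t *\<^sub>C group_exp a t"

lemma sobolev_curve_le:
  "sob n (curve t) \<le> (1 + growth_const n a) ^ n * (cmod (fourier f t) * (1 + \<bar>t\<bar>) ^ n)"
proof -
  have B: "growth_const n a \<ge> 0" by (rule growth_const_nonneg)
  have "(1 + growth_const n a * \<bar>t\<bar>) ^ n \<le> ((1 + growth_const n a) * (1 + \<bar>t\<bar>)) ^ n"
    using B by (intro power_mono) (auto simp: algebra_simps)
  then have "sob n (group_exp a t) \<le> (1 + growth_const n a) ^ n * (1 + \<bar>t\<bar>) ^ n"
    using sobolev_group_exp(2)[where t = t and n = n] by (simp add: power_mult_distrib)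
  from mult_left_mono[OF this norm_ge_zero[of "fourier f t"]] show ?thesis
    by (simp add: sobolev_scaleC(2)[OF sobolev_group_exp(1)] mult_ac)
qed

lemma curve_tendsto: "(curve \<longlongrightarrow> curve t) (at t)"
proof (rule tendsto_scaleC)
  show "(fourier f \<longlongrightarrow> fourier f t) (at t)" using continuous_fourier[OF f] by (simp add: continuous_on_def)
  show "(group_exp a \<longlongrightarrow> group_exp a t) (at t)"
    using has_vector_derivative_continuous[OF group_exp_derivative] by (simp add: isCont_def)
qed

lemma curve_in_Sob: "hat (curve t) \<in> Sob n"
  by (rule sobolev_scaleC(1)[OF sobolev_group_exp(1)])

lemma curve_sobolev:
  "\<exists>D. seminormed_curve {x. hat x \<in> Sob n} (\<lambda>x. sob n x) curve D"
proof -
  obtain D where D: "\<And>t. cmod (fourier f t) * (1 + \<bar>t\<bar>) ^ n \<le> D / (1 + \<bar>t\<bar>)\<^sup>2"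
    using fourier_weighted_decay[OF f] by blast
  let ?B = "growth_const n a"
  have B: "?B \<ge> 0" by (rule growth_const_nonneg)
  have "seminormed_curve {x. hat x \<in> Sob n} (\<lambda>x. sob n x)
     curve ((1 + ?B) ^ n * D)"
  proof
    show "0 \<in> {x. hat x \<in> Sob n}"
      using sobolev_scaleC(1)[OF sobolev_group_exp(1)[of 0], of 0] by simp
    show "curve t \<in> {x. hat x \<in> Sob n}" for t by (simp add: curve_in_Sob)
    show "sob n (curve t) \<le> (1 + ?B) ^ n * D / (1 + \<bar>t\<bar>)\<^sup>2" for t
      using order_trans[OF sobolev_curve_le[where t = t and n = n] mult_left_mono[OF D[of t], of "(1 + ?B) ^ n"]] B by simp
    show "((\<lambda>t'. sob n (curve t' - curve t)) \<longlongrightarrow> 0) (at t)" for t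
    proof -
      obtain M where M: "\<And>s. cmod (fourier f s) * (1 + \<bar>s\<bar>) ^ (2 * n) \<le> M"
        using fourier_rapid_decay[OF f] by blast
      define E where "E = (1 + growth_const (2 * n) a) ^ (2 * n) * M"
      have E: "sob (2 * n) (curve s) \<le> E" for s
        using order_trans[OF sobolev_curve_le mult_left_mono[OF M]] growth_const_nonneg[of "2 * n"]
        by (simp add: E_def)
      have "norm (sob n (curve t' - curve t)) \<le> sqrt (norm (curve t' - curve t) * (E + E))" for t'
      proof -
        have x: "hat (curve t' - curve t) \<in> Sob (2 * n)"
          and le: "sob (2 * n) (curve t' - curve t) \<le> E + E"
          using sobolev_add[OF curve_in_Sob[of t' "2 * n"] sobolev_scaleC(1)[OF curve_in_Sob[of t "2 * n"], of "-1"]]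
            E[of t'] E[of t] sobolev_scaleC(2)[OF curve_in_Sob[of t "2 * n"], of "-1"]
          by (simp_all add: scaleC_minus_left scaleC_one)
        have "sob n (curve t' - curve t) \<le> sqrt (norm2 (curve t' - curve t) * sob (2 * n) (curve t' - curve t))"
          by (rule sobolev_interpolation(2)[OF x])
        also have "\<dots> \<le> sqrt (norm (curve t' - curve t) * (E + E))"
          by (intro real_sqrt_le_mono mult_mono norm2_le le sobolev_norm_nonneg x norm_ge_zero)
        finally show ?thesis using sobolev_norm_nonneg[OF sobolev_interpolation(1)[OF x]] by simp
      qed
      then have le: "\<forall>\<^sub>F t' in at t. norm (sob n (curve t' - curve t)) \<le> sqrt (norm (curve t' - curve t) * (E + E))"
        by (intro always_eventually) blast
      have "((\<lambda>t'. sqrt (norm (curve t' - curve t) * (E + E))) \<longlongrightarrow> sqrt (norm (curve t - curve t) * (E + E))) (at t)"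
        by (intro tendsto_intros curve_tendsto)
      then show ?thesis by (intro Lim_null_comparison[OF le]) simp
    qed
  qed (auto simp: sobolev_add sobolev_scaleC scaleR_scaleC)
  then show ?thesis by blast
qed

lemma curve_norm: "\<exists>D. seminormed_curve UNIV norm curve D"
proof -
  obtain D where D: "\<And>t. cmod (fourier f t) * (1 + \<bar>t\<bar>) ^ 0 \<le> D / (1 + \<bar>t\<bar>)\<^sup>2"
    using fourier_weighted_decay[OF f] by blast
  have "seminormed_curve UNIV norm curve D"
  proof
    show "((\<lambda>t'. norm (curve t' - curve t)) \<longlongrightarrow> 0) (at t)" for t
      by (intro tendsto_norm_zero LIM_zero curve_tendsto)
    show "norm (curve t) \<le> D / (1 + \<bar>t\<bar>)\<^sup>2" for t
      using D[of t] by (simp add: norm_scaleC norm_group_exp)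
  qed (auto simp: norm_triangle_ineq)
  then show ?thesis by blast
qed

text \<open>The Riemann sums are Cauchy in the C*-norm, so the corresponding scalar functions are uniformly
  Cauchy on the spectrum. Their pointwise limit there is known from Fourier inversion, hence it is
  also their uniform limit.\<close>

lemma riemann_sum_tendsto_functional_calculus:
  "(\<lambda>i. riemann_sum i curve) \<longlonglongrightarrow> (2 * pi) *\<^sub>R real_functional_calculus a f"
proof -
  obtain D where "seminormed_curve UNIV norm curve D" using curve_norm by blast
  then interpret A: seminormed_curve UNIV norm curve D .
  have "continuous_on (spectrum a) (\<lambda>z. f (Re z))"
    by (rule continuous_on_compose2[OF test_function_continuous[OF f, of UNIV]]) (auto intro: continuous_intros)
  then obtain b where b: "calculus_limit a (\<lambda>z. f (Re z)) b" using calculus_limit_exists[OF sa] by blast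
  have fb: "real_functional_calculus a f = b"
    unfolding real_functional_calculus_def by (rule functional_calculus_eqI[OF sa b])
  define S where "S i z = riemann_sum i (\<lambda>t. fourier f t * exp (\<i> * complex_of_real t * z))" for i z
  have S: "calculus_limit a (S i) (riemann_sum i curve)" for i
    unfolding S_def [abs_def] riemann_sum_def scaleR_scaleC[where 'a = 'a] scaleR_conv_of_real group_exp_def
    by (intro calculus_limit_sum calculus_limit_scaleC calculus_limit_exp sa)
  have Slim: "(\<lambda>i. S i x) \<longlonglongrightarrow> 2 * pi * f (Re x)" if x: "x \<in> spectrum a" for x
  proof -
    have xr: "x = complex_of_real (Re x)"
      using spectrum_self_adjoint_real[OF sa x] by (simp add: complex_eq_iff)
    have e: "\<i> * complex_of_real t * x = \<i> * complex_of_real (t * Re x)" for t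
      by (subst xr) simp
    obtain D' where D': "\<And>t. cmod (fourier f t) * (1 + \<bar>t\<bar>) ^ 0 \<le> D' / (1 + \<bar>t\<bar>)\<^sup>2"
      using fourier_weighted_decay[OF f] by blast
    have "(\<lambda>i. S i x) \<longlonglongrightarrow> (LINT t|lborel. fourier f t * iexp (t * Re x))"
      unfolding S_def e
    proof (rule riemann_sum_tendsto_integral)
      show "continuous_on UNIV (\<lambda>t. fourier f t * iexp (t * Re x))"
        by (intro continuous_intros continuous_fourier[OF f])
      show "cmod (fourier f t * iexp (t * Re x)) \<le> D' / (1 + \<bar>t\<bar>)\<^sup>2" for t
        using D'[of t] by (simp add: norm_mult del: of_real_mult)
    qed
    then show ?thesis by (simp only: fourier_inversion[OF f])
  qed
  have lim: "calculus_limit a (\<lambda>z. 2 * pi * f (Re z)) ((2 * pi) *\<^sub>R b)"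
    using calculus_limit_scaleC[OF b, of "complex_of_real (2 * pi)"] by (simp add: scaleR_scaleC)
  show ?thesis unfolding fb
  proof (rule metric_LIMSEQ_I)
    fix e :: real assume e: "e > 0"
    then obtain i0 where i0: "\<And>i k. i \<ge> i0 \<Longrightarrow> k \<ge> i0 \<Longrightarrow> norm (riemann_sum i curve - riemann_sum k curve) \<le> e / 2"
      using A.riemann_sum_Cauchy[of "e / 2"] by auto
    have "dist (riemann_sum i curve) ((2 * pi) *\<^sub>R b) < e" if i: "i \<ge> i0" for i
    proof -
      have "cmod (S i x - 2 * pi * f (Re x)) \<le> e / 2" if x: "x \<in> spectrum a" for x
      proof (rule LIMSEQ_le_const2)
        show "(\<lambda>k. cmod (S i x - S k x)) \<longlonglongrightarrow> cmod (S i x - 2 * pi * f (Re x))"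
          by (intro tendsto_intros Slim x)
        show "\<exists>N. \<forall>k\<ge>N. cmod (S i x - S k x) \<le> e / 2"
        proof (intro exI allI impI)
          fix k assume "i0 \<le> k"
          then show "cmod (S i x - S k x) \<le> e / 2"
            using cmod_le_calculus_limit[OF calculus_limit_diff[OF S S] x, of i k] i0[OF i] by force
        qed
      qed
      then have "norm (riemann_sum i curve - (2 * pi) *\<^sub>R b) \<le> e / 2"
        by (rule calculus_limit_norm_le[OF sa calculus_limit_diff[OF S lim]])
      with e show ?thesis by (simp add: dist_norm)
    qed
    then show "\<exists>i0. \<forall>i\<ge>i0. dist (riemann_sum i curve) ((2 * pi) *\<^sub>R b) < e" by blast
  qed
qed

text \<open>The Riemann sums \<open>T\<^sub>i\<close> are Cauchy in the Sobolev norm and converge to \<open>J\<close> in the C*-norm, hence in \<open>L\<^sup>2\<close>;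
  therefore they converge to \<open>J\<close> in the Sobolev norm. Their Sobolev norms are bounded, up to an error that
  tends to \<open>0\<close>, by the integral of the norm of the integrand.\<close>

lemma smooth_functional_calculus:
  defines "J \<equiv> (2 * pi) *\<^sub>R real_functional_calculus a f"
  shows "has_bochner_integral_in (Sob n) (sobolev_norm hat L (real n)) lborel
      (\<lambda>t. hat (curve t)) (hat J)"
    and "sob n J \<le>
      (1 + growth_const n a) ^ n * (LINT t|lborel. cmod (fourier f t) * (1 + \<bar>t\<bar>) ^ n)"
proof -
  let ?V = "Sob n" and ?N = "sobolev_norm hat L (real n)"
  obtain D where "seminormed_curve {x. hat x \<in> ?V} (\<lambda>x. ?N (hat x)) curve D" using curve_sobolev by blast
  then interpret S: seminormed_curve "{x. hat x \<in> ?V}" "\<lambda>x. ?N (hat x)" curve D .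
  define T where "T i = riemann_sum i curve" for i
  have TV: "hat (T i) \<in> ?V" for i using S.riemann_sum_in[of i] by (simp add: T_def)
  have TJ: "T \<longlonglongrightarrow> J" unfolding T_def [abs_def] J_def by (rule riemann_sum_tendsto_functional_calculus)
  \<comment> \<open>Lower semicontinuity: Cauchy in the Sobolev norm and convergent in \<open>L\<^sup>2\<close> implies
    convergent in the Sobolev norm.\<close>
  have close: "\<exists>i0. \<forall>i\<ge>i0. hat (T i - J) \<in> ?V \<and> ?N (hat (T i - J)) \<le> e" if e: "e > 0" for e
  proof -
    obtain i0 where i0: "\<And>i k. i \<ge> i0 \<Longrightarrow> k \<ge> i0 \<Longrightarrow> ?N (hat (T i - T k)) \<le> e"
      using S.riemann_sum_Cauchy[OF e] unfolding T_def by blast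
    have "partial_sobolev K n (T i - J) \<le> e" if i: "i \<ge> i0" for i K
    proof (rule LIMSEQ_le_const2)
      show "(\<lambda>k. partial_sobolev K n (T i - T k)) \<longlonglongrightarrow> partial_sobolev K n (T i - J)"
        by (intro partial_sobolev_tendsto tendsto_hat tendsto_intros TJ)
      show "\<exists>M. \<forall>k\<ge>M. partial_sobolev K n (T i - T k) \<le> e"
      proof (intro exI allI impI)
        fix k assume k: "i0 \<le> k"
        have "hat (T i - T k) \<in> ?V" using S.diff[of "T i" "T k"] TV by simp
        then show "partial_sobolev K n (T i - T k) \<le> e"
          using i0[OF i k] by (rule order_trans[OF partial_sobolev_le_norm])
      qed
    qed
    then show ?thesis using sobolevI by blast
  qed
  have JV: "hat J \<in> ?V"
  proof -
    obtain i where "hat (T i - J) \<in> ?V" using close[of 1] by auto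
    then show ?thesis using S.diff[of "T i" "T i - J"] TV by simp
  qed
  have diffV: "hat (T i - J) \<in> ?V" for i using S.diff[of "T i" J] TV JV by simp
  have NJ: "(\<lambda>i. ?N (hat (T i - J))) \<longlonglongrightarrow> 0"
  proof (rule LIMSEQ_I)
    fix e :: real assume "e > 0"
    then obtain i0 where "\<forall>i\<ge>i0. ?N (hat (T i - J)) \<le> e / 2" using close[of "e / 2"] by auto
    with \<open>e > 0\<close> show "\<exists>i0. \<forall>i\<ge>i0. norm (?N (hat (T i - J)) - 0) < e"
      using sobolev_norm_nonneg[OF diffV] by (intro exI[of _ i0]) force
  qed
  have step: "hat (grid_step i curve t) = grid_step i (\<lambda>t. hat (curve t)) t" for i t
    by (simp add: grid_step_def)
  have sumT: "riemann_sum i (\<lambda>t. hat (curve t)) = hat (T i)" for i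
    unfolding T_def by (rule riemann_sum_linear[symmetric]) (simp_all add: hat_add hat_scaleR)
  show "has_bochner_integral_in ?V ?N lborel (\<lambda>t. hat (curve t)) (hat J)"
    unfolding has_bochner_integral_in_def
  proof (intro conjI ballI exI[of _ "\<lambda>i. grid_step i (\<lambda>t. hat (curve t))"] allI)
    show "hat (curve t) \<in> ?V" for t using S.g_in[of t] by simp
    show "simple_integrable (grid_step i (\<lambda>t. hat (curve t)))" for i
      by (rule grid_step_simple)
    show "grid_step i (\<lambda>t. hat (curve t)) ` space lborel \<subseteq> ?V" for i
      using S.step_in[of i] by (auto simp: step[symmetric])
    show "(\<lambda>t. ?N (hat (curve t) - grid_step i (\<lambda>t. hat (curve t)) t)) \<in> borel_measurable lborel" for i
      using S.measurable_N_diff[of i] by (simp only: step[symmetric] hat_diff)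
    show "(\<lambda>i. \<integral>\<^sup>+ t. ennreal (?N (hat (curve t) - grid_step i (\<lambda>t. hat (curve t)) t)) \<partial>lborel) \<longlonglongrightarrow> 0"
      using S.integral_error_tendsto by (simp only: step[symmetric] hat_diff)
    show "(\<lambda>i. ?N (simple_integral (grid_step i (\<lambda>t. hat (curve t))) - hat J)) \<longlonglongrightarrow> 0"
      using NJ by (simp only: grid_step_simple(2) sumT hat_diff)
  qed (rule JV)
  have lim: "(\<lambda>i. ?N (hat (T i))) \<longlonglongrightarrow> ?N (hat J)"
  proof -
    have "norm (?N (hat (T i)) - ?N (hat J)) \<le> ?N (hat (T i - J))" for i
      using S.N_triangle[of "T i - J" J] S.N_triangle[of "J - T i" "T i"] S.N_commute[of J "T i"]
        S.diff[of J "T i"] TV JV diffV by simp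
    then have "(\<lambda>i. ?N (hat (T i)) - ?N (hat J)) \<longlonglongrightarrow> 0"
      by (intro Lim_null_comparison[OF _ NJ] always_eventually) blast
    then show ?thesis by (rule LIM_zero_cancel)
  qed
  have "ennreal (?N (hat J)) \<le> (\<integral>\<^sup>+ t. ennreal (?N (hat (curve t))) \<partial>lborel) + 0"
  proof (rule LIMSEQ_le)
    show "(\<lambda>i. ennreal (?N (hat (T i)))) \<longlonglongrightarrow> ennreal (?N (hat J))" by (rule tendsto_ennrealI[OF lim])
    show "(\<lambda>i. (\<integral>\<^sup>+ t. ennreal (?N (hat (curve t))) \<partial>lborel)
        + (\<integral>\<^sup>+ t. ennreal (?N (hat (curve t - grid_step i curve t))) \<partial>lborel))
        \<longlonglongrightarrow> (\<integral>\<^sup>+ t. ennreal (?N (hat (curve t))) \<partial>lborel) + 0"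
      by (intro tendsto_add tendsto_const S.integral_error_tendsto)
    show "\<exists>N. \<forall>i\<ge>N. ennreal (?N (hat (T i))) \<le> (\<integral>\<^sup>+ t. ennreal (?N (hat (curve t))) \<partial>lborel)
        + (\<integral>\<^sup>+ t. ennreal (?N (hat (curve t - grid_step i curve t))) \<partial>lborel)"
      using S.N_riemann_sum_le by (auto simp: T_def)
  qed
  also have "\<dots> \<le> (\<integral>\<^sup>+ t. ennreal ((1 + growth_const n a) ^ n * (cmod (fourier f t) * (1 + \<bar>t\<bar>) ^ n)) \<partial>lborel)"
    using sobolev_curve_le by (simp only: add_0_right) (intro nn_integral_mono ennreal_leI)
  also have "\<dots> = ennreal (LINT t|lborel. (1 + growth_const n a) ^ n * (cmod (fourier f t) * (1 + \<bar>t\<bar>) ^ n))"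
    using growth_const_nonneg
    by (intro nn_integral_eq_integral integrable_mult_right fourier_weighted_integrable[OF f]) auto
  finally show "?N (hat J) \<le> (1 + growth_const n a) ^ n * (LINT t|lborel. cmod (fourier f t) * (1 + \<bar>t\<bar>) ^ n)"
    using growth_const_nonneg by (subst (asm) ennreal_le_iff) (auto intro!: integral_nonneg_AE mult_nonneg_nonneg)
qed

lemma hat_functional_calculus_in_sobolev: "hat (real_functional_calculus a f) \<in> Sob n"
proof -
  have "hat ((2 * pi) *\<^sub>R real_functional_calculus a f) \<in> Sob n"
    using smooth_functional_calculus(1) by (simp add: has_bochner_integral_in_def)
  from sobolev_scaleC(1)[OF this, where c = "complex_of_real (1 / (2 * pi))"] show ?thesis
    by (simp add: scaleR_scaleC scaleC_scaleC scaleC_one)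
qed

lemma sobolev_norm_functional_calculus_le:
  "sob n (real_functional_calculus a f) \<le>
    (1 + 2 ^ n * commutator_const) ^ n * (1 + sobolev_norm hat L (\<alpha> + real n + 1) (hat a)) ^ n
      * (LINT t|lborel. cmod (fourier f t) * (1 + \<bar>t\<bar>) ^ n)"
proof -
  let ?A = "sobolev_norm hat L (\<alpha> + real n + 1) (hat a)" and ?c = "2 ^ n * commutator_const"
  let ?I = "LINT t|lborel. cmod (fourier f t) * (1 + \<bar>t\<bar>) ^ n"
  have A: "?A \<ge> 0" by (rule sobolev_norm_nonneg[OF ha])
  have c: "?c \<ge> 0" using commutator_const_nonneg by simp
  have "?I \<ge> 0" by (intro integral_nonneg_AE) auto
  have "sob n ((2 * pi) *\<^sub>R real_functional_calculus a f) =
      2 * pi * sob n (real_functional_calculus a f)"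
    using sobolev_scaleC(2)[OF hat_functional_calculus_in_sobolev, where c = "complex_of_real (2 * pi)" and n = n]
    by (simp add: scaleR_scaleC norm_mult)
  moreover have "1 * sob n (real_functional_calculus a f) \<le>
      2 * pi * sob n (real_functional_calculus a f)"
    using pi_gt3 by (intro mult_right_mono sobolev_norm_nonneg hat_functional_calculus_in_sobolev) simp
  ultimately have "sob n (real_functional_calculus a f) \<le> (1 + growth_const n a) ^ n * ?I"
    using smooth_functional_calculus(2)[of n] by simp
  also have "\<dots> \<le> ((1 + ?c) * (1 + ?A)) ^ n * ?I"
  proof (intro mult_right_mono power_mono)
    show "1 + growth_const n a \<le> (1 + ?c) * (1 + ?A)"
      using A c by (simp add: growth_const_def distrib_left distrib_right)
  qed (use growth_const_nonneg \<open>?I \<ge> 0\<close> in auto)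
  finally show ?thesis by (simp add: power_mult_distrib)
qed

end

end

lemma sobolev_space_mono:
  assumes "s \<le> r" "\<xi> \<in> sobolev_space hat L r"
  shows "\<xi> \<in> sobolev_space hat L s"
proof -
  have "summable (\<lambda>k. (real k + 1) powr (2 * s) * (norm (level_proj hat L k \<xi>))\<^sup>2)"
  proof (rule summable_comparison_test')
    show "summable (\<lambda>k. (real k + 1) powr (2 * r) * (norm (level_proj hat L k \<xi>))\<^sup>2)"
      using assms(2) by (simp add: sobolev_space_def)
    show "norm ((real k + 1) powr (2 * s) * (norm (level_proj hat L k \<xi>))\<^sup>2)
        \<le> (real k + 1) powr (2 * r) * (norm (level_proj hat L k \<xi>))\<^sup>2" for k
      using assms(1) by (simp add: mult_right_mono powr_mono)
  qed
  then show ?thesis by (simp add: sobolev_space_def)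
qed

lemma closed_under_smooth_calculus: "closed_under_smooth_calculus hat L"
  unfolding closed_under_smooth_calculus_def sobolev_inf_def
proof (intro allI impI INT_I)
  fix a f and s :: real
  assume a: "star a = a" "hat a \<in> (\<Inter>s\<in>{0<..}. sobolev_space hat L s)" "test_function f"
  define n where "n = nat \<lceil>s\<rceil>"
  have "s \<le> real n" by (simp add: n_def real_nat_ceiling_ge)
  moreover have "hat a \<in> sobolev_space hat L (\<alpha> + real m + 1)" for m
    using a(2) \<alpha>_pos by auto
  ultimately show "hat (real_functional_calculus a f) \<in> sobolev_space hat L s"
    using hat_functional_calculus_in_sobolev[OF a(1) _ a(3)] by (blast intro: sobolev_space_mono)
qed

end


section \<open>Smooth functional calculus\<close>

theorem theorem1p1:
  fixes \<rho> :: "'a::cstar_algebra \<Rightarrow> complex"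
    and hat :: "'a \<Rightarrow> 'h::complex_hilbert_space"
    and L :: "nat \<Rightarrow> 'a set"
  assumes "state \<rho>" and "tracial \<rho>" and "faithful \<rho>"
    and "gns_space \<rho> hat"
    and "filtration L" and "rapid_decay hat L"
  shows "closed_under_smooth_calculus hat L \<and>
    (\<forall>C \<alpha>. rapid_decay_constants hat L C \<alpha> \<longrightarrow>
      (\<forall>n::nat. \<exists>K>0. \<forall>a f. star a = a \<longrightarrow> hat a \<in> sobolev_inf hat L \<longrightarrow> test_function f \<longrightarrow>
        (\<exists>I. has_bochner_integral_in
               (sobolev_space hat L (real n)) (sobolev_norm hat L (real n)) lborel
               (\<lambda>t. hat (fourier f t *\<^sub>C exp ((\<i> * complex_of_real t) *\<^sub>C a))) I \<and>
             hat (real_functional_calculus a f) = (1 / (2 * pi)) *\<^sub>R I) \<and>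
        sobolev_norm hat L (real n) (hat (real_functional_calculus a f))
          \<le> K * (1 + sobolev_norm hat L (\<alpha> + real n + 1) (hat a)) ^ n
              * (LINT t|lborel. cmod (fourier f t) * (1 + \<bar>t\<bar>) ^ n)))"
proof (intro conjI allI impI)
  obtain C \<alpha> where "rapid_decay_constants hat L C \<alpha>"
    using assms(6) by (auto simp: rapid_decay_def)
  then interpret rapid_decay_filtration \<rho> hat L C \<alpha>
    using assms by unfold_locales
  show "closed_under_smooth_calculus hat L" by (rule closed_under_smooth_calculus)
next
  fix C \<alpha> and n :: nat
  assume "rapid_decay_constants hat L C \<alpha>"
  then interpret rapid_decay_filtration \<rho> hat L C \<alpha>
    using assms by unfold_locales
  show "\<exists>K>0. \<forall>a f. star a = a \<longrightarrow> hat a \<in> sobolev_inf hat L \<longrightarrow> test_function f \<longrightarrow>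
        (\<exists>I. has_bochner_integral_in
               (sobolev_space hat L (real n)) (sobolev_norm hat L (real n)) lborel
               (\<lambda>t. hat (fourier f t *\<^sub>C exp ((\<i> * complex_of_real t) *\<^sub>C a))) I \<and>
             hat (real_functional_calculus a f) = (1 / (2 * pi)) *\<^sub>R I) \<and>
        sobolev_norm hat L (real n) (hat (real_functional_calculus a f))
          \<le> K * (1 + sobolev_norm hat L (\<alpha> + real n + 1) (hat a)) ^ n
              * (LINT t|lborel. cmod (fourier f t) * (1 + \<bar>t\<bar>) ^ n)"
  proof (intro exI[of _ "(1 + 2 ^ n * commutator_const) ^ n"] conjI allI impI)
    show "0 < (1 + 2 ^ n * commutator_const) ^ n"
      using commutator_const_nonneg by (intro zero_less_power add_pos_nonneg) auto
    fix a f
    assume sa: "star a = a" and "hat a \<in> sobolev_inf hat L" and f: "test_function f"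
    then have ha: "hat a \<in> sobolev_space hat L (\<alpha> + real m + 1)" for m
      using \<alpha>_pos by (intro sobolev_inf_mem) auto
    have "has_bochner_integral_in (sobolev_space hat L (real n)) (sobolev_norm hat L (real n)) lborel
        (\<lambda>t. hat (fourier f t *\<^sub>C exp ((\<i> * complex_of_real t) *\<^sub>C a)))
        (hat ((2 * pi) *\<^sub>R real_functional_calculus a f))"
      using smooth_functional_calculus(1)[OF sa ha f] by (simp only: group_exp_def)
    moreover have "hat (real_functional_calculus a f) =
        (1 / (2 * pi)) *\<^sub>R hat ((2 * pi) *\<^sub>R real_functional_calculus a f)"
      by (simp add: hat_scaleR)
    ultimately show "\<exists>I. has_bochner_integral_in
          (sobolev_space hat L (real n)) (sobolev_norm hat L (real n)) lborel
          (\<lambda>t. hat (fourier f t *\<^sub>C exp ((\<i> * complex_of_real t) *\<^sub>C a))) I \<and>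
        hat (real_functional_calculus a f) = (1 / (2 * pi)) *\<^sub>R I" by blast
    show "sobolev_norm hat L (real n) (hat (real_functional_calculus a f))
        \<le> (1 + 2 ^ n * commutator_const) ^ n * (1 + sobolev_norm hat L (\<alpha> + real n + 1) (hat a)) ^ n
          * (LINT t|lborel. cmod (fourier f t) * (1 + \<bar>t\<bar>) ^ n)"
      by (rule sobolev_norm_functional_calculus_le[OF sa ha f])
  qed
qed

end
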